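(* Let $d\ge 1$, let $(\mathcal S,\|\cdot\|)$ be a normed space, $z>0$, $R$ a probability measure on $\mathcal S$, $\delta>0$, and let $H:\mathcal M_f\to\mathbb R\cup\{+\infty\}$ be an energy functional. Assume: (Mark moment) $\int_{\mathcal S} e^{\|m\|^{d+2\delta}}R(dm)<+\infty$. (Stability) There is a constant $c\ge 0$ such that $H(\gamma)\ge -c\,\langle\gamma,1+\|m\|^{d+\delta}\rangle$ for all $\gamma\in\mathcal M_f$. (Range) For every bounded Borel $\Lambda\subset\mathbb R^d$, every integer $t\ge 1$ and every $\gamma\in\mathcal M^t$, with $r=r(\gamma,\Lambda)=3\,\mathfrak d(\Lambda)+2\,\mathfrak l(t)+2\,\mathfrak m(\gamma_\Lambda)+1$, one has $$H_\Lambda(\gamma)=H\big(\gamma_{\Lambda\oplus B(0,r)}\big)-H\big(\gamma_{(\Lambda\oplus B(0,r))\setminus\Lambda}\big);$$ equivalently, the limit defining $H_\Lambda(\gamma)$ is already attained at the smallest $n\ge 1$ such that $\Lambda_n\supset\Lambda\oplus B(0,r)$. (Local stability) For every bounded Borel $\Lambda\subset\mathbb R^d$ and every integer $t\ge1$ there is a constant $c'=c'(\Lambda,t)\ge 0$ such that, for all $\xi\in\mathcal M^t$ and all $\gamma_\Lambda\in\mathcal M_\Lambda$, $H_\Lambda(\gamma_\Lambda\xi_{\Lambda^c})\ge -c'\langle\gamma_\Lambda,1+\|m\|^{d+\delta}\rangle$. Let $\bar P_n$, $n\ge1$, be the lattice-stationarised empirical fields associated with $H$. Then there exists a constant $a_3>0$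 such that $$\forall n\ge1,\qquad \mathscr I(\bar P_n\,|\,\pi^z)\le a_3 .$$
   Context: Configurations. $\mathcal E=\mathbb R^d\times\mathcal S$, with $\mathbb R^d$ carrying the Euclidean norm $|\cdot|$ and Borel $\sigma$-algebras on both factors. $\mathcal M$ is the set of integer-valued $\sigma$-finite measures $\gamma=\sum_i\delta_{(x_i,m_i)}$ on $\mathcal E$; only simple ones are considered and they are identified with their sets of atoms. $\mathcal M$ carries the $\sigma$-algebra generated by the counting maps $\gamma\mapsto \mathrm{Card}\{i:x_i\in\Lambda,\,m_i\in A\}$, $\Lambda\subset\mathbb R^d$ bounded Borel, $A\subset\mathcal S$ Borel. For $\Lambda\subset\mathbb R^d$, $\gamma_\Lambda$ is the restriction of $\gamma$ to $\Lambda\times\mathcal S$; $|\gamma|$ is the total mass; $\mathcal M_f=\{\gamma:|\gamma|<\infty\}$; for bounded $\Lambda$, $\mathcal M_\Lambda\subset\mathcal M_f$ is the set of finite configurations with $\gamma=\gamma_\Lambda$. Juxtaposition $\gamma_\Lambda\xi_{\Lambda^c}$ denotes union. $\langle\gamma,f\rangle=\sum_{(x,m)\in\gamma}f(x,m)$, and $\langle\gamma,1+\|m\|^{d+\delta}\rangle$ means $\langle\gamma,f\rangle$ with $f(x,m)=1+\|m\|^{d+\delta}$. $\mathfrak m(\gamma)=\sup_{(x,m)\in\gamma}\|m\|$ (equal to $0$ for the empty configuration). $B(y,r)$ is the open ball in $\mathbb R^d$. Tempered configurations. For $t\in\mathbb N$, $\mathcal M^t=\{\gamma\in\mathcal M:\langle\gamma_{B(0,l)},1+\|m\|^{d+\delta}\rangle\le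 t\,l^d\ \forall l\in\mathbb N,\ l\ge1\}$, and $\mathcal M^{temp}=\bigcup_{t\in\mathbb N}\mathcal M^t$. Constants. $\mathfrak l(t)=\frac12\big(2^{d+\delta}t\big)^{1/\delta}$; $\mathfrak d(\Lambda)=\inf\{R>0:\Lambda\subset B(0,R)\}$; $\Lambda\oplus B(0,r)=\{x\in\mathbb R^d:\exists y\in\Lambda,\ |y-x|\le r\}$; $\Lambda_n=[-n,n)^d$. Energy. An energy functional is a measurable map $H:\mathcal M_f\to\mathbb R\cup\{+\infty\}$, invariant under translations of the locations by vectors of $\mathbb R^d$, with $H(\text{empty configuration})=0$. For bounded Borel $\Lambda$ the conditional energy is $H_\Lambda(\gamma)=\lim_{n\to\infty}\big(H(\gamma_{\Lambda_n})-H(\gamma_{\Lambda_n\setminus\Lambda})\big)$, $\gamma\in\mathcal M^{temp}$ (with the convention $\infty-\infty=0$). Finite-volume measures. $\pi^z$ (resp. $\pi^z_\Lambda$) is the law of the Poisson point process on $\mathcal E$ with intensity $z\,dx\otimes R(dm)$ (resp. $z\,dx_\Lambda\otimes R(dm)$, $dx_\Lambda$ being Lebesgue measure on $\Lambda$). $P_n(d\gamma)=\frac{1}{Z_{\Lambda_n}}e^{-H(\gamma_{\Lambda_n})}\pi^z_{\Lambda_n}(d\gamma)$, with $Z_{\Lambda_n}$ the normalising constant. $\tilde P_n$ is the probability measure on $\mathcal M$ under which the configurations in the disjoint blocks $\Lambda_n+2n\kappa$, $\kappa\in\mathbb Z^d$, are independent, with identical distribution $P_n$ (up to translating the block back to $\Lambda_n$).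 $\theta_\kappa$ is the translation (of locations) by $\kappa\in\mathbb Z^d$, acting on $\mathcal M$. Then $$\bar P_n=\frac1{(2n)^d}\sum_{\kappa\in\Lambda_n\cap\mathbb Z^d}\tilde P_n\circ\theta_\kappa^{-1}.$$ Entropy. For probability measures $Q,Q'$ on $\mathcal M$ and bounded Borel $\Lambda$, let $Q_\Lambda,Q'_\Lambda$ be the images under $\gamma\mapsto\gamma_\Lambda$; $I_\Lambda(Q|Q')=\int\log f\,dQ_\Lambda$ if $Q_\Lambda\ll Q'_\Lambda$ with $f=dQ_\Lambda/dQ'_\Lambda$, and $+\infty$ otherwise. The specific entropy is $\mathscr I(Q|Q')=\lim_{n\to\infty}\frac1{|\Lambda_n|}I_{\Lambda_n}(Q|Q')$, where $|\Lambda_n|=(2n)^d$; it is well defined when $Q'=\pi^z$ and $Q$ is invariant under $(\theta_\kappa)_{\kappa\in\mathbb Z^d}$ (as is $\bar P_n$). *)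

theory Defs
  imports "HOL-Probability.Probability"
begin

section \<open>Marked configurations\<close>

text \<open>
  A simple configuration on \<open>\<real>\<^sup>d \<times> \<S>\<close> is identified with its set of atoms. An integer-valued
  simple measure is \<open>\<sigma>\<close>-finite iff it has countably many atoms.
\<close>

type_synonym ('d, 's) config = "((real ^ 'd) \<times> 's) set"

definition configs :: "('d::finite, 's) config set" where
  "configs = {\<gamma>. countable \<gamma>}"

definition configs_fin :: "('d::finite, 's) config set" where
  "configs_fin = {\<gamma>. finite \<gamma>}"

definition restr :: "(real ^ 'd::finite) set \<Rightarrow> ('d, 's) config \<Rightarrow> ('d, 's) config" where
  "restr \<Lambda> \<gamma> = \<gamma> \<inter> (\<Lambda> \<times> UNIV)"

definition configs_in :: "(real ^ 'd::finite) set \<Rightarrow> ('d, 's) config set" where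
  "configs_in \<Lambda> = {\<gamma> \<in> configs_fin. restr \<Lambda> \<gamma> = \<gamma>}"

definition shift :: "real ^ 'd::finite \<Rightarrow> ('d, 's) config \<Rightarrow> ('d, 's) config" where
  "shift v \<gamma> = (\<lambda>(x, m). (x + v, m)) ` \<gamma>"

text \<open>Number of atoms in a set, possibly infinite.\<close>

definition cnt :: "('d::finite, 's) config \<Rightarrow> ((real ^ 'd) \<times> 's) set \<Rightarrow> ennreal" where
  "cnt \<gamma> B = emeasure (count_space UNIV) (\<gamma> \<inter> B)"

definition config_space :: "('d::finite, 's::real_normed_vector) config measure" where
  "config_space = sigma configs
     {(\<lambda>\<gamma>. cnt \<gamma> (\<Lambda> \<times> A)) -` U \<inter> configs | \<Lambda> A U.
        bounded \<Lambda> \<and> \<Lambda> \<in> sets borel \<and> A \<in> sets borel \<and> U \<in> sets borel}"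

text \<open>\<open>\<langle>\<gamma>, f\<rangle>\<close> for nonnegative \<open>f\<close>, as a possibly infinite sum over the atoms.\<close>

definition pairing :: "('d::finite, 's) config \<Rightarrow> ((real ^ 'd) \<times> 's \<Rightarrow> real) \<Rightarrow> ennreal" where
  "pairing \<gamma> f = (\<integral>\<^sup>+ p. ennreal (f p) \<partial>count_space \<gamma>)"

definition mark_weight :: "real \<Rightarrow> (real ^ 'd::finite) \<times> 's::real_normed_vector \<Rightarrow> real" where
  "mark_weight \<delta> = (\<lambda>(x, m). 1 + norm m powr (real CARD('d) + \<delta>))"

text \<open>
  Largest mark norm, with value 0 for the empty configuration. Being real-valued, it is only
  meaningful for configurations with bounded marks, in particular for finite ones.
\<close>

definition max_mark :: "('d::finite, 's::real_normed_vector) config \<Rightarrow> real" where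
  "max_mark \<gamma> = Sup (insert 0 ((\<lambda>(x, m). norm m) ` \<gamma>))"

definition tempered_t :: "real \<Rightarrow> nat \<Rightarrow> ('d::finite, 's::real_normed_vector) config set" where
  "tempered_t \<delta> t = {\<gamma> \<in> configs. \<forall>l::nat. l \<ge> 1 \<longrightarrow>
     pairing (restr (ball 0 (real l)) \<gamma>) (mark_weight \<delta>) \<le> ennreal (real t * real l ^ CARD('d))}"


section \<open>Geometric constants\<close>

definition box_n :: "nat \<Rightarrow> (real ^ 'd::finite) set" where
  "box_n n = {x. \<forall>i. - real n \<le> x $ i \<and> x $ i < real n}"

definition lattice_pts :: "(real ^ 'd::finite) set" where
  "lattice_pts = {\<kappa>. \<forall>i. \<kappa> $ i \<in> \<int>}"

definition frak_l :: "'d::finite itself \<Rightarrow> real \<Rightarrow> nat \<Rightarrow> real" where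
  "frak_l _ \<delta> t = 1 / 2 * (2 powr (real CARD('d) + \<delta>) * real t) powr (1 / \<delta>)"

definition frak_d :: "(real ^ 'd::finite) set \<Rightarrow> real" where
  "frak_d \<Lambda> = Inf {R. R > 0 \<and> \<Lambda> \<subseteq> ball 0 R}"

definition enlarge :: "(real ^ 'd::finite) set \<Rightarrow> real \<Rightarrow> (real ^ 'd) set" where
  "enlarge \<Lambda> r = {x. \<exists>y\<in>\<Lambda>. norm (y - x) \<le> r}"

definition range_r :: "real \<Rightarrow> nat \<Rightarrow> ('d::finite, 's::real_normed_vector) config
    \<Rightarrow> (real ^ 'd) set \<Rightarrow> real" where
  "range_r \<delta> t \<gamma> \<Lambda> =
     3 * frak_d \<Lambda> + 2 * frak_l TYPE('d) \<delta> t + 2 * max_mark (restr \<Lambda> \<gamma>) + 1"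


section \<open>Energy\<close>

text \<open>Energies are functions on all sets of atoms of which only the values on finite
  configurations matter.\<close>

definition energy_functional :: "(('d::finite, 's::real_normed_vector) config \<Rightarrow> ereal) \<Rightarrow> bool" where
  "energy_functional H \<longleftrightarrow>
     H \<in> borel_measurable (restrict_space config_space configs_fin) \<and>
     (\<forall>\<gamma>\<in>configs_fin. H \<gamma> \<noteq> -\<infinity>) \<and>
     (\<forall>\<gamma>\<in>configs_fin. \<forall>v. H (shift v \<gamma>) = H \<gamma>) \<and>
     H {} = 0"

text \<open>Subtraction with \<open>\<infinity> - \<infinity> = 0\<close>; the library has \<open>\<infinity> - \<infinity> = \<infinity>\<close> on \<open>ereal\<close>.\<close>

definition ediff :: "ereal \<Rightarrow> ereal \<Rightarrow> ereal" where
  "ediff a b = (if a = \<infinity> \<and> b = \<infinity> then 0 else a - b)"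

definition cond_energy_seq :: "(('d::finite, 's) config \<Rightarrow> ereal) \<Rightarrow> (real ^ 'd) set
    \<Rightarrow> ('d, 's) config \<Rightarrow> nat \<Rightarrow> ereal" where
  "cond_energy_seq H \<Lambda> \<gamma> n = ediff (H (restr (box_n n) \<gamma>)) (H (restr (box_n n - \<Lambda>) \<gamma>))"

definition cond_energy :: "(('d::finite, 's) config \<Rightarrow> ereal) \<Rightarrow> (real ^ 'd) set
    \<Rightarrow> ('d, 's) config \<Rightarrow> ereal" where
  "cond_energy H \<Lambda> \<gamma> = lim (cond_energy_seq H \<Lambda> \<gamma>)"

definition mark_moment :: "'d::finite itself \<Rightarrow> real \<Rightarrow> 's::real_normed_vector measure \<Rightarrow> bool" where
  "mark_moment _ \<delta> R \<longleftrightarrow>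
     (\<integral>\<^sup>+ m. ennreal (exp (norm m powr (real CARD('d) + 2 * \<delta>))) \<partial>R) < \<infinity>"

definition stable_energy :: "real \<Rightarrow> (('d::finite, 's::real_normed_vector) config \<Rightarrow> ereal) \<Rightarrow> bool" where
  "stable_energy \<delta> H \<longleftrightarrow> (\<exists>c::real. c \<ge> 0 \<and>
     (\<forall>\<gamma>\<in>configs_fin. H \<gamma> \<ge> - (ereal c * enn2ereal (pairing \<gamma> (mark_weight \<delta>)))))"

text \<open>The existence of the limit defining \<open>cond_energy\<close> is part of the range assumption.\<close>

definition range_condition :: "real \<Rightarrow> (('d::finite, 's::real_normed_vector) config \<Rightarrow> ereal) \<Rightarrow> bool" where
  "range_condition \<delta> H \<longleftrightarrow>
     (\<forall>\<Lambda> t \<gamma>. bounded \<Lambda> \<and> \<Lambda> \<in> sets borel \<and> t \<ge> 1 \<and> \<gamma> \<in> tempered_t \<delta> t \<longrightarrow>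
        (let r = range_r \<delta> t \<gamma> \<Lambda> in
         convergent (cond_energy_seq H \<Lambda> \<gamma>) \<and>
         cond_energy H \<Lambda> \<gamma> =
           ediff (H (restr (enlarge \<Lambda> r) \<gamma>)) (H (restr (enlarge \<Lambda> r - \<Lambda>) \<gamma>))))"

definition locally_stable :: "real \<Rightarrow> (('d::finite, 's::real_normed_vector) config \<Rightarrow> ereal) \<Rightarrow> bool" where
  "locally_stable \<delta> H \<longleftrightarrow>
     (\<forall>\<Lambda> t. bounded \<Lambda> \<and> \<Lambda> \<in> sets borel \<and> t \<ge> 1 \<longrightarrow>
        (\<exists>c'::real. c' \<ge> 0 \<and>
           (\<forall>\<xi>\<in>tempered_t \<delta> t. \<forall>\<gamma>\<in>configs_in \<Lambda>.
              cond_energy H \<Lambda> (\<gamma> \<union> restr (- \<Lambda>) \<xi>)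
                \<ge> - (ereal c' * enn2ereal (pairing \<gamma> (mark_weight \<delta>))))))"


section \<open>Poisson point processes\<close>

text \<open>
  The law of the Poisson point process with intensity \<open>\<mu>\<close>, where \<open>\<mu>\<close> is finite on rectangles
  over bounded sets. The counts are prescribed on such rectangles only: they form a semiring
  whose counting maps generate \<open>config_space\<close>, so this determines the law. For a general
  product-measurable set the counting map need not be measurable on \<open>config_space\<close>, because
  configurations need not be locally finite.
\<close>

definition poisson_law ::
  "((real ^ 'd::finite) \<times> 's::real_normed_vector) measure \<Rightarrow> ('d, 's) config measure \<Rightarrow> bool" where
  "poisson_law \<mu> P \<longleftrightarrow>
     prob_space P \<and> sets P = sets config_space \<and>
     (\<forall>\<Lambda> A. bounded \<Lambda> \<and> \<Lambda> \<in> sets borel \<and> A \<in> sets borel \<longrightarrow>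
        emeasure \<mu> (\<Lambda> \<times> A) < \<infinity> \<and>
        (\<forall>k::nat. measure P {\<gamma> \<in> space P. cnt \<gamma> (\<Lambda> \<times> A) = of_nat k} =
           measure \<mu> (\<Lambda> \<times> A) ^ k / fact k * exp (- measure \<mu> (\<Lambda> \<times> A)))) \<and>
     (\<forall>(N::nat) \<Lambda> A.
        (\<forall>i<N. bounded (\<Lambda> i) \<and> \<Lambda> i \<in> sets borel \<and> A i \<in> sets borel) \<and>
        disjoint_family_on (\<lambda>i. \<Lambda> i \<times> A i) {..<N} \<longrightarrow>
        prob_space.indep_vars P (\<lambda>_. borel) (\<lambda>i \<gamma>. cnt \<gamma> (\<Lambda> i \<times> A i)) {..<N})"

text \<open>The measure \<open>z dx\<^sub>\<Lambda> \<otimes> R(dm)\<close>.\<close>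

definition intensity :: "real \<Rightarrow> 's::real_normed_vector measure \<Rightarrow> (real ^ 'd::finite) set
    \<Rightarrow> ((real ^ 'd) \<times> 's) measure" where
  "intensity z R \<Lambda> = density lborel (\<lambda>x. ennreal z * indicator \<Lambda> x) \<Otimes>\<^sub>M R"


section \<open>Finite-volume measures and empirical fields\<close>

text \<open>
  Below, \<open>PP \<Lambda>\<close> stands for the Poisson law \<open>\<pi>\<^sup>z\<^sub>\<Lambda>\<close>.
\<close>

definition exp_minus :: "ereal \<Rightarrow> ennreal" where
  "exp_minus h = (case h of ereal x \<Rightarrow> ennreal (exp (- x)) | PInfty \<Rightarrow> 0 | MInfty \<Rightarrow> \<infinity>)"

text \<open>The indicator only removes infinite configurations, where \<open>H\<close> is meaningless and need not
  be measurable. Their restrictions to a bounded box are finite \<open>PP\<close>-almost surely.\<close>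

definition boltzmann :: "(('d::finite, 's) config \<Rightarrow> ereal) \<Rightarrow> ('d, 's) config \<Rightarrow> ennreal" where
  "boltzmann H \<gamma> = exp_minus (H \<gamma>) * indicator configs_fin \<gamma>"

definition partition_fun :: "(('d::finite, 's) config \<Rightarrow> ereal)
    \<Rightarrow> ((real ^ 'd) set \<Rightarrow> ('d, 's) config measure) \<Rightarrow> nat \<Rightarrow> ennreal" where
  "partition_fun H PP n = (\<integral>\<^sup>+ \<gamma>. boltzmann H (restr (box_n n) \<gamma>) \<partial>PP (box_n n))"

definition P_box :: "(('d::finite, 's) config \<Rightarrow> ereal)
    \<Rightarrow> ((real ^ 'd) set \<Rightarrow> ('d, 's) config measure) \<Rightarrow> nat \<Rightarrow> ('d, 's) config measure" where
  "P_box H PP n = density (PP (box_n n))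
     (\<lambda>\<gamma>. boltzmann H (restr (box_n n) \<gamma>) / partition_fun H PP n)"

text \<open>
  Gluing independent copies: the image of the product of copies of \<open>P_box\<close>, indexed by the
  lattice, under placing the \<open>\<kappa>\<close>-th copy into the block \<open>box_n n + 2 n \<kappa>\<close>. Restricting each
  copy to \<open>box_n n\<close> changes it on a null set only and makes the gluing map measurable.
\<close>

definition glue :: "nat \<Rightarrow> (real ^ 'd::finite \<Rightarrow> ('d, 's) config) \<Rightarrow> ('d, 's) config" where
  "glue n \<omega> = (\<Union>\<kappa>\<in>lattice_pts. shift ((2 * real n) *\<^sub>R \<kappa>) (restr (box_n n) (\<omega> \<kappa>)))"

definition P_tilde :: "(('d::finite, 's::real_normed_vector) config \<Rightarrow> ereal)
    \<Rightarrow> ((real ^ 'd) set \<Rightarrow> ('d, 's) config measure) \<Rightarrow> nat \<Rightarrow> ('d, 's) config measure" where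
  "P_tilde H PP n = distr (PiM lattice_pts (\<lambda>_. P_box H PP n)) config_space (glue n)"

definition P_bar :: "(('d::finite, 's::real_normed_vector) config \<Rightarrow> ereal)
    \<Rightarrow> ((real ^ 'd) set \<Rightarrow> ('d, 's) config measure) \<Rightarrow> nat \<Rightarrow> ('d, 's) config measure" where
  "P_bar H PP n = measure_of (space config_space) (sets config_space)
     (\<lambda>B. (\<Sum>\<kappa>\<in>box_n n \<inter> lattice_pts. emeasure (distr (P_tilde H PP n) config_space (shift \<kappa>)) B)
        / ennreal ((2 * real n) ^ CARD('d)))"


section \<open>Entropy\<close>

text \<open>
  Relative entropy of \<open>Q\<close> with respect to \<open>Q'\<close>. Note the argument order of the library's
  \<open>KL_divergence\<close>, where the reference measure comes first. The negative part of
  \<open>ln (dQ/dQ')\<close> is always \<open>Q\<close>-integrable, so a non-integrable logarithm means that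
  the integral is \<open>\<infinity>\<close>.
\<close>

definition rel_entropy :: "'a measure \<Rightarrow> 'a measure \<Rightarrow> ereal" where
  "rel_entropy Q Q' =
     (if absolutely_continuous Q' Q \<and> integrable Q (entropy_density (exp 1) Q' Q)
      then ereal (KL_divergence (exp 1) Q' Q) else \<infinity>)"

definition local_entropy :: "(real ^ 'd::finite) set \<Rightarrow> ('d, 's::real_normed_vector) config measure
    \<Rightarrow> ('d, 's) config measure \<Rightarrow> ereal" where
  "local_entropy \<Lambda> Q Q' =
     rel_entropy (distr Q config_space (restr \<Lambda>)) (distr Q' config_space (restr \<Lambda>))"

definition specific_entropy :: "('d::finite, 's::real_normed_vector) config measure
    \<Rightarrow> ('d, 's) config measure \<Rightarrow> ereal" where
  "specific_entropy Q Q' =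
     lim (\<lambda>n. local_entropy (box_n n) Q Q' / ereal ((2 * real n) ^ CARD('d)))"

end

theory Submission
  imports Defs
begin

text \<open>
  The Poisson process splits into independent Poisson processes over the tiles of any shifted tiling
  of space by boxes of side \<open>2 n\<close>. The empirical field has the same structure: a uniformly chosen
  lattice shift of a tiling with independent tiles, whose law is the finite-volume measure \<open>P\<^sub>n\<close>
  instead of the Poisson law \<open>\<pi>\<^sub>n\<close> of the box. Seen through a window, both are images under one map of
  finite product measures (\<open>poisson_view\<close>, \<open>P_bar_view\<close>), with density \<open>dP\<^sub>n/d\<pi>\<^sub>n\<close> for each tile.

  Passing to images decreases relative entropy, so the entropy in the window is at most the number of
  tiles meeting the window times \<open>I(P\<^sub>n | \<pi>\<^sub>n)\<close>. Conversely, Gibbs' inequality with the average over the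
  shifts of the product densities of the tiles inside the window bounds it from below by the number
  of these tiles times \<open>I(P\<^sub>n | \<pi>\<^sub>n)\<close>, up to the logarithm of the number of shifts
  (\<open>local_entropy_bounds\<close>). Tiles on the boundary of a large window are negligible, so the limit
  defining the specific entropy exists and equals \<open>I(P\<^sub>n | \<pi>\<^sub>n) / (2 n)\<^sup>d\<close> (\<open>specific_entropy_eq\<close>).

  It remains to bound \<open>I(P\<^sub>n | \<pi>\<^sub>n)\<close> by a multiple of the volume, uniformly in \<open>n\<close>. By concavity of the
  logarithm it is at most the logarithm of the second moment of the density \<open>e\<^sup>-\<^sup>H / Z\<close>. The partition
  function is at least the probability of an empty box, which is exponential in the volume, and by
  stability \<open>e\<^sup>-\<^sup>2\<^sup>H\<close> is dominated by the exponential of a sum over the points. The mark moment makes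
  the mean of the latter finite and exponential in the volume (\<open>P_box_density\<close>).

  All statements on Poisson processes are derived from the prescribed counts on rectangles. The
  main step is to cut overlapping rectangles into disjoint ones (\<open>count_event_refinement\<close>), which
  yields uniqueness of Poisson laws and their independence over disjoint tiles
  (\<open>poisson_law_unique\<close>, \<open>poisson_law_blocks\<close>).
\<close>

section \<open>Counting atoms\<close>

lemma cnt_Union:
  assumes "finite I" "disjoint_family_on B I"
  shows "cnt \<gamma> (\<Union>i\<in>I. B i) = (\<Sum>i\<in>I. cnt \<gamma> (B i))"
proof -
  have "(\<Sum>i\<in>I. emeasure (count_space UNIV) (\<gamma> \<inter> B i)) = emeasure (count_space UNIV) (\<Union>i\<in>I. \<gamma> \<inter> B i)"
    using assms by (intro sum_emeasure) (auto simp: disjoint_family_on_def)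
  then show ?thesis
    unfolding cnt_def Int_UN_distrib by (rule sym)
qed

lemma cnt_Union_config:
  assumes "finite I" "disjoint_family_on G I"
  shows "cnt (\<Union>i\<in>I. G i) B = (\<Sum>i\<in>I. cnt (G i) B)"
proof -
  have "(\<Sum>i\<in>I. emeasure (count_space UNIV) (G i \<inter> B)) = emeasure (count_space UNIV) (\<Union>i\<in>I. G i \<inter> B)"
    using assms by (intro sum_emeasure) (auto simp: disjoint_family_on_def)
  moreover have "(\<Union>i\<in>I. G i) \<inter> B = (\<Union>i\<in>I. G i \<inter> B)"
    by blast
  ultimately show ?thesis
    unfolding cnt_def by metis
qed

lemma cnt_finite: "finite \<gamma> \<Longrightarrow> cnt \<gamma> B = of_nat (card (\<gamma> \<inter> B))"
  by (simp add: cnt_def emeasure_count_space_finite)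

lemma restr_restr [simp]: "restr A (restr B \<gamma>) = restr (A \<inter> B) \<gamma>"
  by (auto simp: restr_def)

lemma cnt_restr: "cnt (restr C \<gamma>) (\<Delta> \<times> A) = cnt \<gamma> ((C \<inter> \<Delta>) \<times> A)"
  by (auto simp: cnt_def restr_def intro!: arg_cong[where f="emeasure _"])

lemma inj_shift_atom: "inj_on (\<lambda>(x::real^'d, m). (x + v, m)) S"
  by (auto simp: inj_on_def)

lemma cnt_shift: "cnt (shift v \<gamma>) (\<Delta> \<times> A) = cnt \<gamma> ({x. x + v \<in> \<Delta>} \<times> A)"
proof -
  have "shift v \<gamma> \<inter> (\<Delta> \<times> A) = (\<lambda>(x, m). (x + v, m)) ` (\<gamma> \<inter> ({x. x + v \<in> \<Delta>} \<times> A))"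
    by (auto simp: shift_def)
  moreover have "emeasure (count_space UNIV) ((\<lambda>(x, m). (x + v, m)) ` G)
      = emeasure (count_space UNIV) G" for G :: "('a, 'b) config"
    using inj_shift_atom[of v G]
    by (simp add: emeasure_count_space card_image finite_image_iff)
  ultimately show ?thesis
    by (simp add: cnt_def)
qed

lemma shift_shift [simp]: "shift v (shift w \<gamma>) = shift (w + v) \<gamma>"
  by (force simp: shift_def add.assoc)

lemma shift_0 [simp]: "shift 0 \<gamma> = \<gamma>"
  by (auto simp: shift_def)

lemma restr_shift: "restr C (shift v \<gamma>) = shift v (restr {x. x + v \<in> C} \<gamma>)"
  by (auto simp: shift_def restr_def)

lemma shift_UN: "shift v (\<Union>i\<in>I. G i) = (\<Union>i\<in>I. shift v (G i))"
  by (auto simp: shift_def)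

lemma restr_UN: "restr C (\<Union>i\<in>I. G i) = (\<Union>i\<in>I. restr C (G i))"
  by (auto simp: restr_def)

section \<open>Measurability on the space of configurations\<close>

lemma space_config_space [simp]: "space config_space = configs"
  unfolding config_space_def by (rule space_measure_of) auto

lemma sets_config_space:
  "sets (config_space :: ('d::finite, 's::real_normed_vector) config measure) =
    sigma_sets configs {(\<lambda>\<gamma>. cnt \<gamma> (\<Lambda> \<times> A)) -` U \<inter> configs | \<Lambda> A U.
        bounded \<Lambda> \<and> \<Lambda> \<in> sets borel \<and> A \<in> sets borel \<and> U \<in> sets borel}"
  unfolding config_space_def by (rule sets_measure_of) auto

lemma measurable_cnt:
  assumes "bounded \<Lambda>" "\<Lambda> \<in> sets borel" "A \<in> sets borel"
  shows "(\<lambda>\<gamma>. cnt \<gamma> (\<Lambda> \<times> A)) \<in> borel_measurable config_space"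
  using assms by (auto simp: measurable_def sets_config_space intro!: sigma_sets.Basic)

lemma measurable_into_config_space:
  fixes f :: "'a \<Rightarrow> ('d::finite, 's::real_normed_vector) config"
  assumes "\<And>x. x \<in> space M \<Longrightarrow> f x \<in> configs"
    and "\<And>\<Lambda> A. bounded \<Lambda> \<Longrightarrow> \<Lambda> \<in> sets borel \<Longrightarrow> A \<in> sets borel \<Longrightarrow>
      (\<lambda>x. cnt (f x) (\<Lambda> \<times> A)) \<in> borel_measurable M"
  shows "f \<in> measurable M config_space"
  unfolding config_space_def
proof (rule measurable_measure_of)
  fix Y :: "('d, 's) config set" assume "Y \<in> {(\<lambda>\<gamma>. cnt \<gamma> (\<Lambda> \<times> A)) -` U \<inter> configs | \<Lambda> A U.
        bounded \<Lambda> \<and> \<Lambda> \<in> sets borel \<and> A \<in> sets borel \<and> U \<in> sets borel}"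
  then obtain \<Lambda> A U where *: "Y = (\<lambda>\<gamma>. cnt \<gamma> (\<Lambda> \<times> A)) -` U \<inter> configs"
      "bounded \<Lambda>" "\<Lambda> \<in> sets borel" "A \<in> sets borel" "U \<in> sets borel"
    by blast
  have "f -` Y \<inter> space M = (\<lambda>x. cnt (f x) (\<Lambda> \<times> A)) -` U \<inter> space M"
    using assms(1) by (auto simp: *(1))
  also have "\<dots> \<in> sets M"
    using assms(2)[OF *(2-4)] *(5) by (rule measurable_sets)
  finally show "f -` Y \<inter> space M \<in> sets M" .
qed (use assms(1) in auto)

lemma configs_restr: "\<gamma> \<in> configs \<Longrightarrow> restr C \<gamma> \<in> configs"
  by (auto simp: configs_def restr_def)

lemma configs_shift: "\<gamma> \<in> configs \<Longrightarrow> shift v \<gamma> \<in> configs"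
  by (auto simp: configs_def shift_def)

lemma measurable_restr:
  assumes "C \<in> sets borel"
  shows "restr C \<in> measurable config_space config_space"
  using assms
  by (intro measurable_into_config_space) 
     (auto simp: cnt_restr configs_restr intro!: measurable_cnt bounded_Int)

lemma shifted_borel:
  fixes v :: "'a::euclidean_space"
  assumes "\<Delta> \<in> sets borel" shows "{x. x + v \<in> \<Delta>} \<in> sets borel"
proof -
  have "(\<lambda>x. x + v) \<in> borel_measurable borel"
    by measurable
  from measurable_sets[OF this assms] show ?thesis
    by (simp add: vimage_def)
qed

lemma shifted_bounded:
  fixes v :: "'a::real_normed_vector"
  assumes "bounded \<Delta>" shows "bounded {x. x + v \<in> \<Delta>}"
proof (rule bounded_subset)
  show "bounded ((\<lambda>x. x - v) ` \<Delta>)"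
    using bounded_translation_minus[OF assms] by simp
  show "{x. x + v \<in> \<Delta>} \<subseteq> (\<lambda>x. x - v) ` \<Delta>"
    by (auto simp: image_iff intro!: bexI[of _ "_ + v"])
qed

lemma measurable_shift: "shift v \<in> measurable config_space config_space"
  by (intro measurable_into_config_space)
     (auto simp: cnt_shift configs_shift intro!: measurable_cnt shifted_borel shifted_bounded)

lemma box_n_borel: "box_n n \<in> sets borel"
proof -
  have "box_n n = (\<Inter>i. {x::real^'a. - real n \<le> x $ i} \<inter> {x. x $ i < real n})"
    by (auto simp: box_n_def)
  also have "\<dots> \<in> sets borel"
    by (intro sets.countable_INT'' sets.Int borel_closed borel_open closed_Collect_le open_Collect_less continuous_intros)
       auto
  finally show ?thesis .
qed

lemma box_n_bounded: "bounded (box_n n :: (real^'d::finite) set)"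
proof (rule bounded_subset[OF bounded_cbox])
  show "box_n n \<subseteq> cbox (\<chi> i. - real n) (\<chi> i. real n)"
    by (auto simp: box_n_def mem_box_cart less_imp_le)
qed

lemma box_n_mono: "m \<le> n \<Longrightarrow> box_n m \<subseteq> box_n n"
  by (auto simp: box_n_def) (smt (verit) of_nat_mono)+

lemma UN_box_n: "(\<Union>n. box_n n) = (UNIV :: (real^'d::finite) set)"
proof -
  have "\<exists>n. x \<in> box_n n" for x :: "real^'d"
  proof -
    obtain n where n: "norm x < real n"
      using reals_Archimedean2 by blast
    have "\<bar>x $ i\<bar> < real n" for i
      using component_le_norm_cart[of x i] n by linarith
    then show ?thesis
      by (auto simp: box_n_def abs_less_iff intro!: exI[of _ n]) (smt (verit))
  qed
  then show ?thesis by auto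
qed

text \<open>
  Only counts over bounded sets are measurable by definition. The total number of points is their
  supremum over growing boxes.
\<close>

lemma configs_fin_sets: "configs_fin \<in> sets (config_space :: ('d::finite, 's::real_normed_vector) config measure)"
proof -
  have SUP: "(SUP n. cnt \<gamma> (box_n n \<times> UNIV)) = cnt \<gamma> UNIV" for \<gamma> :: "('d, 's) config"
  proof -
    have "(SUP n. emeasure (count_space UNIV) (\<gamma> \<inter> (box_n n \<times> UNIV)))
        = emeasure (count_space UNIV) (\<Union>n. \<gamma> \<inter> (box_n n \<times> UNIV))"
    proof (rule SUP_emeasure_incseq)
      show "incseq (\<lambda>n. \<gamma> \<inter> (box_n n \<times> UNIV))"
        using box_n_mono by (fastforce simp: incseq_def)
    qed simp
    also have "(\<Union>n. \<gamma> \<inter> (box_n n \<times> UNIV)) = \<gamma> \<inter> UNIV"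
      using UN_box_n by auto
    finally show ?thesis by (simp add: cnt_def)
  qed
  have "configs_fin = {\<gamma> \<in> space (config_space :: ('d, 's) config measure). (SUP n. cnt \<gamma> (box_n n \<times> (UNIV::'s set))) < (\<infinity>::ennreal)}"
    unfolding SUP configs_fin_def
    by (auto simp: configs_def cnt_def countable_finite emeasure_count_space of_nat_less_top split: if_splits)
  also have "\<dots> \<in> sets config_space"
  proof -
    have [measurable]: "(\<lambda>\<gamma>. cnt \<gamma> (box_n n \<times> (UNIV::'s set))) \<in> borel_measurable config_space" for n
      by (intro measurable_cnt box_n_bounded box_n_borel) auto
    show ?thesis by measurable
  qed
  finally show ?thesis .
qed

section \<open>Poisson laws are determined by their counts on rectangles\<close>

type_synonym ('d, 's) test = "(real ^ 'd) set \<times> 's set \<times> ennreal set"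

abbreviation test_set :: "('d::finite, 's::real_normed_vector) test \<Rightarrow> bool" where
  "test_set t \<equiv> bounded (fst t) \<and> fst t \<in> sets borel \<and> fst (snd t) \<in> sets borel \<and> snd (snd t) \<in> sets borel"

text \<open>
  Joint count constraints, one for each triple (location set, mark set, admissible values). In
  contrast to the generators of \<open>config_space\<close> they are closed under intersection, so that laws
  and independence can be tested on them.
\<close>

definition count_event ::
  "('d::finite, 's::real_normed_vector) test set \<Rightarrow> ('d, 's) config set" where
  "count_event F = {\<gamma> \<in> configs. \<forall>t\<in>F. cnt \<gamma> (fst t \<times> fst (snd t)) \<in> snd (snd t)}"

definition count_events :: "('d::finite, 's::real_normed_vector) config set set" where
  "count_events = {count_event F | F. finite F \<and> (\<forall>t\<in>F. test_set t)}"

lemma Int_stable_count_events: "Int_stable count_events"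
proof (rule Int_stableI)
  fix a b :: "('d::finite, 's::real_normed_vector) config set"
  assume "a \<in> count_events" "b \<in> count_events"
  then obtain F G where "a = count_event F" "b = count_event G" "finite F" "finite G"
      "\<forall>t\<in>F. test_set t" "\<forall>t\<in>G. test_set t"
    unfolding count_events_def by blast
  moreover have "count_event F \<inter> count_event G = count_event (F \<union> G)"
    by (auto simp: count_event_def)
  ultimately show "a \<inter> b \<in> count_events"
    unfolding count_events_def by (intro CollectI exI[of _ "F \<union> G"]) auto
qed

lemma configs_in_count_events: "configs \<in> count_events"
  unfolding count_events_def count_event_def by (intro CollectI exI[of _ "{}"]) auto

lemma count_events_Pow: "count_events \<subseteq> Pow configs"
  by (auto simp: count_events_def count_event_def)

lemma count_event_sets:
  assumes "finite F" "\<forall>t\<in>F. test_set t"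
  shows "count_event F \<in> sets config_space"
proof -
  have "{\<gamma> \<in> space config_space. \<forall>t\<in>F. cnt \<gamma> (fst t \<times> fst (snd t)) \<in> snd (snd t)} \<in> sets config_space"
  proof (intro sets.sets_Collect_finite_All assms(1))
    fix t assume "t \<in> F"
    then have t: "test_set t" using assms by blast
    then have "(\<lambda>\<gamma>. cnt \<gamma> (fst t \<times> fst (snd t))) -` snd (snd t) \<inter> space config_space \<in> sets config_space"
      by (intro measurable_sets[OF measurable_cnt]) auto
    then show "{\<gamma> \<in> space config_space. cnt \<gamma> (fst t \<times> fst (snd t)) \<in> snd (snd t)} \<in> sets config_space"
      by (simp add: vimage_def Int_def conj_commute)
  qed
  then show ?thesis by (simp add: count_event_def)
qed

lemma sets_config_space_count_events:
  "sets (config_space :: ('d::finite, 's::real_normed_vector) config measure) = sigma_sets configs count_events"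
proof (rule antisym)
  show "sets (config_space :: ('d, 's) config measure) \<subseteq> sigma_sets configs count_events"
    unfolding sets_config_space
  proof (rule sigma_sets_mono', safe)
    fix \<Lambda> :: "(real^'d) set" and A :: "'s set" and U :: "ennreal set"
    assume *: "bounded \<Lambda>" "\<Lambda> \<in> sets borel" "A \<in> sets borel" "U \<in> sets borel"
    show "(\<lambda>\<gamma>. cnt \<gamma> (\<Lambda> \<times> A)) -` U \<inter> configs \<in> count_events"
      unfolding count_events_def count_event_def
      using * by (intro CollectI exI[of _ "{(\<Lambda>, A, U)}"]) auto
  qed
  show "sigma_sets configs count_events \<subseteq> sets (config_space :: ('d, 's) config measure)"
    using sets.sigma_sets_subset[of count_events config_space] count_event_sets
    by (auto simp: count_events_def)
qed

text \<open>
  A Poisson law prescribes joint laws of counts on disjoint rectangles only, while the rectangles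
  of a count event may overlap. Cutting along both families of sides repairs this: a location is
  classified by the set of tests whose location set contains it, a mark by the set of tests whose
  mark set contains it, and a pair \<open>(J, K)\<close> of sets of tests indexes the rectangle of all points
  classified in this way. Each original count is the sum of the counts of the pieces inside it,
  hence the event becomes a condition \<open>W\<close> on the vector of counts of disjoint rectangles.
\<close>

lemma count_event_refinement:
  fixes F :: "('d::finite, 's::real_normed_vector) test set"
  assumes "finite F" "\<forall>t\<in>F. test_set t"
  obtains I :: "(('d, 's) test set \<times> ('d, 's) test set) set" and L M W
  where "finite I" "\<forall>i\<in>I. bounded (L i) \<and> L i \<in> sets borel \<and> M i \<in> sets borel"
    "disjoint_family_on (\<lambda>i. L i \<times> M i) I" "W \<in> sets (PiM I (\<lambda>_. borel))"
    "\<forall>\<gamma>. \<gamma> \<in> count_event F \<longleftrightarrow> \<gamma> \<in> configs \<and> (\<lambda>i\<in>I. cnt \<gamma> (L i \<times> M i)) \<in> W"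
proof
  \<comment> \<open>A nonempty first class keeps the pieces bounded: they lie in the location set of any of its tests.\<close>
  define I where "I = (Pow F - {{}}) \<times> Pow F"
  define L where "L i = {x. {t\<in>F. x \<in> fst t} = fst i}" 
    for i :: "('d, 's) test set \<times> ('d, 's) test set"
  define M where "M i = {m. {t\<in>F. m \<in> fst (snd t)} = snd i}"
    for i :: "('d, 's) test set \<times> ('d, 's) test set"
  define K where "K t = {i\<in>I. t \<in> fst i \<and> t \<in> snd i}" for t
  define W where "W = {w \<in> space (PiM I (\<lambda>_. borel :: ennreal measure)). \<forall>t\<in>F. (\<Sum>i\<in>K t. w i) \<in> snd (snd t)}"
  show fin: "finite I" using assms by (simp add: I_def)
  show "disjoint_family_on (\<lambda>i. L i \<times> M i) I"
    by (auto simp: disjoint_family_on_def L_def M_def)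
  then have disj: "disjoint_family_on (\<lambda>i. L i \<times> M i) (K t)" for t
    by (rule disjoint_family_on_mono[rotated]) (auto simp: K_def)
  show "\<forall>i\<in>I. bounded (L i) \<and> L i \<in> sets borel \<and> M i \<in> sets borel"
  proof (intro ballI conjI)
    fix i assume i: "i \<in> I"
    have "fst i \<noteq> {}" "fst i \<subseteq> F"
      using i by (simp_all add: I_def mem_Times_iff)
    then obtain t where "t \<in> fst i" "t \<in> F"
      by blast
    moreover have "L i \<subseteq> fst t"
      using calculation by (auto simp: L_def)
    ultimately show "bounded (L i)"
      using assms(2) bounded_subset by blast
    have "L i = {x \<in> space borel. \<forall>t\<in>F. x \<in> fst t \<longleftrightarrow> t \<in> fst i}"
      using i by (auto simp: L_def I_def)
    also have "\<dots> \<in> sets borel"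
      using assms by (intro sets.sets_Collect_finite_All sets.sets_Collect_neg) 
         (auto simp: pred_def[symmetric] intro!: pred_intros_logic)
    finally show "L i \<in> sets borel" .
    have "M i = {x \<in> space borel. \<forall>t\<in>F. x \<in> fst (snd t) \<longleftrightarrow> t \<in> snd i}"
      using i by (auto simp: M_def I_def)
    also have "\<dots> \<in> sets borel"
      using assms by (intro sets.sets_Collect_finite_All sets.sets_Collect_neg) 
         (auto simp: pred_def[symmetric] intro!: pred_intros_logic)
    finally show "M i \<in> sets borel" .
  qed
  have finK: "finite (K t)" and KI: "K t \<subseteq> I" for t
    using fin by (auto simp: K_def)
  show "W \<in> sets (PiM I (\<lambda>_. borel))"
    unfolding W_def
  proof (intro sets.sets_Collect_finite_All assms(1))
    fix t assume "t \<in> F"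
    then have U: "snd (snd t) \<in> sets borel" using assms by blast
    have "(\<lambda>w. \<Sum>i\<in>K t. w i) \<in> borel_measurable (PiM I (\<lambda>_. borel :: ennreal measure))"
      by (intro borel_measurable_sum measurable_component_singleton) (rule subsetD[OF KI])
    from measurable_sets[OF this U]
    show "{w \<in> space (PiM I (\<lambda>_. borel :: ennreal measure)). (\<Sum>i\<in>K t. w i) \<in> snd (snd t)} \<in> sets (PiM I (\<lambda>_. borel))"
      by (simp add: vimage_def Int_def conj_commute)
  qed
  show "\<forall>\<gamma>. \<gamma> \<in> count_event F \<longleftrightarrow> \<gamma> \<in> configs \<and> (\<lambda>i\<in>I. cnt \<gamma> (L i \<times> M i)) \<in> W"
  proof
    fix \<gamma> :: "('d, 's) config"
    have split: "cnt \<gamma> (fst t \<times> fst (snd t)) = (\<Sum>i\<in>K t. cnt \<gamma> (L i \<times> M i))" if t: "t \<in> F" for t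
    proof -
      have "fst t \<times> fst (snd t) = (\<Union>i\<in>K t. L i \<times> M i)"
      proof (intro set_eqI iffI)
        fix p assume p: "p \<in> fst t \<times> fst (snd t)"
        define i where "i = ({s\<in>F. fst p \<in> fst s}, {s\<in>F. snd p \<in> fst (snd s)})"
        have "t \<in> fst i" "t \<in> snd i" "fst i \<subseteq> F" "snd i \<subseteq> F"
          using p t by (auto simp: i_def)
        then have "i \<in> K t"
          unfolding K_def I_def by (auto simp: mem_Times_iff)
        moreover have "p \<in> L i \<times> M i"
          by (simp add: L_def M_def i_def mem_Times_iff)
        ultimately show "p \<in> (\<Union>i\<in>K t. L i \<times> M i)" by blast
      next
        fix p assume "p \<in> (\<Union>i\<in>K t. L i \<times> M i)"
        then obtain i where i: "i \<in> K t" "p \<in> L i \<times> M i" by blast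
        then have "{s\<in>F. fst p \<in> fst s} = fst i" "{s\<in>F. snd p \<in> fst (snd s)} = snd i"
          by (simp_all add: L_def M_def mem_Times_iff)
        moreover have "t \<in> fst i" "t \<in> snd i"
          using i by (simp_all add: K_def)
        ultimately show "p \<in> fst t \<times> fst (snd t)"
          unfolding mem_Times_iff by blast
      qed
      then show ?thesis
        using cnt_Union[OF finK disj] by simp
    qed
    have restrict: "(\<Sum>i\<in>K t. (\<lambda>i\<in>I. cnt \<gamma> (L i \<times> M i)) i) = (\<Sum>i\<in>K t. cnt \<gamma> (L i \<times> M i))" for t
      using KI[of t] by (intro sum.cong) auto
    have *: "(\<Sum>i\<in>K t. (\<lambda>i\<in>I. cnt \<gamma> (L i \<times> M i)) i) = cnt \<gamma> (fst t \<times> fst (snd t))" if "t \<in> F" for t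
      unfolding restrict split[OF that] ..
    have "(\<lambda>i\<in>I. cnt \<gamma> (L i \<times> M i)) \<in> W \<longleftrightarrow> (\<forall>t\<in>F. cnt \<gamma> (fst t \<times> fst (snd t)) \<in> snd (snd t))"
    proof -
      have "(\<lambda>i\<in>I. cnt \<gamma> (L i \<times> M i)) \<in> space (PiM I (\<lambda>_. borel :: ennreal measure))"
        unfolding space_PiM by (intro restrict_PiE_iff[THEN iffD2] ballI) simp
      then show ?thesis
        unfolding W_def mem_Collect_eq by (simp only: * cong: ball_cong) simp
    qed
    then show "\<gamma> \<in> count_event F \<longleftrightarrow> \<gamma> \<in> configs \<and> (\<lambda>i\<in>I. cnt \<gamma> (L i \<times> M i)) \<in> W"
      unfolding count_event_def mem_Collect_eq by blast
  qed
qed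

text \<open>
  Poisson laws speak about families indexed by an initial segment of the natural numbers. The next
  two lemmas carry independence over to arbitrary finite index sets.
\<close>

lemma (in prob_space) indep_sets_reindex:
  assumes h: "inj_on h K" and indep: "indep_sets (\<lambda>k. F (h k)) K"
  shows "indep_sets F (h ` K)"
proof (rule indep_setsI)
  fix i assume "i \<in> h ` K"
  then show "F i \<subseteq> events"
    using indep by (auto simp: indep_sets_def)
next
  fix A J assume J: "J \<noteq> {}" "J \<subseteq> h ` K" "finite J" "\<forall>j\<in>J. A j \<in> F j"
  then obtain K' where K': "K' \<subseteq> K" "finite K'" "J = h ` K'"
    by (meson finite_subset_image)
  have "prob (\<Inter>k\<in>K'. A (h k)) = (\<Prod>k\<in>K'. prob (A (h k)))"
    using J K' by (intro indep_setsD[OF indep]) auto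
  then show "prob (\<Inter>j\<in>J. A j) = (\<Prod>j\<in>J. prob (A j))"
    using K' h by (simp add: prod.reindex inj_on_subset)
qed

lemma (in prob_space) indep_vars_reindex:
  assumes "inj_on h K" "indep_vars (\<lambda>k. M' (h k)) (\<lambda>k. X (h k)) K"
  shows "indep_vars M' X (h ` K)"
  using assms indep_sets_reindex[of h K] by (auto simp: indep_vars_def)

lemma (in prob_space) indep_vars_distr:
  assumes T: "T \<in> measurable M N" and X: "\<And>i. i \<in> I \<Longrightarrow> X i \<in> measurable N (M' i)"
    and indep: "indep_vars M' (\<lambda>i x. X i (T x)) I"
  shows "prob_space.indep_vars (distr M N T) M' X I"
proof (cases "I = {}")
  case True
  interpret D: prob_space "distr M N T" using T by (rule prob_space_distr)
  show ?thesis using True by (simp add: D.indep_vars_def D.indep_sets_def)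
next
  case False
  interpret D: prob_space "distr M N T" using T by (rule prob_space_distr)
  have XT: "(\<lambda>x. X i (T x)) \<in> measurable M (M' i)" if "i \<in> I" for i
    using measurable_compose[OF T X[OF that]] .
  have "distr (distr M N T) (\<Pi>\<^sub>M i\<in>I. M' i) (\<lambda>x. \<lambda>i\<in>I. X i x)
      = distr M (\<Pi>\<^sub>M i\<in>I. M' i) (\<lambda>x. \<lambda>i\<in>I. X i (T x))"
    by (subst distr_distr[OF _ T]) (auto intro!: measurable_restrict X simp: comp_def)
  also have "\<dots> = (\<Pi>\<^sub>M i\<in>I. distr M (M' i) (\<lambda>x. X i (T x)))"
    using indep by (subst (asm) indep_vars_iff_distr_eq_PiM'[OF False XT])
  also have "\<dots> = (\<Pi>\<^sub>M i\<in>I. distr (distr M N T) (M' i) (X i))"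
    by (intro PiM_cong refl) (simp add: distr_distr[OF X T] comp_def)
  finally show ?thesis
    using X by (subst D.indep_vars_iff_distr_eq_PiM'[OF False]) auto
qed

lemma poisson_law_indep_counts_nat:
  assumes "poisson_law \<mu> P"
    and "\<And>i. i < N \<Longrightarrow> bounded (L i) \<and> L i \<in> sets borel \<and> M i \<in> sets borel"
    and "disjoint_family_on (\<lambda>i. L i \<times> M i) {..<N}"
  shows "prob_space.indep_vars P (\<lambda>_. borel) (\<lambda>i \<gamma>. cnt \<gamma> (L i \<times> M i)) {..<N::nat}"
proof -
  have "\<forall>(N::nat) \<Lambda> A.
        (\<forall>i<N. bounded (\<Lambda> i) \<and> \<Lambda> i \<in> sets borel \<and> A i \<in> sets borel) \<and>
        disjoint_family_on (\<lambda>i. \<Lambda> i \<times> A i) {..<N} \<longrightarrow>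
        prob_space.indep_vars P (\<lambda>_. borel) (\<lambda>i \<gamma>. cnt \<gamma> (\<Lambda> i \<times> A i)) {..<N}"
    using assms(1) unfolding poisson_law_def by (elim conjE)
  from this[rule_format, of N L M] assms(2,3) show ?thesis
    by simp
qed

lemma poisson_law_prob_cnt:
  assumes "poisson_law \<mu> P" "bounded \<Lambda>" "\<Lambda> \<in> sets borel" "A \<in> sets borel"
  shows "measure P {\<gamma> \<in> space P. cnt \<gamma> (\<Lambda> \<times> A) = of_nat k} =
    measure \<mu> (\<Lambda> \<times> A) ^ k / fact k * exp (- measure \<mu> (\<Lambda> \<times> A))"
proof -
  have "\<forall>\<Lambda> A. bounded \<Lambda> \<and> \<Lambda> \<in> sets borel \<and> A \<in> sets borel \<longrightarrow>
        emeasure \<mu> (\<Lambda> \<times> A) < \<infinity> \<and>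
        (\<forall>k::nat. measure P {\<gamma> \<in> space P. cnt \<gamma> (\<Lambda> \<times> A) = of_nat k} =
           measure \<mu> (\<Lambda> \<times> A) ^ k / fact k * exp (- measure \<mu> (\<Lambda> \<times> A)))"
    using assms(1) unfolding poisson_law_def by (elim conjE)
  from this[rule_format, of \<Lambda> A] assms(2-) show ?thesis
    by simp
qed

lemma poisson_law_indep_counts:
  assumes "poisson_law \<mu> P" "finite I"
    and rect: "\<And>i. i \<in> I \<Longrightarrow> bounded (L i) \<and> L i \<in> sets borel \<and> M i \<in> sets borel"
    and disj: "disjoint_family_on (\<lambda>i. L i \<times> M i) I"
  shows "prob_space.indep_vars P (\<lambda>_. borel) (\<lambda>i \<gamma>. cnt \<gamma> (L i \<times> M i)) I"
proof -
  interpret prob_space P using assms(1) by (simp add: poisson_law_def)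
  obtain h where h: "bij_betw h {..<card I} I"
    using ex_bij_betw_nat_finite[OF \<open>finite I\<close>] by (auto simp: atLeast0LessThan)
  then have img: "h ` {..<card I} = I" and inj: "inj_on h {..<card I}"
    by (auto simp: bij_betw_def)
  have hI: "h k \<in> I" if "k < card I" for k
    using that img by auto
  have "disjoint_family_on (\<lambda>k. L (h k) \<times> M (h k)) {..<card I}"
    unfolding disjoint_family_on_def
  proof safe
    fix k l a b assume kl: "k < card I" "l < card I" "k \<noteq> l"
      and "a \<in> L (h k)" "b \<in> M (h k)" "a \<in> L (h l)" "b \<in> M (h l)"
    moreover have "h k \<noteq> h l" using inj kl by (auto simp: inj_on_def)
    moreover have "L (h k) \<times> M (h k) \<inter> L (h l) \<times> M (h l) = {}"
      using disj \<open>h k \<noteq> h l\<close> hI kl unfolding disjoint_family_on_def by blast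
    ultimately show "(a, b) \<in> {}" by auto
  qed
  then have "indep_vars (\<lambda>_. borel) (\<lambda>k \<gamma>. cnt \<gamma> (L (h k) \<times> M (h k))) {..<card I}"
    by (intro poisson_law_indep_counts_nat[OF assms(1)] rect hI) auto
  from indep_vars_reindex[OF inj this] show ?thesis
    by (simp add: img)
qed

text \<open>
  The Poisson weights add up to one, so the count is almost surely a natural number and every
  expectation of a function of it is a series. In particular the prescribed point probabilities
  determine the law of the count as a measure on the extended nonnegative reals.
\<close>

lemma poisson_law_nn_integral_cnt:
  assumes P: "poisson_law \<mu> P" and A: "bounded \<Lambda>" "\<Lambda> \<in> sets borel" "A \<in> sets borel"
    and f: "f \<in> borel_measurable borel"
  shows "(\<integral>\<^sup>+\<gamma>. f (cnt \<gamma> (\<Lambda> \<times> A)) \<partial>P) =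
    (\<Sum>k. f (of_nat k) * ennreal (measure \<mu> (\<Lambda> \<times> A) ^ k / fact k * exp (- measure \<mu> (\<Lambda> \<times> A))))"
proof -
  interpret prob_space P using P by (simp add: poisson_law_def)
  have setsP: "sets P = sets config_space" using P by (simp add: poisson_law_def)
  define m where "m = measure \<mu> (\<Lambda> \<times> A)"
  define X where "X = (\<lambda>\<gamma>. cnt \<gamma> (\<Lambda> \<times> A))"
  have [measurable]: "X \<in> borel_measurable P"
    unfolding X_def measurable_cong_sets[OF setsP refl] by (rule measurable_cnt[OF A])
  note f[measurable]
  have Ek: "emeasure P {\<gamma> \<in> space P. X \<gamma> = of_nat k} = ennreal (m ^ k / fact k * exp (- m))" for k
    unfolding emeasure_eq_measure X_def m_def poisson_law_prob_cnt[OF P A] ..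
  have total: "(\<lambda>k. m ^ k / fact k * exp (- m)) sums 1"
    using sums_mult2[OF exp_converges[of m], of "exp (- m)"]
    by (simp add: divide_inverse mult.commute[of "inverse _"] exp_minus_inverse)
  have "(\<Sum>k. emeasure P {\<gamma> \<in> space P. X \<gamma> = of_nat k}) = emeasure P (\<Union>k. {\<gamma> \<in> space P. X \<gamma> = of_nat k})"
    by (intro suminf_emeasure) (auto simp: disjoint_family_on_def)
  moreover have "(\<Sum>k. emeasure P {\<gamma> \<in> space P. X \<gamma> = of_nat k}) = ennreal (\<Sum>k. m ^ k / fact k * exp (- m))"
    unfolding Ek
    by (intro suminf_ennreal2 sums_summable[OF total]) (simp add: m_def)
  ultimately have "emeasure P (\<Union>k. {\<gamma> \<in> space P. X \<gamma> = of_nat k}) = 1"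
    using sums_unique[OF total] by simp
  then have "prob (\<Union>k. {\<gamma> \<in> space P. X \<gamma> = of_nat k}) = 1"
    by (simp add: measure_def)
  then have "AE \<gamma> in P. \<gamma> \<in> (\<Union>k. {\<gamma> \<in> space P. X \<gamma> = of_nat k})"
    by (rule AE_prob_1)
  then have "(\<integral>\<^sup>+\<gamma>. f (X \<gamma>) \<partial>P)
      = (\<integral>\<^sup>+\<gamma>. (\<Sum>k. f (of_nat k) * indicator {\<gamma> \<in> space P. X \<gamma> = of_nat k} \<gamma>) \<partial>P)"
  proof (intro nn_integral_cong_AE, eventually_elim)
    fix \<gamma> assume "\<gamma> \<in> (\<Union>k. {\<gamma> \<in> space P. X \<gamma> = of_nat k})"
    then obtain j where j: "X \<gamma> = of_nat j" "\<gamma> \<in> space P" by auto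
    have "(\<Sum>k. f (of_nat k) * indicator {\<gamma> \<in> space P. X \<gamma> = of_nat k} \<gamma>)
        = (\<Sum>k\<in>{j}. f (of_nat k) * indicator {\<gamma> \<in> space P. X \<gamma> = of_nat k} \<gamma>)"
      by (rule suminf_finite) (auto simp: j indicator_def)
    then show "f (X \<gamma>) = (\<Sum>k. f (of_nat k) * indicator {\<gamma> \<in> space P. X \<gamma> = of_nat k} \<gamma>)"
      using j by simp
  qed
  also have "\<dots> = (\<Sum>k. f (of_nat k) * emeasure P {\<gamma> \<in> space P. X \<gamma> = of_nat k})"
    by (subst nn_integral_suminf) (auto simp: nn_integral_cmult_indicator)
  finally show ?thesis
    unfolding Ek by (simp add: X_def m_def)
qed

lemma poisson_law_distr_cnt_cong:
  assumes P: "poisson_law \<mu> P" "poisson_law \<mu>' P'" and A: "bounded \<Lambda>" "\<Lambda> \<in> sets borel" "A \<in> sets borel"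
    and eq: "measure \<mu> (\<Lambda> \<times> A) = measure \<mu>' (\<Lambda> \<times> A)"
  shows "distr P borel (\<lambda>\<gamma>. cnt \<gamma> (\<Lambda> \<times> A)) = distr P' borel (\<lambda>\<gamma>. cnt \<gamma> (\<Lambda> \<times> A))"
proof (rule measure_eqI)
  fix U assume U: "U \<in> sets (distr P borel (\<lambda>\<gamma>. cnt \<gamma> (\<Lambda> \<times> A)))"
  have *: "emeasure (distr Q borel (\<lambda>\<gamma>. cnt \<gamma> (\<Lambda> \<times> A))) U = (\<integral>\<^sup>+\<gamma>. indicator U (cnt \<gamma> (\<Lambda> \<times> A)) \<partial>Q)"
    if "poisson_law \<nu> Q" for \<nu> Q
  proof -
    have [measurable]: "(\<lambda>\<gamma>. cnt \<gamma> (\<Lambda> \<times> A)) \<in> borel_measurable Q"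
      using that measurable_cnt[OF A] by (auto simp: poisson_law_def cong: measurable_cong_sets)
    show ?thesis
      using U by (simp flip: nn_integral_indicator add: nn_integral_distr)
  qed
  show "emeasure (distr P borel (\<lambda>\<gamma>. cnt \<gamma> (\<Lambda> \<times> A))) U = emeasure (distr P' borel (\<lambda>\<gamma>. cnt \<gamma> (\<Lambda> \<times> A))) U"
    unfolding *[OF P(1)] *[OF P(2)]
    using U by (simp add: poisson_law_nn_integral_cnt[OF P(1) A] poisson_law_nn_integral_cnt[OF P(2) A] eq)
qed simp

text \<open>
  The vector of counts over disjoint rectangles has independent components with determined laws;
  by refinement this fixes the probability of every count event, and count events generate.
\<close>

lemma poisson_law_unique:
  assumes P: "poisson_law \<mu> P" and P': "poisson_law \<mu>' P'"
    and eq: "\<And>\<Lambda> A. bounded \<Lambda> \<Longrightarrow> \<Lambda> \<in> sets borel \<Longrightarrow> A \<in> sets borel \<Longrightarrow>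
      measure \<mu> (\<Lambda> \<times> A) = measure \<mu>' (\<Lambda> \<times> A)"
  shows "P = P'"
proof (rule measure_eqI_generator_eq[OF Int_stable_count_events count_events_Pow, where A="\<lambda>_. configs"])
  interpret P: prob_space P using P by (simp add: poisson_law_def)
  interpret P': prob_space P' using P' by (simp add: poisson_law_def)
  have sets: "sets P = sets config_space" "sets P' = sets config_space"
    using P P' by (auto simp: poisson_law_def)
  from sets show "sets P = sigma_sets configs count_events" "sets P' = sigma_sets configs count_events"
    by (simp_all add: sets_config_space_count_events)
  have space: "space P = configs" "space P' = configs"
    using sets[THEN sets_eq_imp_space_eq] by simp_all
  show "emeasure P configs \<noteq> \<infinity>"
    by simp
  fix X :: "('a, 'b) config set" assume "X \<in> count_events"
  then obtain F where F: "X = count_event F" "finite F" "\<forall>t\<in>F. test_set t"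
    by (auto simp: count_events_def)
  obtain I :: "(('a, 'b) test set \<times> ('a, 'b) test set) set" and L M W where R: "finite I" "\<forall>i\<in>I. bounded (L i) \<and> L i \<in> sets borel \<and> M i \<in> sets borel"
    "disjoint_family_on (\<lambda>i. L i \<times> M i) I" "W \<in> sets (PiM I (\<lambda>_. borel))"
    "\<forall>\<gamma>. \<gamma> \<in> count_event F \<longleftrightarrow> \<gamma> \<in> configs \<and> (\<lambda>i\<in>I. cnt \<gamma> (L i \<times> M i)) \<in> W"
    using count_event_refinement[OF F(2,3)] by blast
  have law: "emeasure Q X = emeasure (\<Pi>\<^sub>M i\<in>I. distr Q borel (\<lambda>\<gamma>. cnt \<gamma> (L i \<times> M i))) W"
    if Q: "poisson_law \<nu> Q" and "I \<noteq> {}" for \<nu> Q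
  proof -
    interpret Q: prob_space Q using Q by (simp add: poisson_law_def)
    have setsQ: "sets Q = sets config_space" using Q by (auto simp: poisson_law_def)
    have spaceQ: "space Q = configs" using sets_eq_imp_space_eq[OF setsQ] by simp
    have meas: "(\<lambda>\<gamma>. cnt \<gamma> (L i \<times> M i)) \<in> borel_measurable Q" if "i \<in> I" for i
      unfolding measurable_cong_sets[OF setsQ refl] by (intro measurable_cnt) (use R(2) that in auto)
    have "emeasure Q X = emeasure (distr Q (\<Pi>\<^sub>M i\<in>I. borel) (\<lambda>\<gamma>. \<lambda>i\<in>I. cnt \<gamma> (L i \<times> M i))) W"
    proof (subst emeasure_distr)
      show "(\<lambda>\<gamma>. \<lambda>i\<in>I. cnt \<gamma> (L i \<times> M i)) \<in> measurable Q (\<Pi>\<^sub>M i\<in>I. borel)"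
        by (intro measurable_restrict meas)
      show "emeasure Q X = emeasure Q ((\<lambda>\<gamma>. \<lambda>i\<in>I. cnt \<gamma> (L i \<times> M i)) -` W \<inter> space Q)"
        by (rule arg_cong[where f="emeasure Q"]) (use R(5) in \<open>unfold F(1) spaceQ, blast\<close>)
    qed (rule R(4))
    also have "distr Q (\<Pi>\<^sub>M i\<in>I. borel) (\<lambda>\<gamma>. \<lambda>i\<in>I. cnt \<gamma> (L i \<times> M i)) = (\<Pi>\<^sub>M i\<in>I. distr Q borel (\<lambda>\<gamma>. cnt \<gamma> (L i \<times> M i)))"
    proof -
      have "Q.indep_vars (\<lambda>_. borel) (\<lambda>i \<gamma>. cnt \<gamma> (L i \<times> M i)) I"
        by (rule poisson_law_indep_counts[OF Q R(1) _ R(3)]) (use R(2) in blast)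
      then show ?thesis
        by (subst (asm) Q.indep_vars_iff_distr_eq_PiM'[OF \<open>I \<noteq> {}\<close> meas])
    qed
    finally show ?thesis .
  qed
  \<comment> \<open>The product characterisation of independence excludes the empty index set, where the event is trivial.\<close>
  show "emeasure P X = emeasure P' X"
  proof (cases "I = {}")
    case True
    then have "\<gamma> \<in> X \<longleftrightarrow> \<gamma> \<in> configs \<and> (\<lambda>i. undefined) \<in> W" for \<gamma>
      using R(5)[rule_format, of \<gamma>] by (simp add: F(1) restrict_def)
    then have "X = {} \<or> X = configs" by blast
    then show ?thesis
      using P.emeasure_space_1 P'.emeasure_space_1 by (auto simp: space)
  next
    case False
    have "(\<Pi>\<^sub>M i\<in>I. distr P borel (\<lambda>\<gamma>. cnt \<gamma> (L i \<times> M i))) = (\<Pi>\<^sub>M i\<in>I. distr P' borel (\<lambda>\<gamma>. cnt \<gamma> (L i \<times> M i)))"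
      using R(2) by (intro PiM_cong refl poisson_law_distr_cnt_cong[OF P P'] eq) auto
    with law[OF P False] law[OF P' False] show ?thesis by simp
  qed
qed (use configs_in_count_events in auto)

section \<open>Splitting a Poisson process into blocks\<close>

lemma emeasure_intensity:
  assumes "prob_space R" "sets R = sets borel" "\<Lambda> \<in> sets borel" "\<Delta> \<in> sets borel" "A \<in> sets borel"
  shows "emeasure (intensity z R \<Lambda>) (\<Delta> \<times> A) = ennreal z * emeasure lborel (\<Lambda> \<inter> \<Delta>) * emeasure R A"
proof -
  interpret prob_space R by fact
  have "emeasure (density lborel (\<lambda>x. ennreal z * indicator \<Lambda> x)) \<Delta>
      = (\<integral>\<^sup>+x. ennreal z * indicator (\<Lambda> \<inter> \<Delta>) x \<partial>lborel)"
    using assms by (subst emeasure_density) (auto intro!: nn_integral_cong simp: indicator_def)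
  also have "\<dots> = ennreal z * emeasure lborel (\<Lambda> \<inter> \<Delta>)"
    using assms by (simp add: nn_integral_cmult_indicator)
  finally show ?thesis
    using assms unfolding intensity_def by (subst emeasure_pair_measure_Times) auto
qed

lemma emeasure_lborel_shift:
  assumes "S \<in> sets borel"
  shows "emeasure lborel {x. x + v \<in> S} = emeasure lborel (S :: (real^'d::finite) set)"
proof -
  have "emeasure (distr lborel borel ((+) v)) S = emeasure lborel {x. x + v \<in> S}"
    using assms by (subst emeasure_distr) (auto simp: vimage_def add.commute)
  then show ?thesis by (simp add: lborel_distr_plus)
qed

lemma measurable_block:
  assumes "C \<in> sets borel"
  shows "(\<lambda>\<gamma>. restr C (shift v \<gamma>)) \<in> measurable config_space config_space"
  using measurable_compose[OF measurable_shift measurable_restr[OF assms]] .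

lemma cnt_block: "cnt (restr C (shift v \<gamma>)) (\<Delta> \<times> A) = cnt \<gamma> ({x. x + v \<in> C \<inter> \<Delta>} \<times> A)"
  by (simp add: cnt_restr cnt_shift)

lemma shifted_Int_bounded: "bounded \<Delta> \<Longrightarrow> bounded {x. x + v \<in> C \<inter> \<Delta>}" for v :: "real^'d::finite"
  by (intro shifted_bounded bounded_Int) auto

lemma shifted_Int_borel: "C \<in> sets borel \<Longrightarrow> \<Delta> \<in> sets borel \<Longrightarrow> {x. x + v \<in> C \<inter> \<Delta>} \<in> sets borel" for v :: "real^'d::finite"
  by (intro shifted_borel sets.Int)

text \<open>
  A translated and restricted Poisson process is again Poisson: its count on a rectangle is a count
  of the original process on the translated rectangle cut off by the block, and Lebesgue measure is
  translation invariant.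
\<close>

lemma poisson_law_block:
  fixes R :: "'s::real_normed_vector measure" and C :: "(real ^ 'd::finite) set"
  assumes P: "poisson_law (intensity z R UNIV) P" and R: "prob_space R" "sets R = sets borel"
    and C: "C \<in> sets borel"
  shows "poisson_law (intensity z R C) (distr P config_space (\<lambda>\<gamma>. restr C (shift v \<gamma>)))"
proof -
  interpret prob_space P using P by (simp add: poisson_law_def)
  have setsP: "sets P = sets config_space" using P by (simp add: poisson_law_def)
  have spaceP: "space P = configs" using sets_eq_imp_space_eq[OF setsP] by simp
  have T: "(\<lambda>\<gamma>. restr C (shift v \<gamma>)) \<in> measurable P config_space"
    unfolding measurable_cong_sets[OF setsP refl] by (rule measurable_block[OF C])
  have eq: "emeasure (intensity z R C) (\<Delta> \<times> A) = emeasure (intensity z R UNIV) ({x. x + v \<in> C \<inter> \<Delta>} \<times> A)"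
    if "\<Delta> \<in> sets borel" "A \<in> sets borel" for \<Delta> A
    using that C R using emeasure_lborel_shift[of "C \<inter> \<Delta>" v] shifted_Int_borel[of C \<Delta> v] by (simp add: emeasure_intensity)
  show ?thesis
    unfolding poisson_law_def
  proof (intro conjI allI impI)
    show "prob_space (distr P config_space (\<lambda>\<gamma>. restr C (shift v \<gamma>)))"
      by (rule prob_space_distr[OF T])
    fix \<Delta> :: "(real^'d) set" and A :: "'s set"
    assume A: "bounded \<Delta> \<and> \<Delta> \<in> sets borel \<and> A \<in> sets borel"
    have B: "bounded {x. x + v \<in> C \<inter> \<Delta>}" "{x. x + v \<in> C \<inter> \<Delta>} \<in> sets borel" "A \<in> sets borel"
      using A C shifted_Int_bounded[of \<Delta> v C] shifted_Int_borel[of C \<Delta> v] by simp_all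
    show "emeasure (intensity z R C) (\<Delta> \<times> A) < \<infinity>"
      using P B A unfolding poisson_law_def by (subst eq) blast+
    fix k :: nat
    have "{\<gamma> \<in> space (distr P config_space (\<lambda>\<gamma>. restr C (shift v \<gamma>))). cnt \<gamma> (\<Delta> \<times> A) = of_nat k}
        = (\<lambda>\<gamma>. cnt \<gamma> (\<Delta> \<times> A)) -` {of_nat k} \<inter> space config_space"
      by auto
    also have "\<dots> \<in> sets config_space"
      by (rule measurable_sets[OF measurable_cnt]) (use A in auto)
    finally have "measure (distr P config_space (\<lambda>\<gamma>. restr C (shift v \<gamma>)))
        {\<gamma> \<in> space (distr P config_space (\<lambda>\<gamma>. restr C (shift v \<gamma>))). cnt \<gamma> (\<Delta> \<times> A) = of_nat k}
      = measure P {\<gamma> \<in> space P. cnt \<gamma> ({x. x + v \<in> C \<inter> \<Delta>} \<times> A) = of_nat k}"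
      by (subst measure_distr[OF T])
         (auto simp: cnt_block spaceP configs_restr configs_shift intro!: arg_cong[where f="measure P"])
    also have "\<dots> = measure (intensity z R C) (\<Delta> \<times> A) ^ k / fact k * exp (- measure (intensity z R C) (\<Delta> \<times> A))"
      unfolding poisson_law_prob_cnt[OF P B] using A by (simp add: measure_def eq)
    finally show "measure (distr P config_space (\<lambda>\<gamma>. restr C (shift v \<gamma>)))
        {\<gamma> \<in> space (distr P config_space (\<lambda>\<gamma>. restr C (shift v \<gamma>))). cnt \<gamma> (\<Delta> \<times> A) = of_nat k}
      = measure (intensity z R C) (\<Delta> \<times> A) ^ k / fact k * exp (- measure (intensity z R C) (\<Delta> \<times> A))" .
  next
    fix N :: nat and L :: "nat \<Rightarrow> (real^'d) set" and M :: "nat \<Rightarrow> 's set"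
    assume *: "(\<forall>i<N. bounded (L i) \<and> L i \<in> sets borel \<and> M i \<in> sets borel) \<and>
        disjoint_family_on (\<lambda>i. L i \<times> M i) {..<N}"
    show "prob_space.indep_vars (distr P config_space (\<lambda>\<gamma>. restr C (shift v \<gamma>))) (\<lambda>_. borel)
        (\<lambda>i \<gamma>. cnt \<gamma> (L i \<times> M i)) {..<N}"
    proof (rule indep_vars_distr[OF T])
      show "(\<lambda>\<gamma>. cnt \<gamma> (L i \<times> M i)) \<in> borel_measurable config_space" if "i \<in> {..<N}" for i
        by (rule measurable_cnt) (use * that in auto)
      show "indep_vars (\<lambda>_. borel) (\<lambda>i \<gamma>. cnt (restr C (shift v \<gamma>)) (L i \<times> M i)) {..<N}"
        unfolding cnt_block
      proof (rule poisson_law_indep_counts_nat[OF P])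
        show "bounded {x. x + v \<in> C \<inter> L i} \<and> {x. x + v \<in> C \<inter> L i} \<in> sets borel \<and> M i \<in> sets borel" if "i < N" for i
          using * that by (intro conjI shifted_Int_bounded shifted_Int_borel C) auto
        show "disjoint_family_on (\<lambda>i. {x. x + v \<in> C \<inter> L i} \<times> M i) {..<N}"
          using * by (fastforce simp: disjoint_family_on_def)
      qed
    qed
  qed simp
qed

text \<open>
  Viewed through disjoint translates of \<open>C\<close>, the Poisson process consists of independent copies of
  the Poisson process on \<open>C\<close>. Refining the count events of each block separately and moving the pieces
  back to their blocks gives one large family of disjoint rectangles. Its counts are independent,
  and grouping them by blocks yields independence of the block events.
\<close>

lemma poisson_law_blocks:
  fixes R :: "'s::real_normed_vector measure" and C :: "(real ^ 'd::finite) set" and v :: "'j \<Rightarrow> real ^ 'd"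
  assumes P: "poisson_law (intensity z R UNIV) P" and R: "prob_space R" "sets R = sets borel"
    and C: "C \<in> sets borel" and PC: "poisson_law (intensity z R C) PC"
    and J: "finite J" "J \<noteq> {}" and disj: "disjoint_family_on (\<lambda>j. {x. x + v j \<in> C}) J"
  shows "distr P (\<Pi>\<^sub>M j\<in>J. config_space) (\<lambda>\<gamma>. \<lambda>j\<in>J. restr C (shift (v j) \<gamma>)) = (\<Pi>\<^sub>M j\<in>J. PC)"
proof -
  interpret prob_space P using P by (simp add: poisson_law_def)
  have setsP: "sets P = sets config_space" using P by (simp add: poisson_law_def)
  have spaceP: "space P = configs" using sets_eq_imp_space_eq[OF setsP] by simp
  have T: "(\<lambda>\<gamma>. restr C (shift (v j) \<gamma>)) \<in> measurable P config_space" for j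
    unfolding measurable_cong_sets[OF setsP refl] by (rule measurable_block[OF C])
  have "indep_vars (\<lambda>_. config_space) (\<lambda>j \<gamma>. restr C (shift (v j) \<gamma>)) J"
  proof (subst indep_vars_finite[OF J(2,1), where E="\<lambda>_. count_events"], goal_cases)
    case 6
    show ?case
    proof
      fix E :: "'j \<Rightarrow> ('d, 's) config set" assume E: "E \<in> J \<rightarrow> count_events"
      have "\<forall>j\<in>J. \<exists>F. E j = count_event F \<and> finite F \<and> (\<forall>t\<in>F. test_set t)"
        using E unfolding count_events_def by blast
      then obtain F where F: "\<forall>j\<in>J. E j = count_event (F j) \<and> finite (F j) \<and> (\<forall>t\<in>F j. test_set t)"
        using bchoice[of J "\<lambda>j F. E j = count_event F \<and> finite F \<and> (\<forall>t\<in>F. test_set t)"] by blast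
      let ?ref = "\<lambda>j (I :: (('d, 's) test set \<times> ('d, 's) test set) set, L, M, W).
          finite I \<and> (\<forall>i\<in>I. bounded (L i) \<and> L i \<in> sets borel \<and> M i \<in> sets borel) \<and>
          disjoint_family_on (\<lambda>i. L i \<times> M i) I \<and> W \<in> sets (PiM I (\<lambda>_. borel)) \<and>
          (\<forall>\<gamma>. \<gamma> \<in> E j \<longleftrightarrow> \<gamma> \<in> configs \<and> (\<lambda>i\<in>I. cnt \<gamma> (L i \<times> M i)) \<in> W)"
      have "\<exists>r. ?ref j r" if j: "j \<in> J" for j
      proof -
        obtain I :: "(('d, 's) test set \<times> ('d, 's) test set) set" and L M W where 
          "finite I" "\<forall>i\<in>I. bounded (L i) \<and> L i \<in> sets borel \<and> M i \<in> sets borel"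
          "disjoint_family_on (\<lambda>i. L i \<times> M i) I" "W \<in> sets (PiM I (\<lambda>_. borel))"
          "\<forall>\<gamma>. \<gamma> \<in> count_event (F j) \<longleftrightarrow> \<gamma> \<in> configs \<and> (\<lambda>i\<in>I. cnt \<gamma> (L i \<times> M i)) \<in> W"
          using count_event_refinement[of "F j"] F j by blast
        with F j show ?thesis by (intro exI[of _ "(I, L, M, W)"]) auto
      qed
      then obtain r where r: "\<forall>j\<in>J. ?ref j (r j)"
        using bchoice[of J ?ref] by blast
      define I where "I j = fst (r j)" for j
      define L where "L j = fst (snd (r j))" for j
      define M where "M j = fst (snd (snd (r j)))" for j
      define W where "W j = snd (snd (snd (r j)))" for j
      have ref: "finite (I j)" "\<And>i. i \<in> I j \<Longrightarrow> bounded (L j i) \<and> L j i \<in> sets borel \<and> M j i \<in> sets borel"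
          "disjoint_family_on (\<lambda>i. L j i \<times> M j i) (I j)" "W j \<in> sets (PiM (I j) (\<lambda>_. borel))"
          "\<And>\<gamma>. \<gamma> \<in> E j \<longleftrightarrow> \<gamma> \<in> configs \<and> (\<lambda>i\<in>I j. cnt \<gamma> (L j i \<times> M j i)) \<in> W j" if "j \<in> J" for j
        using bspec[OF r that] unfolding I_def L_def M_def W_def case_prod_unfold by blast+
      define X where "X = (\<lambda>(j, i) \<gamma>. cnt \<gamma> ({x. x + v j \<in> C \<inter> L j i} \<times> M j i))"
      have indep: "indep_vars (\<lambda>_. borel) X (Sigma J I)"
        unfolding X_def case_prod_unfold
      proof (rule poisson_law_indep_counts[OF P])
        show "finite (Sigma J I)" using J ref(1) by auto
        show "bounded {x. x + v (fst p) \<in> C \<inter> L (fst p) (snd p)} \<and>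
            {x. x + v (fst p) \<in> C \<inter> L (fst p) (snd p)} \<in> sets borel \<and> M (fst p) (snd p) \<in> sets borel"
          if "p \<in> Sigma J I" for p
          using ref(2)[of "fst p" "snd p"] that C by (intro conjI shifted_Int_bounded shifted_Int_borel) auto
        show "disjoint_family_on (\<lambda>p. {x. x + v (fst p) \<in> C \<inter> L (fst p) (snd p)} \<times> M (fst p) (snd p)) (Sigma J I)"
          unfolding disjoint_family_on_def
        proof (intro ballI impI)
          fix p q assume pq: "p \<in> Sigma J I" "q \<in> Sigma J I" "p \<noteq> q"
          then have J': "fst p \<in> J" "fst q \<in> J" "snd p \<in> I (fst p)" "snd q \<in> I (fst q)"
            by auto
          show "{x. x + v (fst p) \<in> C \<inter> L (fst p) (snd p)} \<times> M (fst p) (snd p) \<inter>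
            ({x. x + v (fst q) \<in> C \<inter> L (fst q) (snd q)} \<times> M (fst q) (snd q)) = {}"
          proof (cases "fst p = fst q")
            case True
            with pq have "snd p \<noteq> snd q" by (auto simp: prod_eq_iff)
            then have "(L (fst p) (snd p) \<times> M (fst p) (snd p)) \<inter> (L (fst p) (snd q) \<times> M (fst p) (snd q)) = {}"
              using disjoint_family_onD[OF ref(3)[OF J'(1)] J'(3), of "snd q"] J'(4) True by simp
            then show ?thesis using True by auto
          next
            case False
            then have "{x. x + v (fst p) \<in> C} \<inter> {x. x + v (fst q) \<in> C} = {}"
              using disjoint_family_onD[OF disj J'(1,2)] by simp
            then show ?thesis by auto
          qed
        qed
      qed
      have indep2: "indep_vars (\<lambda>j. PiM ({j} \<times> I j) (\<lambda>_. borel)) (\<lambda>j \<gamma>. restrict (\<lambda>p. X p \<gamma>) ({j} \<times> I j)) J"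
        by (rule indep_vars_restrict[OF indep]) (auto simp: disjoint_family_on_def)
      have indep3: "indep_vars (\<lambda>j. PiM (I j) (\<lambda>_. borel)) 
           (\<lambda>j \<gamma>. \<lambda>i\<in>I j. restrict (\<lambda>p. X p \<gamma>) ({j} \<times> I j) (j, i)) J"
        by (rule indep_vars_compose2[OF indep2, where Y="\<lambda>j w. \<lambda>i\<in>I j. w (j, i)"])
           (intro measurable_restrict measurable_component_singleton, simp)
      have ev: "(\<lambda>\<gamma>. restr C (shift (v j) \<gamma>)) -` E j \<inter> space P
         = (\<lambda>\<gamma>. \<lambda>i\<in>I j. restrict (\<lambda>p. X p \<gamma>) ({j} \<times> I j) (j, i)) -` W j \<inter> space P" if "j \<in> J" for j
      proof -
        have "(\<lambda>i\<in>I j. cnt (restr C (shift (v j) \<gamma>)) (L j i \<times> M j i))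
            = (\<lambda>i\<in>I j. restrict (\<lambda>p. X p \<gamma>) ({j} \<times> I j) (j, i))" for \<gamma>
          by (auto simp: X_def cnt_block restrict_def)
        then show ?thesis
          using ref(5)[OF that] by (auto simp: spaceP configs_restr configs_shift)
      qed
      have "prob (\<Inter>j\<in>J. (\<lambda>\<gamma>. \<lambda>i\<in>I j. restrict (\<lambda>p. X p \<gamma>) ({j} \<times> I j) (j, i)) -` W j \<inter> space P)
        = (\<Prod>j\<in>J. prob ((\<lambda>\<gamma>. \<lambda>i\<in>I j. restrict (\<lambda>p. X p \<gamma>) ({j} \<times> I j) (j, i)) -` W j \<inter> space P))"
        by (rule indep_varsD_finite[OF indep3]) (use J ref(4) in auto)
      then show "prob (\<Inter>j\<in>J. (\<lambda>\<gamma>. restr C (shift (v j) \<gamma>)) -` E j \<inter> space P)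
        = (\<Prod>j\<in>J. prob ((\<lambda>\<gamma>. restr C (shift (v j) \<gamma>)) -` E j \<inter> space P))"
        by (simp add: ev cong: prod.cong INF_cong)
    qed
  qed (use T Int_stable_count_events count_events_Pow configs_in_count_events in
       \<open>simp_all add: sets_config_space_count_events\<close>)
  then have "distr P (\<Pi>\<^sub>M j\<in>J. config_space) (\<lambda>\<gamma>. \<lambda>j\<in>J. restr C (shift (v j) \<gamma>))
      = (\<Pi>\<^sub>M j\<in>J. distr P config_space (\<lambda>\<gamma>. restr C (shift (v j) \<gamma>)))"
    by (subst (asm) indep_vars_iff_distr_eq_PiM'[OF J(2) T])
  also have "\<dots> = (\<Pi>\<^sub>M j\<in>J. PC)"
    by (intro PiM_cong refl poisson_law_unique[OF poisson_law_block[OF P R C] PC])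
  finally show ?thesis .
qed

section \<open>Relative entropy of image measures\<close>

text \<open>
  This elementary bound makes the negative part of the logarithm of a density integrable with
  respect to the measure that it defines.
\<close>

lemma mult_neg_ln_le_1: "0 \<le> x \<Longrightarrow> x * max 0 (- ln x) \<le> (1::real)"
proof (cases "x = 0 \<or> x \<ge> 1")
  case False
  assume "0 \<le> x"
  with False have x: "0 < x" "x < 1" by auto
  have "- ln x = ln (1 / x)" using x by (simp add: ln_div)
  also have "\<dots> \<le> 1 / x - 1" using x by (intro ln_le_minus_one) simp
  finally have "x * (- ln x) \<le> x * (1 / x - 1)" using x by (intro mult_left_mono) auto
  also have "\<dots> \<le> 1" using x by (simp add: field_simps)
  finally show ?thesis using x by (simp add: max_def)
qed auto

lemma integrable_neg_ln_density:
  fixes f :: "'a \<Rightarrow> real"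
  assumes M: "prob_space M" and f[measurable]: "f \<in> borel_measurable M" and f0: "\<And>x. 0 \<le> f x"
  shows "integrable (density M (\<lambda>x. ennreal (f x))) (\<lambda>x. max 0 (- ln (f x)))"
proof (rule integrableI_nonneg)
  interpret prob_space M by fact
  have "(\<integral>\<^sup>+x. ennreal (max 0 (- ln (f x))) \<partial>density M (\<lambda>x. ennreal (f x)))
      = (\<integral>\<^sup>+x. ennreal (f x * max 0 (- ln (f x))) \<partial>M)"
    using f0 by (subst nn_integral_density) (auto simp: ennreal_mult)
  also have "\<dots> \<le> (\<integral>\<^sup>+x. 1 \<partial>M)"
    using f0 by (intro nn_integral_mono) (auto intro!: mult_neg_ln_le_1 simp flip: ennreal_1)
  also have "\<dots> < \<infinity>"
    by (simp add: emeasure_space_1)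
  finally show "(\<integral>\<^sup>+x. ennreal (max 0 (- ln (f x))) \<partial>density M (\<lambda>x. ennreal (f x))) < \<infinity>" .
qed auto

text \<open>
  Gibbs' inequality \<open>\<integral> ln g dN \<le> \<integral> ln f dN\<close> for the density \<open>f\<close> of \<open>N\<close> and any subprobability
  density \<open>g\<close>: the tangent bound gives \<open>ln g \<le> ln f + g / f - 1\<close>, and \<open>\<integral> g / f dN \<le> \<integral> g dM \<le> 1\<close>.
  The negative part of \<open>ln g\<close> may fail to be integrable, so the conclusion is phrased with the
  integrable majorant \<open>u\<close>.
\<close>

lemma gibbs_ineq:
  fixes f g :: "'a \<Rightarrow> real"
  assumes f[measurable]: "f \<in> borel_measurable M" and f0: "\<And>x. 0 \<le> f x"
    and N: "N = density M (\<lambda>x. ennreal (f x))" "prob_space N"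
    and lnf: "integrable N (\<lambda>x. ln (f x))"
    and g[measurable]: "g \<in> borel_measurable M" and g0: "\<And>x. 0 \<le> g x"
    and g1: "(\<integral>\<^sup>+x. ennreal (g x) \<partial>M) \<le> 1"
    and gpos: "AE x in N. 0 < g x"
  shows "\<exists>u. integrable N u \<and> (AE x in N. ln (g x) \<le> u x) \<and> (\<integral>x. u x \<partial>N) \<le> (\<integral>x. ln (f x) \<partial>N)"
proof -
  interpret N: prob_space N by fact
  have fpos: "AE x in N. 0 < f x"
    unfolding N(1) using f0 by (subst AE_density) (auto simp: less_le)
  have "(\<integral>\<^sup>+x. ennreal (g x / f x) \<partial>N) = (\<integral>\<^sup>+x. ennreal (f x) * ennreal (g x / f x) \<partial>M)"
    unfolding N(1) by (subst nn_integral_density) auto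
  also have "\<dots> \<le> (\<integral>\<^sup>+x. ennreal (g x) \<partial>M)"
    using f0 g0 by (intro nn_integral_mono) (auto simp: ennreal_mult[symmetric])
  finally have le1: "(\<integral>\<^sup>+x. ennreal (g x / f x) \<partial>N) \<le> 1"
    using g1 by (rule order_trans)
  then have "(\<integral>\<^sup>+x. ennreal (g x / f x) \<partial>N) < \<infinity>"
    using ennreal_one_less_top le_less_trans by (metis infinity_ennreal_def)
  then have int: "integrable N (\<lambda>x. g x / f x)"
    using f0 g0 by (intro integrableI_nonneg) (auto simp: N(1))
  have "(\<integral>x. g x / f x \<partial>N) \<le> 1"
    using le1 f0 g0 by (subst (asm) nn_integral_eq_integral[OF int]) auto
  then have "(\<integral>x. ln (f x) + (g x / f x - 1) \<partial>N) \<le> (\<integral>x. ln (f x) \<partial>N)"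
    using lnf int by (simp add: N.prob_space)
  moreover have "AE x in N. ln (g x) \<le> ln (f x) + (g x / f x - 1)"
    using fpos gpos
  proof eventually_elim
    case (elim x)
    have "ln (g x) - ln (f x) = ln (g x / f x)" using elim by (simp add: ln_div)
    also have "\<dots> \<le> g x / f x - 1" using elim by (intro ln_le_minus_one) simp
    finally show ?case by simp
  qed
  moreover have "integrable N (\<lambda>x. ln (f x) + (g x / f x - 1))"
    using lnf int by simp
  ultimately show ?thesis by blast
qed

lemma gibbs_ineq_integrable:
  fixes f g :: "'a \<Rightarrow> real"
  assumes "f \<in> borel_measurable M" "\<And>x. 0 \<le> f x"
    and "N = density M (\<lambda>x. ennreal (f x))" "prob_space N"
    and "integrable N (\<lambda>x. ln (f x))"
    and "g \<in> borel_measurable M" "\<And>x. 0 \<le> g x"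
    and "(\<integral>\<^sup>+x. ennreal (g x) \<partial>M) \<le> 1"
    and "AE x in N. 0 < g x" and g: "integrable N (\<lambda>x. ln (g x))"
  shows "(\<integral>x. ln (g x) \<partial>N) \<le> (\<integral>x. ln (f x) \<partial>N)"
proof -
  obtain u where "integrable N u" "AE x in N. ln (g x) \<le> u x" "(\<integral>x. u x \<partial>N) \<le> (\<integral>x. ln (f x) \<partial>N)"
    using gibbs_ineq[OF assms(1-9)] by blast
  then show ?thesis
    using integral_mono_AE[OF g] by (metis order_trans)
qed

text \<open>
  Two probability measures with a density \<open>r\<close> of finite entropy between them, and a common map \<open>T\<close>.
  Gibbs' inequality bounds the entropy of the image measures from both sides: on the source space
  it compares \<open>r\<close> with the pulled back density of the images, on the target space it compares the
  density of the images with any competitor.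
\<close>

locale image_entropy =
  fixes X0 X :: "'a measure" and r :: "'a \<Rightarrow> real" and T :: "'a \<Rightarrow> 'b" and S :: "'b measure"
  assumes X0: "prob_space X0" and X: "prob_space X"
    and r[measurable]: "r \<in> borel_measurable X0" and r0: "\<And>x. 0 \<le> r x"
    and dens: "X = density X0 (\<lambda>x. ennreal (r x))"
    and lnr: "integrable X (\<lambda>x. ln (r x))"
    and T0: "T \<in> measurable X0 S"
begin

abbreviation "Q0 \<equiv> distr X0 S T"
abbreviation "Q \<equiv> distr X S T"

lemma T: "T \<in> measurable X S"
  using T0 by (simp add: dens)

sublocale Q0: prob_space Q0
  by (rule prob_space.prob_space_distr[OF X0 T0])

sublocale Q: prob_space Q
  by (rule prob_space.prob_space_distr[OF X T])

lemma image_ac: "absolutely_continuous Q0 Q"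
proof -
  have [simp]: "space X = space X0"
    by (simp add: dens)
  have "absolutely_continuous X0 X"
    unfolding dens by (rule absolutely_continuousI_density) simp
  then show ?thesis
    using T T0 unfolding absolutely_continuous_def
    by (auto simp: null_sets_distr_iff dest: subsetD)
qed

definition h where "h = (\<lambda>y. enn2real (RN_deriv Q0 Q y))"

lemma h_meas: "h \<in> borel_measurable Q0" and h0: "0 \<le> h y"
  by (auto simp: h_def)

lemma h_dens: "Q = density Q0 (\<lambda>y. ennreal (h y))"
proof -
  have "AE y in Q0. RN_deriv Q0 Q y \<noteq> \<infinity>"
    using image_ac by (intro Q0.RN_deriv_finite) (auto intro: Q.sigma_finite_measure_axioms)
  then have "AE y in Q0. RN_deriv Q0 Q y = ennreal (h y)"
    by eventually_elim (simp add: h_def less_top)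
  then have "density Q0 (RN_deriv Q0 Q) = density Q0 (\<lambda>y. ennreal (h y))"
    using h_meas by (intro density_cong) auto
  then show ?thesis
    using Q0.density_RN_deriv[OF image_ac] by simp
qed

lemma h_pos: "AE y in Q. 0 < h y"
proof -
  have "AE y in density Q0 (\<lambda>y. ennreal (h y)). 0 < h y"
    using h0 h_meas by (subst AE_density) (auto simp: less_le)
  then show ?thesis by (simp only: h_dens[symmetric])
qed

lemma entropy_density_h: "entropy_density (exp 1) Q0 Q = (\<lambda>y. ln (h y))"
  by (auto simp: entropy_density_def h_def log_def)

text \<open>
  The entropy of the images is at most that of the sources, since \<open>h \<circ> T\<close> integrates to one with
  respect to \<open>X0\<close> and so is a competitor for \<open>r\<close>.
\<close>

lemma integrable_ln_h: "integrable Q (\<lambda>y. ln (h y))"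
  and ln_h_le: "(\<integral>y. ln (h y) \<partial>Q) \<le> (\<integral>x. ln (r x) \<partial>X)"
proof -
  have hm[measurable]: "h \<in> borel_measurable S"
    using h_meas by simp
  note T0[measurable]
  have hT: "(\<lambda>x. h (T x)) \<in> borel_measurable X0"
    by measurable
  have "(\<integral>\<^sup>+x. ennreal (h (T x)) \<partial>X0) = (\<integral>\<^sup>+y. ennreal (h y) \<partial>Q0)"
    by (subst nn_integral_distr) auto
  also have "\<dots> = emeasure (density Q0 (\<lambda>y. ennreal (h y))) (space Q0)"
    by (subst emeasure_density) (auto intro!: nn_integral_cong)
  also have "\<dots> = 1"
    using Q.emeasure_space_1 by (simp add: h_dens[symmetric])
  finally have hT1: "(\<integral>\<^sup>+x. ennreal (h (T x)) \<partial>X0) \<le> 1" by simp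
  have hTpos: "AE x in X. 0 < h (T x)"
    using h_pos by (subst (asm) AE_distr_iff[OF T]) auto
  obtain u where u: "integrable X u" "AE x in X. ln (h (T x)) \<le> u x" "(\<integral>x. u x \<partial>X) \<le> (\<integral>x. ln (r x) \<partial>X)"
    using gibbs_ineq[OF r r0 dens X lnr hT h0 hT1 hTpos] by blast
  have "integrable Q (\<lambda>y. max 0 (- ln (h y)))"
    using integrable_neg_ln_density[OF Q0.prob_space_axioms h_meas h0] by (simp only: h_dens[symmetric])
  then have neg: "integrable X (\<lambda>x. max 0 (- ln (h (T x))))"
    by (subst (asm) integrable_distr_eq[OF T]) auto
  have int: "integrable X (\<lambda>x. ln (h (T x)))"
  proof (rule Bochner_Integration.integrable_bound)
    show "integrable X (\<lambda>x. \<bar>u x\<bar> + max 0 (- ln (h (T x))))"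
      using u neg by simp
    show "AE x in X. norm (ln (h (T x))) \<le> norm (\<bar>u x\<bar> + max 0 (- ln (h (T x))))"
      using u(2) by eventually_elim auto
  qed (rule borel_measurable_ln[OF measurable_compose[OF T hm]])
  then show "integrable Q (\<lambda>y. ln (h y))"
    by (subst integrable_distr_eq[OF T]) auto
  have "(\<integral>y. ln (h y) \<partial>Q) = (\<integral>x. ln (h (T x)) \<partial>X)"
    by (subst integral_distr[OF T]) auto
  also have "\<dots> \<le> (\<integral>x. u x \<partial>X)"
    by (rule integral_mono_AE[OF int u(1,2)])
  finally show "(\<integral>y. ln (h y) \<partial>Q) \<le> (\<integral>x. ln (r x) \<partial>X)"
    using u(3) by linarith
qed

text \<open>
  Every subprobability density \<open>g\<close> on the target gives a lower bound for the entropy of the images;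
  it suffices to know a lower bound \<open>s\<close> of \<open>ln g\<close> along \<open>T\<close>.
\<close>

lemma le_ln_h:
  assumes g[measurable]: "g \<in> borel_measurable S" and g0: "\<And>y. 0 \<le> g y" and g1: "(\<integral>\<^sup>+y. ennreal (g y) \<partial>Q0) \<le> 1"
    and s: "integrable X s" "AE x in X. 0 < g (T x) \<and> s x \<le> ln (g (T x))"
  shows "(\<integral>x. s x \<partial>X) \<le> (\<integral>y. ln (h y) \<partial>Q)"
proof -
  have gm: "g \<in> borel_measurable Q0" by simp
  have gpos: "AE y in Q. 0 < g y"
    using s(2) by (subst AE_distr_iff[OF T]) auto
  obtain u where u: "integrable Q u" "AE y in Q. ln (g y) \<le> u y" "(\<integral>y. u y \<partial>Q) \<le> (\<integral>y. ln (h y) \<partial>Q)"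
    using gibbs_ineq[OF h_meas h0 h_dens Q.prob_space_axioms integrable_ln_h gm g0 g1 gpos] by blast
  have um: "u \<in> borel_measurable S"
    using u(1) by simp
  have "(\<integral>x. s x \<partial>X) \<le> (\<integral>x. u (T x) \<partial>X)"
  proof (rule integral_mono_AE[OF s(1)])
    show "integrable X (\<lambda>x. u (T x))"
      using u(1) by (subst (asm) integrable_distr_eq[OF T um])
    have "AE x in X. ln (g (T x)) \<le> u (T x)"
      by (rule AE_distrD[OF T u(2)])
    with s(2) show "AE x in X. s x \<le> u (T x)"
      by eventually_elim auto
  qed
  also have "\<dots> = (\<integral>y. u y \<partial>Q)"
    by (simp add: integral_distr[OF T um])
  finally show ?thesis using u(3) by linarith
qed

end

section \<open>Exponential moments of linear functionals\<close>

lemma poisson_law_exp_moment: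
  assumes P: "poisson_law \<mu> P" and A: "bounded \<Lambda>" "\<Lambda> \<in> sets borel" "A \<in> sets borel"
  shows "(\<integral>\<^sup>+\<gamma>. ennreal (exp (a * enn2real (cnt \<gamma> (\<Lambda> \<times> A)))) \<partial>P) =
    ennreal (exp (measure \<mu> (\<Lambda> \<times> A) * (exp a - 1)))"
proof -
  define m where "m = measure \<mu> (\<Lambda> \<times> A)"
  have m: "0 \<le> m" by (simp add: m_def)
  have "(\<integral>\<^sup>+\<gamma>. ennreal (exp (a * enn2real (cnt \<gamma> (\<Lambda> \<times> A)))) \<partial>P)
      = (\<Sum>k. ennreal (exp (a * real k)) * ennreal (m ^ k / fact k * exp (- m)))"
    by (subst poisson_law_nn_integral_cnt[OF P A, where f="\<lambda>x. ennreal (exp (a * enn2real x))"]) (auto simp: m_def)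
  also have "\<dots> = (\<Sum>k. ennreal ((m * exp a) ^ k / fact k * exp (- m)))"
    using m by (intro suminf_cong)
       (simp add: ennreal_mult[symmetric] power_mult_distrib exp_of_nat_mult[symmetric] mult_ac)
  also have "\<dots> = ennreal (exp (m * exp a) * exp (- m))"
  proof (rule sums_unique[symmetric], rule sums_ennreal[THEN iffD2])
    show "(\<lambda>k. (m * exp a) ^ k / fact k * exp (- m)) sums (exp (m * exp a) * exp (- m))"
      using sums_mult2[OF exp_converges[of "m * exp a"], of "exp (- m)"]
      by (simp add: divide_inverse mult.commute[of "inverse _"])
  qed (use m in auto)
  also have "exp (m * exp a) * exp (- m) = exp (m * (exp a - 1))"
    by (simp add: exp_add[symmetric] algebra_simps)
  finally show ?thesis by (simp add: m_def)
qed

text \<open>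
  Rounding the weights up to integers replaces a linear functional of a finite configuration by a
  combination of counts over the level sets of the weight, which are independent under a Poisson law.
\<close>

lemma sum_le_levels:
  fixes w :: "'s \<Rightarrow> real" and \<gamma> :: "('d::finite, 's) config"
  assumes fin: "finite \<gamma>" and w0: "\<And>m. 0 \<le> w m" and a: "0 \<le> a"
  shows "\<exists>k. (\<Sum>p\<in>\<gamma>. a * (1 + w (snd p)))
     \<le> (\<Sum>j<k. a * (real j + 2) * real (card (\<gamma> \<inter> (UNIV \<times> {m. real j \<le> w m \<and> w m < real j + 1}))))"
proof -
  define lev where "lev p = nat \<lfloor>w (snd p)\<rfloor>" for p :: "(real^'d) \<times> 's"
  have lev: "real (lev p) \<le> w (snd p)" "w (snd p) < real (lev p) + 1" for p
    using w0[of "snd p"] by (simp_all add: lev_def)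
  have lev_eq: "lev p = j \<longleftrightarrow> real j \<le> w (snd p) \<and> w (snd p) < real j + 1" for p j
    using lev[of p] floor_unique[of "int j" "w (snd p)"] by (auto simp: lev_def)
  obtain k where k: "lev ` \<gamma> \<subseteq> {..<k}"
    using finite_nat_bounded[of "lev ` \<gamma>"] fin by auto
  have "(\<Sum>p\<in>\<gamma>. a * (1 + w (snd p))) \<le> (\<Sum>p\<in>\<gamma>. a * (real (lev p) + 2))"
    using lev a by (intro sum_mono mult_left_mono) (auto simp: less_imp_le add.commute intro: order_trans[OF less_imp_le[OF lev(2)]])
  also have "\<dots> = (\<Sum>j<k. \<Sum>p\<in>{p\<in>\<gamma>. lev p = j}. a * (real (lev p) + 2))"
    using fin k by (intro sum.group[symmetric]) auto
  also have "\<dots> = (\<Sum>j<k. a * (real j + 2) * real (card (\<gamma> \<inter> (UNIV \<times> {m. real j \<le> w m \<and> w m < real j + 1}))))"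
  proof (intro sum.cong refl)
    fix j
    have eq: "{p\<in>\<gamma>. lev p = j} = \<gamma> \<inter> (UNIV \<times> {m. real j \<le> w m \<and> w m < real j + 1})"
      by (auto simp: lev_eq)
    show "(\<Sum>p\<in>{p\<in>\<gamma>. lev p = j}. a * (real (lev p) + 2))
       = a * (real j + 2) * real (card (\<gamma> \<inter> (UNIV \<times> {m. real j \<le> w m \<and> w m < real j + 1})))"
      unfolding eq[symmetric] by simp
  qed
  finally show ?thesis by blast
qed

text \<open>
  On finitely many levels the counts are independent Poisson variables with explicit exponential
  moments, and the exponents add up to at most \<open>z |\<Lambda>| C\<close>, whatever the number of levels. Monotone
  convergence removes the truncation, because a finite configuration meets finitely many levels.
  Rounding up costs at most one in the weight, hence \<open>w + 2\<close> instead of \<open>w + 1\<close> in the hypothesis.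
\<close>

lemma poisson_law_exp_linear:
  fixes w :: "'s::real_normed_vector \<Rightarrow> real" and \<Lambda> :: "(real ^ 'd::finite) set"
  assumes P: "poisson_law (intensity z R \<Lambda>) P" and R: "prob_space R" "sets R = sets borel" and z: "0 \<le> z"
    and \<Lambda>: "bounded \<Lambda>" "\<Lambda> \<in> sets borel"
    and w[measurable]: "w \<in> borel_measurable borel" and w0: "\<And>m. 0 \<le> w m" and a: "0 \<le> a"
    and C: "(\<integral>\<^sup>+m. ennreal (exp (a * (w m + 2))) \<partial>R) \<le> ennreal C" "0 \<le> C"
  shows "(\<integral>\<^sup>+\<gamma>. (if finite (restr \<Lambda> \<gamma>) then ennreal (exp (\<Sum>p\<in>restr \<Lambda> \<gamma>. a * (1 + w (snd p)))) else 0) \<partial>P)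
     \<le> ennreal (exp (z * measure lborel \<Lambda> * C))"
proof -
  interpret R: prob_space R by fact
  interpret prob_space P using P by (simp add: poisson_law_def)
  have setsP: "sets P = sets config_space" using P by (simp add: poisson_law_def)
  define A where "A j = {m. real j \<le> w m \<and> w m < real j + 1}" for j :: nat
  have A[measurable]: "A j \<in> sets borel" for j
    unfolding A_def by measurable
  have AR: "A j \<in> sets R" for j using A R by simp
  have meas[measurable]: "(\<lambda>\<gamma>. cnt \<gamma> (\<Lambda> \<times> A j)) \<in> borel_measurable P" for j
    unfolding measurable_cong_sets[OF setsP refl] by (intro measurable_cnt \<Lambda> A)
  define X where "X j \<gamma> = ennreal (exp (a * (real j + 2) * enn2real (cnt \<gamma> (\<Lambda> \<times> A j))))" for j \<gamma>
  define G where "G k \<gamma> = (\<Prod>j<k. X j \<gamma>)" for k \<gamma>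
  have [measurable]: "X j \<in> borel_measurable P" for j
    unfolding X_def by measurable
  have [measurable]: "G k \<in> borel_measurable P" for k
    unfolding G_def by measurable
  have X1: "1 \<le> X j \<gamma>" for j \<gamma>
    using a by (simp add: X_def flip: ennreal_1)
  have inc: "incseq G"
    unfolding G_def
  proof (rule incseq_SucI, rule le_funI)
    fix k \<gamma> show "(\<Prod>j<k. X j \<gamma>) \<le> (\<Prod>j<Suc k. X j \<gamma>)"
      using mult_left_mono[OF X1[of k \<gamma>], of "\<Prod>j<k. X j \<gamma>"] by simp
  qed
  have disj: "disjoint_family_on (\<lambda>j. \<Lambda> \<times> A j) {..<k}" for k
    by (auto simp: disjoint_family_on_def A_def)
  have fin_vol: "emeasure lborel \<Lambda> < \<infinity>"
    using emeasure_bounded_finite[OF \<Lambda>(1)] by simp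
  have m: "measure (intensity z R \<Lambda>) (\<Lambda> \<times> A j) = z * measure lborel \<Lambda> * measure R (A j)" for j
    using z emeasure_intensity[OF R \<Lambda>(2) \<Lambda>(2) A[of j], of z]
    by (simp add: measure_def enn2real_mult)
  have indep: "indep_vars (\<lambda>_. borel) X {..<k}" for k
    unfolding X_def
    by (rule indep_vars_compose2[OF poisson_law_indep_counts_nat[OF P], where Y="\<lambda>j x. ennreal (exp (a * (real j + 2) * enn2real x))"])
       (use \<Lambda> A disj in auto)
  \<comment> \<open>The level sets are disjoint, so at most one summand is present at each mark.\<close>
  have sumR: "(\<Sum>j<k. measure R (A j) * exp (a * (real j + 2))) \<le> C" for k
  proof -
    have "ennreal (\<Sum>j<k. measure R (A j) * exp (a * (real j + 2)))
        = (\<Sum>j<k. \<integral>\<^sup>+m. ennreal (exp (a * (real j + 2))) * indicator (A j) m \<partial>R)"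
      unfolding nn_integral_cmult_indicator[OF AR]
      by (subst sum_ennreal[symmetric]) (auto simp: R.emeasure_eq_measure ennreal_mult mult.commute)
    also have "\<dots> = (\<integral>\<^sup>+m. (\<Sum>j<k. ennreal (exp (a * (real j + 2))) * indicator (A j) m) \<partial>R)"
      using AR by (intro nn_integral_sum[symmetric]) auto
    also have "\<dots> \<le> (\<integral>\<^sup>+m. ennreal (exp (a * (w m + 2))) \<partial>R)"
    proof (rule nn_integral_mono)
      fix m
      show "(\<Sum>j<k. ennreal (exp (a * (real j + 2))) * indicator (A j) m) \<le> ennreal (exp (a * (w m + 2)))"
      proof (cases "\<exists>i<k. m \<in> A i")
        case True
        then obtain i where i: "i < k" "m \<in> A i" by blast
        have "m \<in> A j \<longleftrightarrow> j = i" for j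
          using i(2) unfolding A_def by auto
        then have "(\<Sum>j<k. ennreal (exp (a * (real j + 2))) * indicator (A j) m)
            = (\<Sum>j<k. if j = i then ennreal (exp (a * (real j + 2))) else 0)"
          by (intro sum.cong) (auto simp: indicator_def)
        also have "\<dots> = ennreal (exp (a * (real i + 2)))"
          using i by simp
        also have "\<dots> \<le> ennreal (exp (a * (w m + 2)))"
          using i a by (auto simp: A_def intro!: mult_left_mono)
        finally show ?thesis .
      next
        case False
        then have "(\<Sum>j<k. ennreal (exp (a * (real j + 2))) * indicator (A j) m) = 0"
          by (intro sum.neutral) (auto simp: indicator_def)
        then show ?thesis by simp
      qed
    qed
    also have "\<dots> \<le> ennreal C" by (rule C)
    finally show ?thesis using C by (simp add: sum_nonneg)
  qed
  have intG: "(\<integral>\<^sup>+\<gamma>. G k \<gamma> \<partial>P) \<le> ennreal (exp (z * measure lborel \<Lambda> * C))" for k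
  proof -
    have "(\<integral>\<^sup>+\<gamma>. G k \<gamma> \<partial>P) = (\<Prod>j<k. \<integral>\<^sup>+\<gamma>. X j \<gamma> \<partial>P)"
      unfolding G_def by (intro indep_vars_nn_integral indep) auto
    also have "\<dots> = (\<Prod>j<k. ennreal (exp (z * measure lborel \<Lambda> * measure R (A j) * (exp (a * (real j + 2)) - 1))))"
      unfolding X_def by (intro prod.cong refl) (simp only: poisson_law_exp_moment[OF P \<Lambda> A] m)
    also have "\<dots> = ennreal (exp (\<Sum>j<k. z * measure lborel \<Lambda> * measure R (A j) * (exp (a * (real j + 2)) - 1)))"
      by (simp add: prod_ennreal exp_sum)
    also have "\<dots> \<le> ennreal (exp (z * measure lborel \<Lambda> * C))"
    proof -
      have "(\<Sum>j<k. z * measure lborel \<Lambda> * measure R (A j) * (exp (a * (real j + 2)) - 1))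
          \<le> (\<Sum>j<k. z * measure lborel \<Lambda> * (measure R (A j) * exp (a * (real j + 2))))"
        using z by (intro sum_mono) (auto simp: algebra_simps)
      also have "\<dots> \<le> z * measure lborel \<Lambda> * C"
        unfolding sum_distrib_left[symmetric] using z sumR by (intro mult_left_mono) auto
      finally show ?thesis by simp
    qed
    finally show ?thesis .
  qed
  have "(\<integral>\<^sup>+\<gamma>. (if finite (restr \<Lambda> \<gamma>) then ennreal (exp (\<Sum>p\<in>restr \<Lambda> \<gamma>. a * (1 + w (snd p)))) else 0) \<partial>P)
      \<le> (\<integral>\<^sup>+\<gamma>. (SUP k. G k \<gamma>) \<partial>P)"
  proof (rule nn_integral_mono)
    fix \<gamma>
    show "(if finite (restr \<Lambda> \<gamma>) then ennreal (exp (\<Sum>p\<in>restr \<Lambda> \<gamma>. a * (1 + w (snd p)))) else 0) \<le> (SUP k. G k \<gamma>)"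
    proof (cases "finite (restr \<Lambda> \<gamma>)")
      case True
      have cnt: "enn2real (cnt \<gamma> (\<Lambda> \<times> A j)) = real (card (restr \<Lambda> \<gamma> \<inter> (UNIV \<times> A j)))" for j
      proof -
        have "cnt \<gamma> (\<Lambda> \<times> A j) = cnt (restr \<Lambda> \<gamma>) (UNIV \<times> A j)" by (simp add: cnt_restr)
        then show ?thesis by (simp add: cnt_finite[OF True])
      qed
      obtain k where "(\<Sum>p\<in>restr \<Lambda> \<gamma>. a * (1 + w (snd p)))
         \<le> (\<Sum>j<k. a * (real j + 2) * enn2real (cnt \<gamma> (\<Lambda> \<times> A j)))"
        using sum_le_levels[of "restr \<Lambda> \<gamma>" w a, OF True w0 a, unfolded A_def[symmetric]] unfolding cnt by blast
      then have "ennreal (exp (\<Sum>p\<in>restr \<Lambda> \<gamma>. a * (1 + w (snd p)))) \<le> G k \<gamma>"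
        unfolding G_def X_def by (simp add: prod_ennreal exp_sum[symmetric])
      also have "\<dots> \<le> (SUP k. G k \<gamma>)" by (rule SUP_upper) simp
      finally show ?thesis using True by simp
    qed simp
  qed
  also have "\<dots> = (SUP k. \<integral>\<^sup>+\<gamma>. G k \<gamma> \<partial>P)"
    by (rule nn_integral_monotone_convergence_SUP[OF inc]) measurable
  also have "\<dots> \<le> ennreal (exp (z * measure lborel \<Lambda> * C))"
    by (rule SUP_least) (rule intG)
  finally show ?thesis .
qed

text \<open>
  The exponent \<open>d + 2 \<delta>\<close> of the mark moment beats any multiple of the exponent \<open>d + \<delta>\<close> of the stability
  bound: \<open>a x\<^sup>d\<^sup>+\<^sup>\<delta> \<le> x\<^sup>d\<^sup>+\<^sup>2\<^sup>\<delta>\<close> as soon as \<open>a \<le> x\<^sup>\<delta>\<close>, and \<open>B\<close> takes care of smaller \<open>x\<close>.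
\<close>

lemma exp_weight_integrable:
  fixes R :: "'s::real_normed_vector measure"
  assumes mm: "mark_moment TYPE('d::finite) \<delta> R" and \<delta>: "\<delta> > 0" and R: "prob_space R" "sets R = sets borel" and a: "0 \<le> a"
  shows "\<exists>C\<ge>0. (\<integral>\<^sup>+m. ennreal (exp (a * (norm m powr (real CARD('d) + \<delta>) + 2))) \<partial>R) \<le> ennreal C"
proof -
  define B where "B = a * (a powr (1 / \<delta>)) powr (real CARD('d) + \<delta>)"
  have "0 \<le> B" using a by (simp add: B_def)
  have bound: "a * x powr (real CARD('d) + \<delta>) \<le> x powr (real CARD('d) + 2 * \<delta>) + B" if "0 \<le> x" for x
  proof (cases "a powr (1 / \<delta>) \<le> x")
    case True
    then have "(a powr (1 / \<delta>)) powr \<delta> \<le> x powr \<delta>"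
      using \<delta> by (intro powr_mono2) auto
    then have "a \<le> x powr \<delta>" using \<delta> a by (simp add: powr_powr)
    then have "a * x powr (real CARD('d) + \<delta>) \<le> x powr \<delta> * x powr (real CARD('d) + \<delta>)"
      by (intro mult_right_mono) auto
    also have "\<dots> = x powr (real CARD('d) + 2 * \<delta>)"
      by (simp add: powr_add[symmetric] algebra_simps)
    finally show ?thesis using \<open>0 \<le> B\<close> by simp
  next
    case False
    then have "x powr (real CARD('d) + \<delta>) \<le> (a powr (1 / \<delta>)) powr (real CARD('d) + \<delta>)"
      using that \<delta> by (intro powr_mono2) auto
    then have "a * x powr (real CARD('d) + \<delta>) \<le> B"
      unfolding B_def using a by (intro mult_left_mono) auto
    then show ?thesis by (simp add: add_increasing)
  qed
  define I where "I = (\<integral>\<^sup>+m. ennreal (exp (norm m powr (real CARD('d) + 2 * \<delta>))) \<partial>R)"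
  have "(\<integral>\<^sup>+m. ennreal (exp (a * (norm m powr (real CARD('d) + \<delta>) + 2))) \<partial>R)
      \<le> (\<integral>\<^sup>+m. ennreal (exp (B + 2 * a)) * ennreal (exp (norm m powr (real CARD('d) + 2 * \<delta>))) \<partial>R)"
    using bound by (intro nn_integral_mono) (auto simp: ennreal_mult[symmetric] exp_add[symmetric] algebra_simps)
  also have "\<dots> = ennreal (exp (B + 2 * a)) * I"
    unfolding I_def using R by (intro nn_integral_cmult) (simp add: measurable_cong_sets[OF R(2) refl])
  also have "\<dots> = ennreal (exp (B + 2 * a) * enn2real I)"
    using mm unfolding mark_moment_def I_def[symmetric] by (simp add: ennreal_mult less_top)
  finally show ?thesis
    by (intro exI[of _ "exp (B + 2 * a) * enn2real I"]) simp
qed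

section \<open>Gibbs densities\<close>

text \<open>
  The entropy of a density is at most the logarithm of its second moment. The proof integrates the
  tangent bound \<open>ln f \<le> ln K + f / K - 1\<close> of the logarithm at \<open>K\<close>.
\<close>

lemma ln_density_L2:
  fixes f :: "'a \<Rightarrow> real"
  assumes M: "prob_space M" and f[measurable]: "f \<in> borel_measurable M" and f0: "\<And>x. 0 \<le> f x"
    and N: "N = density M (\<lambda>x. ennreal (f x))" "prob_space N"
    and K: "(\<integral>\<^sup>+x. ennreal (f x * f x) \<partial>M) \<le> ennreal K" "0 < K"
  shows "integrable N (\<lambda>x. ln (f x))" "(\<integral>x. ln (f x) \<partial>N) \<le> ln K" "0 \<le> (\<integral>x. ln (f x) \<partial>N)"
proof -
  interpret M: prob_space M by fact
  interpret N: prob_space N by fact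
  have fpos: "AE x in N. 0 < f x"
    unfolding N(1) using f0 by (subst AE_density) (auto simp: less_le)
  have fN: "(\<integral>\<^sup>+x. ennreal (f x) \<partial>N) \<le> ennreal K"
    unfolding N(1) using K f0 by (subst nn_integral_density) (auto simp: ennreal_mult)
  then have intf: "integrable N f"
    using f0 by (intro integrableI_nonneg) (auto simp: N(1) intro: le_less_trans)
  have If: "(\<integral>x. f x \<partial>N) \<le> K"
    using fN f0 K by (subst (asm) nn_integral_eq_integral[OF intf]) auto
  have neg: "integrable N (\<lambda>x. max 0 (- ln (f x)))"
    unfolding N(1) by (rule integrable_neg_ln_density[OF M f f0])
  show int: "integrable N (\<lambda>x. ln (f x))"
  proof (rule Bochner_Integration.integrable_bound)
    show "integrable N (\<lambda>x. f x + max 0 (- ln (f x)))"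
      using intf neg by simp
    show "AE x in N. norm (ln (f x)) \<le> norm (f x + max 0 (- ln (f x)))"
      using fpos
    proof eventually_elim
      case (elim x)
      then have "ln (f x) \<le> f x" using ln_le_minus_one[of "f x"] by linarith
      then show ?case using f0[of x] by auto
    qed
  qed (simp add: N(1))
  have "(\<integral>x. ln (f x) \<partial>N) \<le> (\<integral>x. ln K + (f x / K - 1) \<partial>N)"
  proof (rule integral_mono_AE[OF int])
    show "integrable N (\<lambda>x. ln K + (f x / K - 1))" using intf by simp
    show "AE x in N. ln (f x) \<le> ln K + (f x / K - 1)"
      using fpos
    proof eventually_elim
      case (elim x)
      then show ?case using ln_le_minus_one[of "f x / K"] K by (simp add: ln_div)
    qed
  qed
  also have "\<dots> = ln K + ((\<integral>x. f x \<partial>N) / K - 1)"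
    using intf by (simp add: N.prob_space)
  also have "\<dots> \<le> ln K" using If K by (simp add: field_simps)
  finally show "(\<integral>x. ln (f x) \<partial>N) \<le> ln K" .
  show "0 \<le> (\<integral>x. ln (f x) \<partial>N)"
    using gibbs_ineq_integrable[OF f f0 N int, of "\<lambda>_. 1"] by (simp add: M.emeasure_space_1)
qed

lemma exp_minus_measurable[measurable]: "exp_minus \<in> borel_measurable borel"
proof -
  have "exp_minus = (\<lambda>h. if h = \<infinity> then 0 else if h = -\<infinity> then \<infinity> else ennreal (exp (- real_of_ereal h)))"
  proof
    fix h show "exp_minus h = (if h = \<infinity> then 0 else if h = -\<infinity> then \<infinity> else ennreal (exp (- real_of_ereal h)))"
      by (cases h) (auto simp: exp_minus_def)
  qed
  then show ?thesis by (rule ssubst) measurable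
qed

text \<open>
  The indicator in the Boltzmann weight extends the measurability of \<open>H\<close> from the finite
  configurations, which form a measurable set, to all configurations.
\<close>

lemma boltzmann_measurable:
  assumes "energy_functional H"
  shows "boltzmann H \<in> borel_measurable config_space"
proof -
  have "(\<lambda>\<gamma>. exp_minus (H \<gamma>)) \<in> borel_measurable (restrict_space config_space configs_fin)"
    using assms by (auto simp: energy_functional_def)
  then have "(\<lambda>\<gamma>. exp_minus (H \<gamma>) * indicator configs_fin \<gamma>) \<in> borel_measurable config_space"
    by (subst (asm) borel_measurable_restrict_space_iff_ennreal) (auto intro!: sets.Int configs_fin_sets sets.top[of config_space, simplified])
  then show ?thesis by (simp add: boltzmann_def[abs_def])
qed

lemma boltzmann_finite: "energy_functional H \<Longrightarrow> boltzmann H \<gamma> < \<infinity>"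
  by (cases "H \<gamma>") (auto simp: boltzmann_def exp_minus_def energy_functional_def indicator_def)

lemma boltzmann_stable:
  fixes H :: "('d::finite, 's::real_normed_vector) config \<Rightarrow> ereal"
  assumes "energy_functional H" "stable_energy \<delta> H"
  shows "\<exists>c\<ge>0. \<forall>\<gamma>. boltzmann H \<gamma> \<le>
    (if finite \<gamma> then ennreal (exp (\<Sum>p\<in>\<gamma>. c * (1 + norm (snd p) powr (real CARD('d) + \<delta>)))) else 0)"
proof -
  obtain c where c: "0 \<le> c" "\<And>\<gamma>. \<gamma> \<in> configs_fin \<Longrightarrow> H \<gamma> \<ge> - (ereal c * enn2ereal (pairing \<gamma> (mark_weight \<delta>)))"
    using assms(2) unfolding stable_energy_def by blast
  have "boltzmann H \<gamma> \<le> ennreal (exp (\<Sum>p\<in>\<gamma>. c * (1 + norm (snd p) powr (real CARD('d) + \<delta>))))"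
    if fin: "finite \<gamma>" for \<gamma>
  proof -
    define s where "s = (\<Sum>p\<in>\<gamma>. 1 + norm (snd p) powr (real CARD('d) + \<delta>))"
    have "pairing \<gamma> (mark_weight \<delta>) = ennreal s"
      unfolding pairing_def nn_integral_count_space_finite[OF fin] s_def mark_weight_def case_prod_unfold
      by (rule sum_ennreal) simp
    moreover have "0 \<le> s" by (simp add: s_def sum_nonneg)
    ultimately have le: "H \<gamma> \<ge> ereal (- (c * s))"
      using c(2)[of \<gamma>] fin by (simp add: configs_fin_def enn2ereal_ennreal)
    then have "exp_minus (H \<gamma>) \<le> ennreal (exp (c * s))"
      by (cases "H \<gamma>") (auto simp: exp_minus_def)
    then show ?thesis
      using fin by (simp add: boltzmann_def configs_fin_def s_def sum_distrib_left)
  qed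
  then show ?thesis
    using c(1) by (intro exI[of _ c]) (auto simp: boltzmann_def configs_fin_def)
qed

lemma measure_box_n_le: "measure lborel (box_n n :: (real^'d::finite) set) \<le> (2 * real n) ^ CARD('d)"
proof -
  have "box_n n \<subseteq> cbox (\<chi> i. - real n) (\<chi> i. real n :: real^'d)"
    by (auto simp: box_n_def mem_box_cart less_imp_le)
  then have "measure lborel (box_n n :: (real^'d) set) \<le> measure lborel (cbox (\<chi> i. - real n) (\<chi> i. real n :: real^'d))"
    by (intro measure_mono_fmeasurable) (simp_all add: box_n_borel)
  also have "\<dots> = (2 * real n) ^ CARD('d)"
    by (subst content_cbox_cart) (simp_all add: interval_ne_empty_cart del: box_ne_empty)
  finally show ?thesis .
qed

text \<open>
  The density of the finite-volume measure with respect to the Poisson law of its box, as a real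
  function, so that its logarithm can be integrated.
\<close>

definition gibbs_density :: "(('d::finite, 's) config \<Rightarrow> ereal)
    \<Rightarrow> ((real ^ 'd) set \<Rightarrow> ('d, 's) config measure) \<Rightarrow> nat \<Rightarrow> ('d, 's) config \<Rightarrow> real" where
  "gibbs_density H PP n \<gamma> = enn2real (boltzmann H (restr (box_n n) \<gamma>) / partition_fun H PP n)"

lemma gibbs_density_restr: "gibbs_density H PP n (restr (box_n n) \<gamma>) = gibbs_density H PP n \<gamma>"
  by (simp add: gibbs_density_def)

lemma gibbs_density_nonneg: "0 \<le> gibbs_density H PP n \<gamma>"
  by (simp add: gibbs_density_def)

lemma gibbs_density_measurable:
  assumes "energy_functional H"
  shows "gibbs_density H PP n \<in> borel_measurable config_space"
proof -
  have [measurable]: "(\<lambda>\<gamma>. boltzmann H (restr (box_n n) \<gamma>)) \<in> borel_measurable config_space"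
    by (rule measurable_compose[OF measurable_restr[OF box_n_borel] boltzmann_measurable[OF assms]])
  show ?thesis unfolding gibbs_density_def by measurable
qed

text \<open>
  The entropy of the finite-volume measure is at most of the order of the volume. Let \<open>V\<close> be the
  volume of the box. The partition function is at least the probability \<open>exp (- z V)\<close> of an empty
  box, and by stability \<open>e\<^sup>-\<^sup>2\<^sup>H\<close> is bounded by an exponential of a sum over the points, with
  mean at most \<open>exp (z V C)\<close>. Hence the second moment of the density is at most
  \<open>exp (z V (2 + C))\<close>, and its logarithm bounds the entropy.
\<close>

lemma P_box_density:
  fixes H :: "('d::finite, 's::real_normed_vector) config \<Rightarrow> ereal"
  assumes z: "z > 0" and \<delta>: "\<delta> > 0" and R: "prob_space R" "sets R = sets borel" and H: "energy_functional H"
    and PP: "\<And>\<Lambda>. \<Lambda> \<in> sets borel \<Longrightarrow> poisson_law (intensity z R \<Lambda>) (PP \<Lambda>)"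
    and mm: "mark_moment TYPE('d) \<delta> R" and stable: "stable_energy \<delta> H"
  shows "\<exists>a>0. \<forall>n. P_box H PP n = density (PP (box_n n)) (\<lambda>\<gamma>. ennreal (gibbs_density H PP n \<gamma>)) \<and>
      prob_space (P_box H PP n) \<and> integrable (P_box H PP n) (\<lambda>\<gamma>. ln (gibbs_density H PP n \<gamma>)) \<and>
      0 \<le> (\<integral>\<gamma>. ln (gibbs_density H PP n \<gamma>) \<partial>P_box H PP n) \<and>
      (\<integral>\<gamma>. ln (gibbs_density H PP n \<gamma>) \<partial>P_box H PP n) \<le> a * (2 * real n) ^ CARD('d)"
proof -
  define w where "w m = norm m powr (real CARD('d) + \<delta>)" for m :: 's
  obtain c where c: "0 \<le> c" and c_le: "\<And>\<gamma>. boltzmann H \<gamma> \<le>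
    (if finite \<gamma> then ennreal (exp (\<Sum>p\<in>\<gamma>. c * (1 + w (snd p)))) else 0)"
    using boltzmann_stable[OF H stable] unfolding w_def by blast
  obtain C where C: "0 \<le> C" "(\<integral>\<^sup>+m. ennreal (exp (2 * c * (w m + 2))) \<partial>R) \<le> ennreal C"
    using exp_weight_integrable[OF mm \<delta> R, of "2 * c"] c unfolding w_def by auto
  show ?thesis
  proof (intro exI[of _ "z * (2 + C)"] conjI allI)
    show "0 < z * (2 + C)" using z C by simp
    fix n
    define \<pi> where "\<pi> = PP (box_n n)"
    have \<pi>: "poisson_law (intensity z R (box_n n)) \<pi>"
      unfolding \<pi>_def by (rule PP[OF box_n_borel])
    interpret \<pi>: prob_space \<pi> using \<pi> by (simp add: poisson_law_def)
    have sets\<pi>: "sets \<pi> = sets config_space" using \<pi> by (simp add: poisson_law_def)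
    define V where "V = measure lborel (box_n n :: (real^'d) set)"
    have V: "0 \<le> V" "V \<le> (2 * real n) ^ CARD('d)"
      unfolding V_def by (simp, rule measure_box_n_le)
    define B where "B \<gamma> = boltzmann H (restr (box_n n) \<gamma>)" for \<gamma>
    have Bm[measurable]: "B \<in> borel_measurable \<pi>"
      unfolding B_def[abs_def] measurable_cong_sets[OF sets\<pi> refl]
      by (rule measurable_compose[OF measurable_restr[OF box_n_borel] boltzmann_measurable[OF H]])
    define Z where "Z = partition_fun H PP n"
    have Z_eq: "Z = (\<integral>\<^sup>+\<gamma>. B \<gamma> \<partial>\<pi>)"
      by (simp add: Z_def partition_fun_def B_def \<pi>_def)
    have B2: "(\<integral>\<^sup>+\<gamma>. B \<gamma> * B \<gamma> \<partial>\<pi>) \<le> ennreal (exp (z * V * C))"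
    proof -
      have "(\<integral>\<^sup>+\<gamma>. B \<gamma> * B \<gamma> \<partial>\<pi>) \<le>
        (\<integral>\<^sup>+\<gamma>. (if finite (restr (box_n n) \<gamma>) then ennreal (exp (\<Sum>p\<in>restr (box_n n) \<gamma>. 2 * c * (1 + w (snd p)))) else 0) \<partial>\<pi>)"
      proof (rule nn_integral_mono)
        fix \<gamma>
        have "B \<gamma> * B \<gamma> \<le> (if finite (restr (box_n n) \<gamma>) then ennreal (exp (\<Sum>p\<in>restr (box_n n) \<gamma>. c * (1 + w (snd p)))) else 0)
           * (if finite (restr (box_n n) \<gamma>) then ennreal (exp (\<Sum>p\<in>restr (box_n n) \<gamma>. c * (1 + w (snd p)))) else 0)"
          unfolding B_def by (intro mult_mono c_le) auto
        also have "\<dots> = (if finite (restr (box_n n) \<gamma>) then ennreal (exp (\<Sum>p\<in>restr (box_n n) \<gamma>. 2 * c * (1 + w (snd p)))) else 0)"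
          by (simp add: ennreal_mult[symmetric] exp_add[symmetric] sum.distrib[symmetric] algebra_simps)
        finally show "B \<gamma> * B \<gamma> \<le> (if finite (restr (box_n n) \<gamma>) then ennreal (exp (\<Sum>p\<in>restr (box_n n) \<gamma>. 2 * c * (1 + w (snd p)))) else 0)" .
      qed
      also have "\<dots> \<le> ennreal (exp (z * V * C))"
        unfolding V_def using z c C
        by (intro poisson_law_exp_linear[OF \<pi> R]) (auto simp: box_n_bounded box_n_borel w_def[abs_def])
      finally show ?thesis .
    qed
    \<comment> \<open>The empty configuration has weight one.\<close>
    have Z_ge: "ennreal (exp (- (z * V))) \<le> Z"
    proof -
      define E where "E = {\<gamma> \<in> space \<pi>. cnt \<gamma> (box_n n \<times> (UNIV :: 's set)) = of_nat 0}"
      have E: "E \<in> sets \<pi>"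
      proof -
        have [measurable]: "(\<lambda>\<gamma>. cnt \<gamma> (box_n n \<times> (UNIV :: 's set))) \<in> borel_measurable \<pi>"
          unfolding measurable_cong_sets[OF sets\<pi> refl] by (intro measurable_cnt box_n_bounded box_n_borel) auto
        show ?thesis unfolding E_def by measurable
      qed
      have "measure (intensity z R (box_n n)) ((box_n n :: (real^'d) set) \<times> UNIV) = z * V"
      proof -
        have bb: "(box_n n :: (real^'d) set) \<in> sets borel"
          by (rule box_n_borel)
        have "emeasure R UNIV = 1"
          using prob_space.emeasure_space_1[OF R(1)] sets_eq_imp_space_eq[OF R(2)] by simp
        then show ?thesis
          using z emeasure_intensity[OF R bb bb, of UNIV z]
          by (simp add: measure_def enn2real_mult V_def)
      qed
      then have "ennreal (exp (- (z * V))) = emeasure \<pi> E"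
        unfolding E_def \<pi>.emeasure_eq_measure
        by (subst poisson_law_prob_cnt[OF \<pi> box_n_bounded box_n_borel]) auto
      also have "emeasure \<pi> E = (\<integral>\<^sup>+\<gamma>. indicator E \<gamma> \<partial>\<pi>)"
        using E by simp
      also have "\<dots> \<le> (\<integral>\<^sup>+\<gamma>. B \<gamma> \<partial>\<pi>)"
      proof (rule nn_integral_mono)
        fix \<gamma>
        show "indicator E \<gamma> \<le> B \<gamma>"
        proof (cases "\<gamma> \<in> E")
          case True
          then have "cnt \<gamma> (box_n n \<times> UNIV) = 0" by (simp add: E_def)
          then have "restr (box_n n) \<gamma> = {}"
            by (auto simp: cnt_def restr_def emeasure_count_space split: if_splits)
          moreover have "H {} = 0" using H by (simp add: energy_functional_def)
          ultimately have "B \<gamma> = 1"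
            by (simp add: B_def boltzmann_def configs_fin_def zero_ereal_def exp_minus_def)
          then show ?thesis by (simp add: indicator_def)
        qed simp
      qed
      finally show ?thesis by (simp add: Z_eq)
    qed
    \<comment> \<open>Since \<open>B \<le> 1 + B\<^sup>2\<close>, the bound on the second moment also bounds \<open>Z\<close>.\<close>
    have Z_fin: "Z < \<infinity>"
    proof -
      have "Z \<le> (\<integral>\<^sup>+\<gamma>. 1 + B \<gamma> * B \<gamma> \<partial>\<pi>)"
        unfolding Z_eq
      proof (rule nn_integral_mono)
        fix \<gamma> show "B \<gamma> \<le> 1 + B \<gamma> * B \<gamma>"
        proof (cases "B \<gamma> \<le> 1")
          case False
          then have "B \<gamma> * 1 \<le> B \<gamma> * B \<gamma>" by (intro mult_left_mono) auto
          then show ?thesis by (simp add: add_increasing)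
        qed (simp add: add_increasing2)
      qed
      also have "\<dots> = 1 + (\<integral>\<^sup>+\<gamma>. B \<gamma> * B \<gamma> \<partial>\<pi>)"
        by (subst nn_integral_add) (auto simp: \<pi>.emeasure_space_1)
      also have "\<dots> \<le> 1 + ennreal (exp (z * V * C))"
        using B2 by (intro add_left_mono)
      also have "\<dots> < \<infinity>" by simp
      finally show ?thesis .
    qed
    define zz where "zz = enn2real Z"
    have zz: "Z = ennreal zz" using Z_fin by (simp add: zz_def less_top)
    have zz_ge: "exp (- (z * V)) \<le> zz"
      using Z_ge unfolding zz by (simp add: ennreal_le_iff2)
    then have zz_pos: "0 < zz" using exp_gt_zero[of "- (z * V)"] by linarith
    define \<rho> where "\<rho> = gibbs_density H PP n"
    have Bfin: "B \<gamma> = ennreal (enn2real (B \<gamma>))" for \<gamma>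
      using boltzmann_finite[OF H] by (simp add: B_def less_top)
    have \<rho>_eq: "\<rho> \<gamma> = enn2real (B \<gamma>) / zz" for \<gamma>
      unfolding \<rho>_def gibbs_density_def Z_def[symmetric] B_def[symmetric] zz
      by (subst Bfin) (use zz_pos in \<open>simp add: divide_ennreal\<close>)
    have \<rho>: "ennreal (\<rho> \<gamma>) = B \<gamma> / Z" for \<gamma>
      unfolding \<rho>_eq zz by (subst (2) Bfin) (use zz_pos in \<open>simp add: divide_ennreal\<close>)
    have \<rho>m[measurable]: "\<rho> \<in> borel_measurable \<pi>"
      unfolding \<rho>_def measurable_cong_sets[OF sets\<pi> refl] by (rule gibbs_density_measurable[OF H])
    have \<rho>0: "0 \<le> \<rho> \<gamma>" for \<gamma>
      by (simp add: \<rho>_def gibbs_density_nonneg)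
    show dens: "P_box H PP n = density (PP (box_n n)) (\<lambda>\<gamma>. ennreal (gibbs_density H PP n \<gamma>))"
      unfolding P_box_def \<rho>_def[symmetric] \<rho> by (simp add: B_def Z_def)
    then have dens': "P_box H PP n = density \<pi> (\<lambda>\<gamma>. ennreal (\<rho> \<gamma>))"
      by (simp add: \<pi>_def \<rho>_def)
    show prob: "prob_space (P_box H PP n)"
    proof (rule prob_spaceI)
      have "emeasure (P_box H PP n) (space (P_box H PP n)) = (\<integral>\<^sup>+\<gamma>. B \<gamma> / Z \<partial>\<pi>)"
        unfolding dens' \<rho> by (subst emeasure_density) (auto intro!: nn_integral_cong)
      also have "\<dots> = Z / Z"
        by (simp add: nn_integral_divide Z_eq[symmetric])
      also have "\<dots> = 1"
        using zz_pos by (simp add: zz divide_ennreal)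
      finally show "emeasure (P_box H PP n) (space (P_box H PP n)) = 1" .
    qed
    define K where "K = exp (z * V * C) * exp (2 * (z * V))"
    have "(\<integral>\<^sup>+\<gamma>. ennreal (\<rho> \<gamma> * \<rho> \<gamma>) \<partial>\<pi>) \<le> ennreal K"
    proof -
      have "ennreal (\<rho> \<gamma> * \<rho> \<gamma>) = B \<gamma> * B \<gamma> * ennreal (1 / (zz * zz))" for \<gamma>
        unfolding \<rho>_eq by (subst (3 4) Bfin) (use zz_pos in \<open>simp add: ennreal_mult[symmetric]\<close>)
      then have "(\<integral>\<^sup>+\<gamma>. ennreal (\<rho> \<gamma> * \<rho> \<gamma>) \<partial>\<pi>) = (\<integral>\<^sup>+\<gamma>. B \<gamma> * B \<gamma> \<partial>\<pi>) * ennreal (1 / (zz * zz))"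
        by (simp add: nn_integral_multc)
      also have "\<dots> \<le> ennreal (exp (z * V * C)) * ennreal (exp (2 * (z * V)))"
      proof (intro mult_mono B2)
        have "1 / (zz * zz) \<le> 1 / (exp (- (z * V)) * exp (- (z * V)))"
          using zz_ge zz_pos by (intro divide_left_mono mult_mono) auto
        also have "\<dots> = exp (2 * (z * V))"
          by (simp add: exp_minus exp_add[symmetric] field_simps mult_exp_exp)
        finally show "ennreal (1 / (zz * zz)) \<le> ennreal (exp (2 * (z * V)))"
          by (rule ennreal_leI)
      qed auto
      finally show ?thesis by (simp add: K_def ennreal_mult)
    qed
    moreover have "0 < K" by (simp add: K_def)
    ultimately have *: "integrable (P_box H PP n) (\<lambda>\<gamma>. ln (\<rho> \<gamma>))"
        "(\<integral>\<gamma>. ln (\<rho> \<gamma>) \<partial>P_box H PP n) \<le> ln K" "0 \<le> (\<integral>\<gamma>. ln (\<rho> \<gamma>) \<partial>P_box H PP n)"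
      using ln_density_L2[OF \<pi>.prob_space_axioms \<rho>m \<rho>0 dens' prob] by blast+
    from *(1,3) show "integrable (P_box H PP n) (\<lambda>\<gamma>. ln (gibbs_density H PP n \<gamma>))"
        "0 \<le> (\<integral>\<gamma>. ln (gibbs_density H PP n \<gamma>) \<partial>P_box H PP n)"
      by (simp_all add: \<rho>_def)
    have "ln K = z * (2 + C) * V"
      by (simp add: K_def exp_add[symmetric] algebra_simps)
    also have "\<dots> \<le> z * (2 + C) * (2 * real n) ^ CARD('d)"
      using z C V by (intro mult_left_mono) auto
    finally show "(\<integral>\<gamma>. ln (gibbs_density H PP n \<gamma>) \<partial>P_box H PP n) \<le> z * (2 + C) * (2 * real n) ^ CARD('d)"
      using *(2) by (simp add: \<rho>_def)
  qed
qed

section \<open>Tilings by translated boxes\<close>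

text \<open>
  Such cubes index both the shifts of the empirical field and the tiles around a window.
\<close>

definition lattice_cube :: "int \<Rightarrow> int \<Rightarrow> (real ^ 'd::finite) set" where
  "lattice_cube a b = {\<kappa> \<in> lattice_pts. \<forall>i. of_int a \<le> \<kappa> $ i \<and> \<kappa> $ i < of_int b}"

lemma lattice_cube_image:
  "(lattice_cube a b :: (real ^ 'd::finite) set) = (\<lambda>f. \<chi> i. real_of_int (f i)) ` (UNIV \<rightarrow>\<^sub>E {a..<b})" (is "_ = ?h ` ?F")
proof (intro set_eqI iffI)
  fix \<kappa> :: "real^'d" assume \<kappa>: "\<kappa> \<in> lattice_cube a b"
  have int: "real_of_int \<lfloor>\<kappa> $ i\<rfloor> = \<kappa> $ i" for i
    using \<kappa> by (auto simp: lattice_cube_def lattice_pts_def)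
  have "\<kappa> = ?h (\<lambda>i. \<lfloor>\<kappa> $ i\<rfloor>)"
    by (simp add: vec_eq_iff int)
  moreover have "a \<le> \<lfloor>\<kappa> $ i\<rfloor> \<and> \<lfloor>\<kappa> $ i\<rfloor> < b" for i
    using \<kappa> by (simp add: lattice_cube_def le_floor_iff floor_less_iff)
  then have "(\<lambda>i. \<lfloor>\<kappa> $ i\<rfloor>) \<in> ?F" by auto
  ultimately show "\<kappa> \<in> ?h ` ?F" by (rule image_eqI)
next
  fix \<kappa> :: "real^'d" assume "\<kappa> \<in> ?h ` ?F"
  then show "\<kappa> \<in> lattice_cube a b"
    by (auto simp: lattice_cube_def lattice_pts_def PiE_def Pi_def)
qed

lemma finite_lattice_cube: "finite (lattice_cube a b)"
  unfolding lattice_cube_image by (intro finite_imageI finite_PiE) auto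

lemma card_lattice_cube: "card (lattice_cube a b :: (real^'d::finite) set) = nat (b - a) ^ CARD('d)"
proof -
  have "inj_on (\<lambda>f. \<chi> i::'d. real_of_int (f i)) (UNIV \<rightarrow>\<^sub>E {a..<b})"
    by (auto simp: inj_on_def vec_eq_iff)
  then show ?thesis
    unfolding lattice_cube_image by (simp add: card_image card_PiE)
qed

lemma lattice_cube_subset: "lattice_cube a b \<subseteq> lattice_pts"
  by (auto simp: lattice_cube_def)

lemma box_n_lattice: "box_n n \<inter> lattice_pts = lattice_cube (- int n) (int n)"
  by (auto simp: box_n_def lattice_cube_def)

text \<open>
  The tile with index \<open>\<eta>\<close> in the tiling by boxes of side \<open>2 n\<close> that is shifted by \<open>\<kappa>\<close>. It is written
  as a preimage because restricting a translated configuration produces this form.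
\<close>

definition block :: "nat \<Rightarrow> real ^ 'd::finite \<Rightarrow> real ^ 'd \<Rightarrow> (real ^ 'd) set" where
  "block n \<kappa> \<eta> = {x. x + - ((2 * real n) *\<^sub>R \<eta> + \<kappa>) \<in> box_n n}"

lemma block_mem: "x \<in> block n \<kappa> \<eta> \<longleftrightarrow>
   (\<forall>i. - real n \<le> x $ i - 2 * real n * \<eta> $ i - \<kappa> $ i \<and> x $ i - 2 * real n * \<eta> $ i - \<kappa> $ i < real n)"
  by (simp add: block_def box_n_def algebra_simps)

lemma block_disjoint: "disjoint_family_on (block n \<kappa>) lattice_pts"
proof -
  have "\<eta> = \<eta>'" if l: "\<eta> \<in> lattice_pts" "\<eta>' \<in> lattice_pts" and x: "x \<in> block n \<kappa> \<eta>" "x \<in> block n \<kappa> \<eta>'"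
    for x \<eta> \<eta>' :: "real^'a"
  proof -
    have "\<eta> $ i = \<eta>' $ i" for i
    proof -
      have "2 * real n * (\<eta> $ i - \<eta>' $ i) < 2 * real n" "2 * real n * (\<eta>' $ i - \<eta> $ i) < 2 * real n"
        using x[unfolded block_mem, THEN spec, of i] by (simp_all add: algebra_simps)
      moreover have "0 < real n"
        using x(1)[unfolded block_mem, THEN spec, of i] by linarith
      ultimately have "\<eta> $ i - \<eta>' $ i < 1" "\<eta>' $ i - \<eta> $ i < 1"
        by simp_all
      \<comment> \<open>Two integers at distance less than one agree.\<close>
      moreover obtain a b where "\<eta> $ i = of_int a" "\<eta>' $ i = of_int b"
        using l unfolding lattice_pts_def mem_Collect_eq by (metis Ints_cases)
      ultimately have "a - b < 1" "b - a < 1" by linarith+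
      then show ?thesis using \<open>\<eta> $ i = of_int a\<close> \<open>\<eta>' $ i = of_int b\<close> by simp
    qed
    then show ?thesis by (simp add: vec_eq_iff)
  qed
  then show ?thesis unfolding disjoint_family_on_def by blast
qed

text \<open>
  A point lies in the tile obtained by rounding down its rescaled coordinates. As \<open>\<kappa>\<close> shifts by at
  most half a tile, \<open>2 k + 1\<close> tiles in each direction suffice to cover a window of half side \<open>2 n k\<close>.
\<close>

lemma blocks_cover:
  assumes n: "n \<ge> 1" and N: "N \<le> 2 * n * k" and \<kappa>: "\<kappa> \<in> box_n n"
  shows "box_n N \<subseteq> (\<Union>\<eta>\<in>lattice_cube (- int k) (int k + 1). block n \<kappa> \<eta>)"
proof
  fix x :: "real^'a" assume x: "x \<in> box_n N"
  define y where "y i = (x $ i - \<kappa> $ i + real n) / (2 * real n)" for i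
  define \<eta> :: "real^'a" where "\<eta> = (\<chi> i. of_int \<lfloor>y i\<rfloor>)"
  have n0: "0 < 2 * real n" using n by simp
  have N': "real N \<le> 2 * real n * real k"
    using N by (metis of_nat_le_iff of_nat_mult of_nat_numeral)
  have y: "2 * real n * y i = x $ i - \<kappa> $ i + real n" for i
    using n0 by (simp add: y_def)
  have "x \<in> block n \<kappa> \<eta>"
    unfolding block_mem
  proof
    fix i
    have "2 * real n * of_int \<lfloor>y i\<rfloor> \<le> 2 * real n * y i" "2 * real n * y i < 2 * real n * (of_int \<lfloor>y i\<rfloor> + 1)"
      using n0 by (intro mult_left_mono mult_strict_left_mono; linarith)+
    then show "- real n \<le> x $ i - 2 * real n * \<eta> $ i - \<kappa> $ i \<and> x $ i - 2 * real n * \<eta> $ i - \<kappa> $ i < real n"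
      unfolding y by (simp add: \<eta>_def algebra_simps)
  qed
  moreover have "\<eta> \<in> lattice_cube (- int k) (int k + 1)"
  proof -
    have *: "- real k \<le> y i \<and> y i < real k + 1" for i
    proof -
      have "- real N \<le> x $ i" "x $ i < real N" "- real n \<le> \<kappa> $ i" "\<kappa> $ i < real n"
        using x \<kappa> by (auto simp: box_n_def)
      then have "2 * real n * (- real k) \<le> 2 * real n * y i" "2 * real n * y i < 2 * real n * (real k + 1)"
        unfolding y using N' by (simp_all add: algebra_simps)
      then show ?thesis
        unfolding mult_le_cancel_left_pos[OF n0] mult_less_cancel_left_pos[OF n0] by blast
    qed
    have "- int k \<le> \<lfloor>y i\<rfloor> \<and> \<lfloor>y i\<rfloor> < int k + 1" for i
      using *[of i] by (intro conjI; linarith)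
    then have "of_int (- int k) \<le> real_of_int \<lfloor>y i\<rfloor> \<and> real_of_int \<lfloor>y i\<rfloor> < of_int (int k + 1)" for i
      unfolding of_int_le_iff of_int_less_iff by blast
    then show ?thesis by (simp add: lattice_cube_def lattice_pts_def \<eta>_def)
  qed
  ultimately show "x \<in> (\<Union>\<eta>\<in>lattice_cube (- int k) (int k + 1). block n \<kappa> \<eta>)" by blast
qed

lemma block_inside:
  assumes N: "2 * n * k + 2 * n \<le> N" and \<kappa>: "\<kappa> \<in> box_n n" and l: "\<eta> \<in> lattice_cube (- int k) (int k + 1)"
  shows "block n \<kappa> \<eta> \<subseteq> box_n N"
proof
  fix x :: "real^'a" assume x: "x \<in> block n \<kappa> \<eta>"
  have N': "2 * real n * real k + 2 * real n \<le> real N"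
    using N by (metis of_nat_add of_nat_le_iff of_nat_mult of_nat_numeral)
  show "x \<in> box_n N"
    unfolding box_n_def mem_Collect_eq
  proof
    fix i
    obtain a where a: "\<eta> $ i = of_int a"
      using l unfolding lattice_cube_def lattice_pts_def mem_Collect_eq by (metis Ints_cases)
    have "of_int (- int k) \<le> \<eta> $ i \<and> \<eta> $ i < of_int (int k + 1)"
      using l unfolding lattice_cube_def by blast
    then have "- int k \<le> a \<and> a < int k + 1"
      unfolding a by (simp only: of_int_le_iff of_int_less_iff)
    then have "- real k \<le> \<eta> $ i" "\<eta> $ i \<le> real k"
      unfolding a by linarith+
    then have "2 * real n * (- real k) \<le> 2 * real n * \<eta> $ i" "2 * real n * \<eta> $ i \<le> 2 * real n * real k"
      by (intro mult_left_mono; simp)+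
    moreover have "- real n \<le> \<kappa> $ i" "\<kappa> $ i < real n"
      using \<kappa> by (auto simp: box_n_def)
    ultimately show "- real N \<le> x $ i \<and> x $ i < real N"
      using x[unfolded block_mem, THEN spec, of i] N' by (intro conjI; linarith)
  qed
qed

section \<open>Gluing configurations\<close>

text \<open>
  Gluing over a part of the lattice. A bounded window meets finitely many tiles, so there the
  infinite gluing coincides with a finite one.
\<close>

definition glue_on :: "(real ^ 'd::finite) set \<Rightarrow> nat \<Rightarrow> (real ^ 'd \<Rightarrow> ('d, 's) config) \<Rightarrow> ('d, 's) config" where
  "glue_on J n \<omega> = (\<Union>\<kappa>\<in>J. shift ((2 * real n) *\<^sub>R \<kappa>) (restr (box_n n) (\<omega> \<kappa>)))"

lemma glue_eq_glue_on: "glue n = glue_on lattice_pts n"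
  by (simp add: glue_def[abs_def] glue_on_def[abs_def])

lemma restr_box_n_shift:
  "restr (box_n n) (shift (- ((2 * real n) *\<^sub>R \<eta> + \<kappa>)) \<gamma>) =
    shift (- ((2 * real n) *\<^sub>R \<eta> + \<kappa>)) (restr (block n \<kappa> \<eta>) \<gamma>)"
  by (simp add: restr_shift block_def)

lemma shift_restr_box_n:
  "shift ((2 * real n) *\<^sub>R \<eta> + \<kappa>) (restr (box_n n) \<gamma>) =
    restr (block n \<kappa> \<eta>) (shift ((2 * real n) *\<^sub>R \<eta> + \<kappa>) \<gamma>)"
  by (simp add: restr_shift block_def)

lemma restr_shift_glue_on:
  "restr C (shift \<kappa> (glue_on J n \<omega>)) = (\<Union>\<eta>\<in>J. restr (C \<inter> block n \<kappa> \<eta>) (shift ((2 * real n) *\<^sub>R \<eta> + \<kappa>) (\<omega> \<eta>)))"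
  unfolding glue_on_def shift_UN shift_shift shift_restr_box_n restr_UN restr_restr ..

text \<open>
  The tiles are disjoint, so cutting a tile out of a glued configuration recovers the copy that was
  placed there.
\<close>

lemma glue_on_block:
  assumes J: "J \<subseteq> lattice_pts" "\<eta> \<in> J"
  shows "restr (box_n n) (shift (- ((2 * real n) *\<^sub>R \<eta> + \<kappa>)) (shift \<kappa> (glue_on J n \<omega>))) = restr (box_n n) (\<omega> \<eta>)"
proof -
  have "restr (block n \<kappa> \<eta> \<inter> block n \<kappa> \<mu>) \<gamma> = (if \<mu> = \<eta> then restr (block n \<kappa> \<eta>) \<gamma> else {})" if "\<mu> \<in> J" 
    for \<mu> and \<gamma> :: "('a, 'b) config"
  proof (cases "\<mu> = \<eta>")
    case False
    then have "block n \<kappa> \<eta> \<inter> block n \<kappa> \<mu> = {}"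
      using disjoint_family_onD[OF block_disjoint[of n \<kappa>], of \<eta> \<mu>] J that by blast
    then show ?thesis using False by (simp add: restr_def)
  qed simp
  then have "restr (block n \<kappa> \<eta>) (shift \<kappa> (glue_on J n \<omega>))
      = (\<Union>\<mu>\<in>J. if \<mu> = \<eta> then restr (block n \<kappa> \<eta>) (shift ((2 * real n) *\<^sub>R \<mu> + \<kappa>) (\<omega> \<mu>)) else {})"
    unfolding restr_shift_glue_on by (intro SUP_cong refl) simp
  also have "\<dots> = shift ((2 * real n) *\<^sub>R \<eta> + \<kappa>) (restr (box_n n) (\<omega> \<eta>))"
    unfolding shift_restr_box_n using J(2) by (auto split: if_splits)
  finally show ?thesis
    unfolding restr_box_n_shift by simp
qed

lemma restr_glue_cover:
  assumes J: "J \<subseteq> K" "K \<subseteq> lattice_pts" and cover: "C \<subseteq> (\<Union>\<eta>\<in>J. block n \<kappa> \<eta>)"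
  shows "restr C (shift \<kappa> (glue_on K n \<omega>)) = restr C (shift \<kappa> (glue_on J n \<omega>))"
proof -
  have "C \<inter> block n \<kappa> \<eta> = {}" if "\<eta> \<in> K - J" for \<eta>
  proof (rule equals0I)
    fix x assume x: "x \<in> C \<inter> block n \<kappa> \<eta>"
    then obtain \<mu> where \<mu>: "\<mu> \<in> J" "x \<in> block n \<kappa> \<mu>"
      using cover by blast
    then have "\<mu> \<noteq> \<eta>" "\<mu> \<in> lattice_pts" "\<eta> \<in> lattice_pts"
      using that J by auto
    then have "block n \<kappa> \<mu> \<inter> block n \<kappa> \<eta> = {}"
      by (intro disjoint_family_onD[OF block_disjoint])
    then show False using x \<mu> by blast
  qed
  then have "restr (C \<inter> block n \<kappa> \<eta>) \<gamma> = {}" if "\<eta> \<in> K - J" for \<eta> and \<gamma> :: "('a, 'b) config"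
    using that by (simp add: restr_def)
  then show ?thesis
    unfolding restr_shift_glue_on using J(1) by blast
qed

text \<open>
  Cutting a configuration into tiles and gluing them again changes nothing inside the tiled region.
\<close>

lemma restr_reglue:
  assumes cover: "C \<subseteq> (\<Union>\<eta>\<in>J. block n \<kappa> \<eta>)"
  shows "restr C (shift \<kappa> (glue_on J n (\<lambda>\<eta>\<in>J. restr (box_n n) (shift (- ((2 * real n) *\<^sub>R \<eta> + \<kappa>)) \<gamma>)))) = restr C \<gamma>"
proof -
  have "restr (C \<inter> block n \<kappa> \<eta>) (shift ((2 * real n) *\<^sub>R \<eta> + \<kappa>)
      ((\<lambda>\<eta>\<in>J. restr (box_n n) (shift (- ((2 * real n) *\<^sub>R \<eta> + \<kappa>)) \<gamma>)) \<eta>)) = restr (C \<inter> block n \<kappa> \<eta>) \<gamma>" if "\<eta> \<in> J" for \<eta>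
    using that unfolding restrict_apply'[OF that] restr_box_n_shift shift_shift by (simp add: Int_assoc)
  then have "restr C (shift \<kappa> (glue_on J n (\<lambda>\<eta>\<in>J. restr (box_n n) (shift (- ((2 * real n) *\<^sub>R \<eta> + \<kappa>)) \<gamma>))))
      = (\<Union>\<eta>\<in>J. restr (C \<inter> block n \<kappa> \<eta>) \<gamma>)"
    unfolding restr_shift_glue_on by (rule SUP_cong[OF refl])
  also have "\<dots> = restr C \<gamma>"
    using cover by (auto simp: restr_def)
  finally show ?thesis .
qed

lemma measurable_glue_on:
  assumes J: "finite J" "J \<subseteq> K" "J \<subseteq> lattice_pts"
  shows "glue_on J n \<in> measurable (PiM K (\<lambda>_. config_space)) config_space"
proof (rule measurable_into_config_space)
  fix \<omega> :: "real^'a \<Rightarrow> ('a, 'b) config" assume "\<omega> \<in> space (PiM K (\<lambda>_. config_space))"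
  then have "\<omega> \<eta> \<in> configs" if "\<eta> \<in> J" for \<eta>
    using J that by (auto simp: space_PiM PiE_iff)
  then have "shift v (restr (box_n n) (\<omega> \<eta>)) \<in> configs" if "\<eta> \<in> J" for \<eta> v
    using that by (intro configs_shift configs_restr)
  then show "glue_on J n \<omega> \<in> configs"
    using J(1) unfolding glue_on_def configs_def mem_Collect_eq by (intro countable_UN[OF countable_finite]) auto
next
  fix \<Delta> :: "(real^'a) set" and A :: "'b set"
  assume A: "bounded \<Delta>" "\<Delta> \<in> sets borel" "A \<in> sets borel"
  have "cnt (glue_on J n \<omega>) (\<Delta> \<times> A) = (\<Sum>\<eta>\<in>J. cnt (shift ((2 * real n) *\<^sub>R \<eta>) (restr (box_n n) (\<omega> \<eta>))) (\<Delta> \<times> A))"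
    for \<omega> :: "real^'a \<Rightarrow> ('a, 'b) config"
    unfolding glue_on_def
  proof (rule cnt_Union_config[OF J(1)])
    have sub: "shift ((2 * real n) *\<^sub>R \<eta>) (restr (box_n n) (\<omega> \<eta>)) \<subseteq> block n 0 \<eta> \<times> UNIV" for \<eta>
      using shift_restr_box_n[of n \<eta> 0 "\<omega> \<eta>"] by (auto simp: restr_def)
    show "disjoint_family_on (\<lambda>\<eta>. shift ((2 * real n) *\<^sub>R \<eta>) (restr (box_n n) (\<omega> \<eta>))) J"
      unfolding disjoint_family_on_def
    proof (intro ballI impI)
      fix \<eta> \<mu> assume "\<eta> \<in> J" "\<mu> \<in> J" "\<eta> \<noteq> \<mu>"
      then have "block n 0 \<eta> \<inter> block n 0 \<mu> = {}"
        using J(3) by (intro disjoint_family_onD[OF block_disjoint]) auto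
      then show "shift ((2 * real n) *\<^sub>R \<eta>) (restr (box_n n) (\<omega> \<eta>)) \<inter> shift ((2 * real n) *\<^sub>R \<mu>) (restr (box_n n) (\<omega> \<mu>)) = {}"
        using sub[of \<eta>] sub[of \<mu>] by blast
    qed
  qed
  moreover have "(\<lambda>\<omega>. \<Sum>\<eta>\<in>J. cnt (shift ((2 * real n) *\<^sub>R \<eta>) (restr (box_n n) (\<omega> \<eta>))) (\<Delta> \<times> A))
     \<in> borel_measurable (PiM K (\<lambda>_. config_space))"
  proof (rule borel_measurable_sum)
    fix \<eta> assume "\<eta> \<in> J"
    then have "(\<lambda>\<omega>. \<omega> \<eta>) \<in> measurable (PiM K (\<lambda>_. config_space)) config_space"
      using J by (intro measurable_component_singleton) auto
    from measurable_compose[OF measurable_compose[OF measurable_compose[OF this measurable_restr[OF box_n_borel]] measurable_shift] measurable_cnt[OF A]]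
    show "(\<lambda>\<omega>. cnt (shift ((2 * real n) *\<^sub>R \<eta>) (restr (box_n n) (\<omega> \<eta>))) (\<Delta> \<times> A)) \<in> borel_measurable (PiM K (\<lambda>_. config_space))" .
  qed
  ultimately show "(\<lambda>\<omega>. cnt (glue_on J n \<omega>) (\<Delta> \<times> A)) \<in> borel_measurable (PiM K (\<lambda>_. config_space))"
    by presburger
qed

lemma bounded_subset_box_n:
  assumes "bounded (\<Delta> :: (real^'d::finite) set)"
  shows "\<exists>N. \<Delta> \<subseteq> box_n N"
proof -
  obtain B where B: "\<And>x. x \<in> \<Delta> \<Longrightarrow> norm x \<le> B"
    using assms unfolding bounded_iff by blast
  obtain N where N: "B < real N" using reals_Archimedean2 by blast
  have "x \<in> box_n N" if "x \<in> \<Delta>" for x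
  proof -
    have "\<bar>x $ i\<bar> < real N" for i
      using component_le_norm_cart[of x i] B[OF that] N by linarith
    then have "- real N \<le> x $ i \<and> x $ i < real N" for i
      by (auto simp: abs_less_iff minus_less_iff intro: less_imp_le)
    then show ?thesis by (simp add: box_n_def)
  qed
  then show ?thesis by blast
qed

lemma zero_in_box_n: "n \<ge> 1 \<Longrightarrow> 0 \<in> box_n n"
  by (simp add: box_n_def)

lemma lattice_pts_countable: "countable (lattice_pts :: (real^'d::finite) set)"
proof -
  have "lattice_pts = (\<Union>k::nat. lattice_cube (- int k) (int k) :: (real^'d) set)"
    unfolding box_n_lattice[symmetric] using UN_box_n by auto
  then show ?thesis
    by (rule ssubst) (intro countable_UN countable_finite[OF finite_lattice_cube] countableI_type)
qed

text \<open>
  A count over a bounded set only sees the finitely many tiles that meet this set.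
\<close>

lemma measurable_glue:
  assumes n: "n \<ge> 1"
  shows "glue n \<in> measurable (PiM lattice_pts (\<lambda>_. config_space)) (config_space :: ('d::finite, 's::real_normed_vector) config measure)"
proof (rule measurable_into_config_space)
  fix \<omega> :: "real^'d \<Rightarrow> ('d, 's) config" assume "\<omega> \<in> space (PiM lattice_pts (\<lambda>_. config_space))"
  then have "\<omega> \<eta> \<in> configs" if "\<eta> \<in> lattice_pts" for \<eta>
    using that by (auto simp: space_PiM PiE_iff)
  then have "shift v (restr (box_n n) (\<omega> \<eta>)) \<in> configs" if "\<eta> \<in> lattice_pts" for \<eta> v
    using that by (intro configs_shift configs_restr)
  then show "glue n \<omega> \<in> configs"
    unfolding glue_def configs_def mem_Collect_eq by (intro countable_UN lattice_pts_countable) auto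
next
  fix \<Delta> :: "(real^'d) set" and A :: "'s set"
  assume A: "bounded \<Delta>" "\<Delta> \<in> sets borel" "A \<in> sets borel"
  obtain N where N: "\<Delta> \<subseteq> box_n N" using bounded_subset_box_n[OF A(1)] by blast
  have "N \<le> 2 * n * N" using n by (cases n) auto
  then have cov: "\<Delta> \<subseteq> (\<Union>\<eta>\<in>lattice_cube (- int N) (int N + 1). block n 0 \<eta>)"
    using blocks_cover[OF n _ zero_in_box_n[OF n]] N by blast
  have "cnt (glue n \<omega>) (\<Delta> \<times> A) = cnt (glue_on (lattice_cube (- int N) (int N + 1)) n \<omega>) (\<Delta> \<times> A)" 
    for \<omega> :: "real^'d \<Rightarrow> ('d, 's) config"
    using restr_glue_cover[OF lattice_cube_subset order_refl cov, of \<omega>] 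
    unfolding glue_eq_glue_on by (metis cnt_restr inf.idem shift_0)
  then show "(\<lambda>\<omega>. cnt (glue n \<omega>) (\<Delta> \<times> A)) \<in> borel_measurable (PiM lattice_pts (\<lambda>_. config_space))"
    using measurable_compose[OF measurable_glue_on[OF finite_lattice_cube lattice_cube_subset lattice_cube_subset] measurable_cnt[OF A]]
    by presburger
qed

section \<open>Mixtures and finite products\<close>

text \<open>
  An average of image measures is a single image measure, with the index as an additional random
  coordinate. In this form the comparison of entropies under a common map applies to averages.
\<close>

lemma uniform_mixture:
  assumes S: "finite S" "S \<noteq> {}" and M: "prob_space M" and F: "\<And>\<kappa>. \<kappa> \<in> S \<Longrightarrow> F \<kappa> \<in> measurable M N"
  shows measurable_uniform_mixture: "(\<lambda>(\<kappa>, \<omega>). F \<kappa> \<omega>) \<in> measurable (uniform_count_measure S \<Otimes>\<^sub>M M) N"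
    and emeasure_uniform_mixture: "B \<in> sets N \<Longrightarrow> emeasure (distr (uniform_count_measure S \<Otimes>\<^sub>M M) N (\<lambda>(\<kappa>, \<omega>). F \<kappa> \<omega>)) B
      = (\<Sum>\<kappa>\<in>S. emeasure (distr M N (F \<kappa>)) B) / of_nat (card S)"
proof -
  interpret M: prob_space M by fact
  have "sets (uniform_count_measure S \<Otimes>\<^sub>M M) = sets (count_space S \<Otimes>\<^sub>M M)"
    by (intro sets_pair_measure_cong sets_uniform_count_measure_count_space refl)
  note cong = measurable_cong_sets[OF this refl]
  show meas: "(\<lambda>(\<kappa>, \<omega>). F \<kappa> \<omega>) \<in> measurable (uniform_count_measure S \<Otimes>\<^sub>M M) N"
    unfolding cong using S F by (intro measurable_pair_measure_countable1) (auto intro: countable_finite)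
  assume B: "B \<in> sets N"
  define X where "X = (\<lambda>(\<kappa>, \<omega>). F \<kappa> \<omega>) -` B \<inter> space (uniform_count_measure S \<Otimes>\<^sub>M M)"
  have X: "X \<in> sets (uniform_count_measure S \<Otimes>\<^sub>M M)"
    unfolding X_def by (rule measurable_sets[OF meas B])
  have pre: "Pair \<kappa> -` X = F \<kappa> -` B \<inter> space M" if "\<kappa> \<in> S" for \<kappa>
    using that by (auto simp: X_def space_pair_measure space_uniform_count_measure)
  have "emeasure (distr (uniform_count_measure S \<Otimes>\<^sub>M M) N (\<lambda>(\<kappa>, \<omega>). F \<kappa> \<omega>)) B
      = emeasure (uniform_count_measure S \<Otimes>\<^sub>M M) X"
    unfolding X_def by (rule emeasure_distr[OF meas B])
  also have "\<dots> = (\<integral>\<^sup>+\<kappa>. emeasure M (Pair \<kappa> -` X) \<partial>uniform_count_measure S)"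
    by (rule M.emeasure_pair_measure_alt[OF X])
  also have "\<dots> = (\<Sum>\<kappa>\<in>S. ennreal (1 / real (card S)) * emeasure M (Pair \<kappa> -` X))"
    unfolding uniform_count_measure_def using S by (subst nn_integral_point_measure_finite) auto
  also have "\<dots> = (\<Sum>\<kappa>\<in>S. ennreal (1 / real (card S)) * emeasure (distr M N (F \<kappa>)) B)"
    using B F by (intro sum.cong refl) (simp add: pre emeasure_distr)
  also have "\<dots> = ennreal (1 / real (card S)) * (\<Sum>\<kappa>\<in>S. emeasure (distr M N (F \<kappa>)) B)"
    by (simp add: sum_distrib_left)
  also have "ennreal (1 / real (card S)) = 1 / of_nat (card S)"
    using S by (simp add: ennreal_of_nat_eq_real_of_nat card_gt_0_iff flip: divide_ennreal ennreal_1)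
  finally show "emeasure (distr (uniform_count_measure S \<Otimes>\<^sub>M M) N (\<lambda>(\<kappa>, \<omega>). F \<kappa> \<omega>)) B
      = (\<Sum>\<kappa>\<in>S. emeasure (distr M N (F \<kappa>)) B) / of_nat (card S)"
    by (simp add: divide_ennreal_def mult.commute)
qed

lemma uniform_mixture_const:
  assumes S: "finite S" "S \<noteq> {}" and M: "prob_space M" and F: "\<And>\<kappa>. \<kappa> \<in> S \<Longrightarrow> F \<kappa> \<in> measurable M N"
    and const: "\<And>\<kappa>. \<kappa> \<in> S \<Longrightarrow> distr M N (F \<kappa>) = L"
  shows "distr (uniform_count_measure S \<Otimes>\<^sub>M M) N (\<lambda>(\<kappa>, \<omega>). F \<kappa> \<omega>) = L"
proof (rule measure_eqI)
  obtain \<kappa> where "\<kappa> \<in> S" using S by blast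
  from const[OF this] have sets: "sets L = sets N" by auto
  then show "sets (distr (uniform_count_measure S \<Otimes>\<^sub>M M) N (\<lambda>(\<kappa>, \<omega>). F \<kappa> \<omega>)) = sets L" by simp
  fix B assume "B \<in> sets (distr (uniform_count_measure S \<Otimes>\<^sub>M M) N (\<lambda>(\<kappa>, \<omega>). F \<kappa> \<omega>))"
  then have B: "B \<in> sets N" by simp
  have "emeasure (distr (uniform_count_measure S \<Otimes>\<^sub>M M) N (\<lambda>(\<kappa>, \<omega>). F \<kappa> \<omega>)) B
      = (\<Sum>\<kappa>\<in>S. emeasure L B) / of_nat (card S)"
    by (subst emeasure_uniform_mixture[OF S M F B]) (simp_all add: const)
  also have "\<dots> = emeasure L B * of_nat (card S) / of_nat (card S)"
    by (simp add: mult.commute)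
  also have "\<dots> = emeasure L B"
    by (rule ennreal_mult_divide_eq) (use S in auto)
  finally show "emeasure (distr (uniform_count_measure S \<Otimes>\<^sub>M M) N (\<lambda>(\<kappa>, \<omega>). F \<kappa> \<omega>)) B = emeasure L B" .
qed

lemma PiM_density:
  fixes f :: "'a \<Rightarrow> real"
  assumes J: "finite J" and M: "prob_space M" and f[measurable]: "f \<in> borel_measurable M" and f0: "\<And>x. 0 \<le> f x"
    and D: "D = density M (\<lambda>x. ennreal (f x))" "prob_space D"
  shows "(\<Pi>\<^sub>M j\<in>J. D) = density (\<Pi>\<^sub>M j\<in>J. M) (\<lambda>\<omega>. ennreal (\<Prod>j\<in>J. f (\<omega> j)))"
proof -
  interpret M: prob_space M by fact
  interpret D: prob_space D by fact
  interpret PM: product_sigma_finite "\<lambda>_. M" ..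
  interpret PD: product_sigma_finite "\<lambda>_. D" ..
  have meas: "(\<lambda>\<omega>. ennreal (\<Prod>j\<in>J. f (\<omega> j))) \<in> borel_measurable (\<Pi>\<^sub>M j\<in>J. M)"
    by measurable
  show ?thesis
  proof (rule PD.PiM_eqI[symmetric, OF J])
    show "sets (density (\<Pi>\<^sub>M j\<in>J. M) (\<lambda>\<omega>. ennreal (\<Prod>j\<in>J. f (\<omega> j)))) = sets (\<Pi>\<^sub>M j\<in>J. D)"
      by (simp add: D(1) cong: sets_PiM_cong)
    fix A assume A: "\<And>j. j \<in> J \<Longrightarrow> A j \<in> sets D"
    then have A': "\<And>j. j \<in> J \<Longrightarrow> A j \<in> sets M" by (simp add: D(1))
    have "emeasure (density (\<Pi>\<^sub>M j\<in>J. M) (\<lambda>\<omega>. ennreal (\<Prod>j\<in>J. f (\<omega> j)))) (Pi\<^sub>E J A)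
        = (\<integral>\<^sup>+\<omega>. ennreal (\<Prod>j\<in>J. f (\<omega> j)) * indicator (Pi\<^sub>E J A) \<omega> \<partial>(\<Pi>\<^sub>M j\<in>J. M))"
      by (rule emeasure_density[OF meas]) (intro sets_PiM_I_finite J A')
    also have "\<dots> = (\<integral>\<^sup>+\<omega>. (\<Prod>j\<in>J. ennreal (f (\<omega> j)) * indicator (A j) (\<omega> j)) \<partial>(\<Pi>\<^sub>M j\<in>J. M))"
    proof (rule nn_integral_cong)
      fix \<omega> assume "\<omega> \<in> space (\<Pi>\<^sub>M j\<in>J. M)"
      then have "indicator (Pi\<^sub>E J A) \<omega> = (\<Prod>j\<in>J. indicator (A j) (\<omega> j) :: ennreal)"
        using J by (auto simp: indicator_def space_PiM PiE_iff prod_zero_iff)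
      then show "ennreal (\<Prod>j\<in>J. f (\<omega> j)) * indicator (Pi\<^sub>E J A) \<omega> = (\<Prod>j\<in>J. ennreal (f (\<omega> j)) * indicator (A j) (\<omega> j))"
        using f0 by (simp add: prod.distrib prod_ennreal)
    qed
    also have "\<dots> = (\<Prod>j\<in>J. \<integral>\<^sup>+x. ennreal (f x) * indicator (A j) x \<partial>M)"
      using A' by (intro PM.product_nn_integral_prod J) auto
    also have "\<dots> = (\<Prod>j\<in>J. emeasure D (A j))"
      using A' by (intro prod.cong refl) (simp add: D(1) emeasure_density)
    finally show "emeasure (density (\<Pi>\<^sub>M j\<in>J. M) (\<lambda>\<omega>. ennreal (\<Prod>j\<in>J. f (\<omega> j)))) (Pi\<^sub>E J A) = (\<Prod>j\<in>J. emeasure D (A j))" .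
  qed
qed

lemma PiM_sum_integral:
  fixes f :: "'a \<Rightarrow> real"
  assumes J: "finite J" "J' \<subseteq> J" and D: "prob_space D" and f: "integrable D f"
  shows "integrable (\<Pi>\<^sub>M j\<in>J. D) (\<lambda>\<omega>. \<Sum>j\<in>J'. f (\<omega> j))"
    and "(\<integral>\<omega>. (\<Sum>j\<in>J'. f (\<omega> j)) \<partial>(\<Pi>\<^sub>M j\<in>J. D)) = real (card J') * (\<integral>x. f x \<partial>D)"
proof -
  have comp: "integrable (\<Pi>\<^sub>M j\<in>J. D) (\<lambda>\<omega>. f (\<omega> j))" "(\<integral>\<omega>. f (\<omega> j) \<partial>(\<Pi>\<^sub>M j\<in>J. D)) = (\<integral>x. f x \<partial>D)" if "j \<in> J'" for j
  proof -
    have j: "j \<in> J" using that J by blast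
    have d: "distr (\<Pi>\<^sub>M j\<in>J. D) D (\<lambda>\<omega>. \<omega> j) = D"
      by (rule distr_PiM_component) (use D j in auto)
    have m: "(\<lambda>\<omega>. \<omega> j) \<in> measurable (\<Pi>\<^sub>M j\<in>J. D) D"
      by (rule measurable_component_singleton[OF j])
    show "integrable (\<Pi>\<^sub>M j\<in>J. D) (\<lambda>\<omega>. f (\<omega> j))"
      by (rule integrable_distr[OF m]) (simp add: d f)
    have "(\<integral>x. f x \<partial>distr (\<Pi>\<^sub>M j\<in>J. D) D (\<lambda>\<omega>. \<omega> j)) = (\<integral>\<omega>. f (\<omega> j) \<partial>(\<Pi>\<^sub>M j\<in>J. D))"
      using f by (intro integral_distr[OF m]) auto
    then show "(\<integral>\<omega>. f (\<omega> j) \<partial>(\<Pi>\<^sub>M j\<in>J. D)) = (\<integral>x. f x \<partial>D)" by (simp add: d)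
  qed
  show "integrable (\<Pi>\<^sub>M j\<in>J. D) (\<lambda>\<omega>. \<Sum>j\<in>J'. f (\<omega> j))"
    using comp by (intro Bochner_Integration.integrable_sum)
  have "(\<integral>\<omega>. (\<Sum>j\<in>J'. f (\<omega> j)) \<partial>(\<Pi>\<^sub>M j\<in>J. D)) = (\<Sum>j\<in>J'. \<integral>\<omega>. f (\<omega> j) \<partial>(\<Pi>\<^sub>M j\<in>J. D))"
    using comp by (intro Bochner_Integration.integral_sum)
  then show "(\<integral>\<omega>. (\<Sum>j\<in>J'. f (\<omega> j)) \<partial>(\<Pi>\<^sub>M j\<in>J. D)) = real (card J') * (\<integral>x. f x \<partial>D)"
    by (simp add: comp)
qed

section \<open>The empirical field\<close>

text \<open>
  A fixed box size together with the facts on the finite-volume measure that the entropy of the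
  empirical field depends on.
\<close>

locale gibbs_field =
  fixes z :: real and R :: "'s::real_normed_vector measure" and H :: "('d::finite, 's) config \<Rightarrow> ereal"
    and PP :: "(real ^ 'd) set \<Rightarrow> ('d, 's) config measure" and n :: nat
  assumes n: "n \<ge> 1" and R: "prob_space R" "sets R = sets borel" and H: "energy_functional H"
    and PP: "\<And>\<Lambda>. \<Lambda> \<in> sets borel \<Longrightarrow> poisson_law (intensity z R \<Lambda>) (PP \<Lambda>)"
    and dens: "P_box H PP n = density (PP (box_n n)) (\<lambda>\<gamma>. ennreal (gibbs_density H PP n \<gamma>))"
    and prob: "prob_space (P_box H PP n)"
    and int: "integrable (P_box H PP n) (\<lambda>\<gamma>. ln (gibbs_density H PP n \<gamma>))"
begin

abbreviation "\<rho> \<equiv> gibbs_density H PP n"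
abbreviation "Pn \<equiv> P_box H PP n"
abbreviation "\<pi>\<^sub>n \<equiv> PP (box_n n)"
abbreviation "shifts \<equiv> box_n n \<inter> (lattice_pts :: (real^'d) set)"
abbreviation "cube k \<equiv> (lattice_cube (- int k) (int k + 1) :: (real^'d) set)"

text \<open>
  The relative entropy of the finite-volume measure with respect to the Poisson law of its box.
\<close>

definition "ent = (\<integral>\<gamma>. ln (\<rho> \<gamma>) \<partial>Pn)"

text \<open>
  What the window \<open>box_n N\<close> shows of a tiling shifted by \<open>\<kappa>\<close>, as a function of the finitely many
  tiles with indices in \<open>cube k\<close>. Both the empirical field and the Poisson process arise in the window
  as images under this map, from tiles with law \<open>Pn\<close> and \<open>\<pi>\<^sub>n\<close> respectively.
\<close>

definition view :: "nat \<Rightarrow> nat \<Rightarrow> real^'d \<Rightarrow> (real^'d \<Rightarrow> ('d, 's) config) \<Rightarrow> ('d, 's) config" where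
  "view N k \<kappa> \<omega> = restr (box_n N) (shift \<kappa> (glue_on (cube k) n \<omega>))"

lemma sets_PP: "\<Lambda> \<in> sets borel \<Longrightarrow> sets (PP \<Lambda>) = sets config_space"
  and prob_PP: "\<Lambda> \<in> sets borel \<Longrightarrow> prob_space (PP \<Lambda>)"
  using PP[of \<Lambda>] by (simp_all add: poisson_law_def)

lemma sets_Pn: "sets Pn = sets config_space"
  by (simp add: dens sets_PP[OF box_n_borel])

lemma shifts: "finite shifts" "shifts \<noteq> {}" "card shifts = (2 * n) ^ CARD('d)"
proof -
  have "nat (int n - - int n) = 2 * n" by simp
  then show "card shifts = (2 * n) ^ CARD('d)"
    unfolding box_n_lattice card_lattice_cube by (rule arg_cong)
  show "finite shifts"
    unfolding box_n_lattice by (rule finite_lattice_cube)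
  have "0 \<in> shifts" using zero_in_box_n[OF n] by (simp add: lattice_pts_def)
  then show "shifts \<noteq> {}" by blast
qed

lemma cube: "finite (cube k)" "cube k \<subseteq> lattice_pts" "card (cube k) = (2 * k + 1) ^ CARD('d)" "cube k \<noteq> {}"
proof -
  show "finite (cube k)" "cube k \<subseteq> lattice_pts"
    by (rule finite_lattice_cube, rule lattice_cube_subset)
  have "nat (int k + 1 - - int k) = 2 * k + 1" by simp
  then show "card (cube k) = (2 * k + 1) ^ CARD('d)"
    unfolding card_lattice_cube by (rule arg_cong)
  have "0 \<in> cube k" by (simp add: lattice_cube_def lattice_pts_def)
  then show "cube k \<noteq> {}" by blast
qed

lemma measurable_view:
  assumes "sets M = sets config_space"
  shows "view N k \<kappa> \<in> measurable (\<Pi>\<^sub>M \<eta>\<in>cube k. M) config_space"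
proof -
  have "sets (\<Pi>\<^sub>M \<eta>\<in>cube k. M) = sets (\<Pi>\<^sub>M \<eta>\<in>cube k. config_space)"
    using assms by (intro sets_PiM_cong) auto
  note cong = measurable_cong_sets[OF this refl]
  show ?thesis
    unfolding cong view_def[abs_def]
    by (intro measurable_compose[OF measurable_compose[OF measurable_glue_on[OF cube(1) order_refl cube(2)] measurable_shift] measurable_restr] box_n_borel)
qed

lemma blocks_law:
  assumes J: "finite J" "J \<noteq> {}" "J \<subseteq> lattice_pts"
  shows "distr (PP UNIV) (\<Pi>\<^sub>M \<eta>\<in>J. config_space) (\<lambda>\<gamma>. \<lambda>\<eta>\<in>J. restr (box_n n) (shift (- ((2 * real n) *\<^sub>R \<eta> + \<kappa>)) \<gamma>)) = (\<Pi>\<^sub>M \<eta>\<in>J. \<pi>\<^sub>n)"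
proof (rule poisson_law_blocks[OF _ R box_n_borel _ J(1,2)])
  show "disjoint_family_on (\<lambda>\<eta>. {x. x + - ((2 * real n) *\<^sub>R \<eta> + \<kappa>) \<in> box_n n}) J"
    unfolding block_def[symmetric] by (rule disjoint_family_on_mono[OF J(3) block_disjoint])
qed (use PP box_n_borel in auto)

lemma measurable_blocks:
  assumes "sets M = sets config_space"
  shows "(\<lambda>\<gamma>. \<lambda>\<eta>\<in>J. restr (box_n n) (shift (- ((2 * real n) *\<^sub>R \<eta> + \<kappa>)) \<gamma>)) \<in> measurable M (\<Pi>\<^sub>M \<eta>\<in>J. config_space)"
  unfolding measurable_cong_sets[OF assms refl]
  by (intro measurable_restrict measurable_block box_n_borel)

lemma poisson_view:
  assumes N: "N \<le> 2 * n * k" and \<kappa>: "\<kappa> \<in> box_n n"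
  shows "distr (\<Pi>\<^sub>M \<eta>\<in>cube k. \<pi>\<^sub>n) config_space (view N k \<kappa>) = distr (PP UNIV) config_space (restr (box_n N))"
proof -
  have "distr (\<Pi>\<^sub>M \<eta>\<in>cube k. \<pi>\<^sub>n) config_space (view N k \<kappa>)
      = distr (distr (PP UNIV) (\<Pi>\<^sub>M \<eta>\<in>cube k. config_space) (\<lambda>\<gamma>. \<lambda>\<eta>\<in>cube k. restr (box_n n) (shift (- ((2 * real n) *\<^sub>R \<eta> + \<kappa>)) \<gamma>)))
         config_space (view N k \<kappa>)"
    by (simp only: blocks_law[OF cube(1,4,2)])
  also have "\<dots> = distr (PP UNIV) config_space (restr (box_n N))"
  proof (subst distr_distr[OF measurable_view measurable_blocks])
    have "view N k \<kappa> \<circ> (\<lambda>\<gamma>. \<lambda>\<eta>\<in>cube k. restr (box_n n) (shift (- ((2 * real n) *\<^sub>R \<eta> + \<kappa>)) \<gamma>)) = restr (box_n N)"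
      by (rule ext) (simp only: comp_def view_def restr_reglue[OF blocks_cover[OF n N \<kappa>]])
    then show "distr (PP UNIV) config_space (view N k \<kappa> \<circ> (\<lambda>\<gamma>. \<lambda>\<eta>\<in>cube k. restr (box_n n) (shift (- ((2 * real n) *\<^sub>R \<eta> + \<kappa>)) \<gamma>)))
       = distr (PP UNIV) config_space (restr (box_n N))"
      by (simp only:)
  qed (simp_all add: sets_PP)
  finally show ?thesis .
qed

lemma prob_P_tilde: "prob_space (P_tilde H PP n)" and sets_P_tilde: "sets (P_tilde H PP n) = sets config_space"
  and measurable_glue': "glue n \<in> measurable (\<Pi>\<^sub>M \<eta>\<in>lattice_pts. Pn) config_space"
proof -
  have "sets (\<Pi>\<^sub>M \<eta>\<in>lattice_pts. Pn) = sets (\<Pi>\<^sub>M \<eta>\<in>lattice_pts. config_space :: ('d, 's) config measure)"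
    using sets_Pn by (intro sets_PiM_cong) auto
  from measurable_cong_sets[OF this refl] show g: "glue n \<in> measurable (\<Pi>\<^sub>M \<eta>\<in>lattice_pts. Pn) config_space"
    using measurable_glue[OF n] by blast
  show "prob_space (P_tilde H PP n)"
    unfolding P_tilde_def by (rule prob_space.prob_space_distr[OF prob_space_PiM[OF prob] g])
  show "sets (P_tilde H PP n) = sets config_space"
    by (simp add: P_tilde_def)
qed

lemma P_tilde_view:
  assumes N: "N \<le> 2 * n * k" and \<kappa>: "\<kappa> \<in> box_n n"
  shows "distr (P_tilde H PP n) config_space (\<lambda>\<gamma>. restr (box_n N) (shift \<kappa> \<gamma>)) = distr (\<Pi>\<^sub>M \<eta>\<in>cube k. Pn) config_space (view N k \<kappa>)"
proof -
  interpret Pn: prob_space Pn by (rule prob)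
  interpret PP: product_prob_space "\<lambda>_. Pn" "lattice_pts :: (real^'d) set" ..
  have m: "(\<lambda>\<gamma>. restr (box_n N) (shift \<kappa> \<gamma>)) \<in> measurable config_space config_space"
    by (rule measurable_block[OF box_n_borel])
  have "distr (P_tilde H PP n) config_space (\<lambda>\<gamma>. restr (box_n N) (shift \<kappa> \<gamma>))
      = distr (\<Pi>\<^sub>M \<eta>\<in>lattice_pts. Pn) config_space (\<lambda>\<omega>. restr (box_n N) (shift \<kappa> (glue n \<omega>)))"
    unfolding P_tilde_def by (subst distr_distr[OF m measurable_glue']) (simp add: comp_def)
  also have "(\<lambda>\<omega>. restr (box_n N) (shift \<kappa> (glue n \<omega>))) = view N k \<kappa> \<circ> (\<lambda>\<omega>. restrict \<omega> (cube k))"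
  proof
    fix \<omega> :: "real^'d \<Rightarrow> ('d, 's) config"
    have "glue_on (cube k) n (restrict \<omega> (cube k)) = glue_on (cube k) n \<omega>"
      unfolding glue_on_def by (intro SUP_cong refl) simp
    then show "restr (box_n N) (shift \<kappa> (glue n \<omega>)) = (view N k \<kappa> \<circ> (\<lambda>\<omega>. restrict \<omega> (cube k))) \<omega>"
      unfolding glue_eq_glue_on view_def comp_def
      using restr_glue_cover[OF cube(2) order_refl blocks_cover[OF n N \<kappa>], of \<omega>] by simp
  qed
  also have "distr (\<Pi>\<^sub>M \<eta>\<in>lattice_pts. Pn) config_space (view N k \<kappa> \<circ> (\<lambda>\<omega>. restrict \<omega> (cube k)))
      = distr (distr (\<Pi>\<^sub>M \<eta>\<in>lattice_pts. Pn) (\<Pi>\<^sub>M \<eta>\<in>cube k. Pn) (\<lambda>\<omega>. restrict \<omega> (cube k))) config_space (view N k \<kappa>)"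
    by (rule distr_distr[symmetric, OF measurable_view[OF sets_Pn] measurable_restrict_subset[OF cube(2)]])
  also have "distr (\<Pi>\<^sub>M \<eta>\<in>lattice_pts. Pn) (\<Pi>\<^sub>M \<eta>\<in>cube k. Pn) (\<lambda>\<omega>. restrict \<omega> (cube k)) = (\<Pi>\<^sub>M \<eta>\<in>cube k. Pn)"
    by (rule PP.distr_PiM_restrict_finite[OF cube(1,2)])
  finally show ?thesis .
qed

text \<open>
  \<open>P_bar\<close> is given by a set function, which determines a measure only if it is countably additive.
  Here it agrees with the law of a tiling under a uniformly chosen shift, which is a measure.
\<close>

lemma P_bar_mixture:
  "P_bar H PP n = distr (uniform_count_measure shifts \<Otimes>\<^sub>M P_tilde H PP n) config_space (\<lambda>(\<kappa>, \<gamma>). shift \<kappa> \<gamma>)" (is "_ = ?M")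
proof -
  have m: "shift \<kappa> \<in> measurable (P_tilde H PP n) config_space" for \<kappa>
    unfolding measurable_cong_sets[OF sets_P_tilde refl] by (rule measurable_shift)
  have "P_bar H PP n = measure_of (space config_space) (sets config_space) (emeasure ?M)"
    unfolding P_bar_def
  proof (rule measure_of_eq[OF sets.space_closed])
    fix B :: "('d, 's) config set" assume "B \<in> sigma_sets (space config_space) (sets config_space)"
    then have "B \<in> sets config_space" by (simp only: sets.sigma_sets_eq)
    from emeasure_uniform_mixture[OF shifts(1,2) prob_P_tilde m this]
    show "(\<Sum>\<kappa>\<in>box_n n \<inter> lattice_pts. emeasure (distr (P_tilde H PP n) config_space (shift \<kappa>)) B) / ennreal ((2 * real n) ^ CARD('d)) = emeasure ?M B"
      by (simp add: shifts(3) ennreal_of_nat_eq_real_of_nat)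
  qed
  also have "\<dots> = ?M"
    using measure_of_of_measure[of ?M] by simp
  finally show ?thesis .
qed

lemma P_bar_view:
  assumes N: "N \<le> 2 * n * k"
  shows "distr (P_bar H PP n) config_space (restr (box_n N)) =
    distr (uniform_count_measure shifts \<Otimes>\<^sub>M (\<Pi>\<^sub>M \<eta>\<in>cube k. Pn)) config_space (\<lambda>(\<kappa>, \<omega>). view N k \<kappa> \<omega>)"
proof (rule measure_eqI)
  fix B assume "B \<in> sets (distr (P_bar H PP n) config_space (restr (box_n N)))"
  then have B: "B \<in> sets config_space" by simp
  have m: "shift \<kappa> \<in> measurable (P_tilde H PP n) config_space" for \<kappa>
    unfolding measurable_cong_sets[OF sets_P_tilde refl] by (rule measurable_shift)
  have m': "(\<lambda>\<gamma>. restr (box_n N) (shift \<kappa> \<gamma>)) \<in> measurable (P_tilde H PP n) config_space" for \<kappa>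
    unfolding measurable_cong_sets[OF sets_P_tilde refl] by (rule measurable_block[OF box_n_borel])
  have "distr (P_bar H PP n) config_space (restr (box_n N)) =
      distr (uniform_count_measure shifts \<Otimes>\<^sub>M P_tilde H PP n) config_space (\<lambda>(\<kappa>, \<gamma>). restr (box_n N) (shift \<kappa> \<gamma>))"
    unfolding P_bar_mixture
    by (subst distr_distr[OF measurable_restr[OF box_n_borel] measurable_uniform_mixture[OF shifts(1,2) prob_P_tilde m]])
       (simp add: comp_def case_prod_unfold)
  then have "emeasure (distr (P_bar H PP n) config_space (restr (box_n N))) B
      = (\<Sum>\<kappa>\<in>shifts. emeasure (distr (P_tilde H PP n) config_space (\<lambda>\<gamma>. restr (box_n N) (shift \<kappa> \<gamma>))) B) / of_nat (card shifts)"
    using emeasure_uniform_mixture[OF shifts(1,2) prob_P_tilde m' B] by simp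
  also have "\<dots> = (\<Sum>\<kappa>\<in>shifts. emeasure (distr (\<Pi>\<^sub>M \<eta>\<in>cube k. Pn) config_space (view N k \<kappa>)) B) / of_nat (card shifts)"
    using P_tilde_view[OF N] by (intro arg_cong2[where f="(/)"] sum.cong refl) auto
  also have "\<dots> = emeasure (distr (uniform_count_measure shifts \<Otimes>\<^sub>M (\<Pi>\<^sub>M \<eta>\<in>cube k. Pn)) config_space (\<lambda>(\<kappa>, \<omega>). view N k \<kappa> \<omega>)) B"
    by (rule emeasure_uniform_mixture[symmetric, OF shifts(1,2) prob_space_PiM[OF prob] measurable_view[OF sets_Pn] B])
  finally show "emeasure (distr (P_bar H PP n) config_space (restr (box_n N))) B =
    emeasure (distr (uniform_count_measure shifts \<Otimes>\<^sub>M (\<Pi>\<^sub>M \<eta>\<in>cube k. Pn)) config_space (\<lambda>(\<kappa>, \<omega>). view N k \<kappa> \<omega>)) B" .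
qed simp

text \<open>
  In the window, the empirical field and the Poisson process are images, under the same map, of
  product measures over a random shift and the tiles in \<open>cube k\<close>. The density between these products
  has entropy \<open>ent\<close> per tile, which gives the upper bound.

  For the lower bound the competitor \<open>g\<close> is the average over the shifts \<open>\<kappa>\<close> of the product densities
  of the tiles indexed by \<open>cube k'\<close>. These tiles lie inside the window for every shift, so \<open>g\<close> can be
  evaluated on what the window shows. Keeping only the summand of the true shift costs the factor
  \<open>(2 n)\<^sup>d\<close>, that is, its logarithm in the entropy.
\<close>

lemma local_entropy_bounds:
  assumes N: "N \<le> 2 * n * k" and k': "2 * n * k' + 2 * n \<le> N"
  shows "\<exists>e. local_entropy (box_n N) (P_bar H PP n) (PP UNIV) = ereal e \<and>
    real ((2 * k' + 1) ^ CARD('d)) * ent - ln (real ((2 * n) ^ CARD('d))) \<le> e \<and>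
    e \<le> real ((2 * k + 1) ^ CARD('d)) * ent"
proof -
  define U where "U = uniform_count_measure shifts"
  define X0 where "X0 = U \<Otimes>\<^sub>M (\<Pi>\<^sub>M \<eta>\<in>cube k. \<pi>\<^sub>n)"
  define X where "X = U \<Otimes>\<^sub>M (\<Pi>\<^sub>M \<eta>\<in>cube k. Pn)"
  define r where "r = (\<lambda>(\<kappa> :: real^'d, \<omega>). \<Prod>\<eta>\<in>cube k. \<rho> (\<omega> \<eta>))"
  define T where "T = (\<lambda>(\<kappa>, \<omega>). view N k \<kappa> \<omega>)"
  interpret U: prob_space U
    unfolding U_def using shifts by (intro prob_space_uniform_count_measure) auto
  interpret Pn: prob_space Pn by (rule prob)
  interpret pin: prob_space \<pi>\<^sub>n by (rule prob_PP[OF box_n_borel])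
  interpret Pcube: prob_space "\<Pi>\<^sub>M \<eta>\<in>cube k. Pn" by (rule prob_space_PiM) (rule prob)
  interpret picube: prob_space "\<Pi>\<^sub>M \<eta>\<in>cube k. \<pi>\<^sub>n" by (rule prob_space_PiM) (rule pin.prob_space_axioms)
  interpret X: pair_prob_space U "\<Pi>\<^sub>M \<eta>\<in>cube k. Pn" ..
  interpret X0: pair_prob_space U "\<Pi>\<^sub>M \<eta>\<in>cube k. \<pi>\<^sub>n" ..
  have \<rho>m[measurable]: "\<rho> \<in> borel_measurable \<pi>\<^sub>n"
    unfolding measurable_cong_sets[OF sets_PP[OF box_n_borel] refl] by (rule gibbs_density_measurable[OF H])
  have \<rho>0: "0 \<le> \<rho> \<gamma>" for \<gamma> by (rule gibbs_density_nonneg)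
  have prodm: "(\<lambda>\<omega>. \<Prod>\<eta>\<in>cube k. \<rho> (\<omega> \<eta>)) \<in> borel_measurable (\<Pi>\<^sub>M \<eta>\<in>cube k. \<pi>\<^sub>n)"
    by measurable
  have rm: "r \<in> borel_measurable X0"
    unfolding r_def X0_def case_prod_unfold by (rule measurable_compose[OF measurable_snd prodm])
  have r0: "0 \<le> r x" for x
    by (auto simp: r_def case_prod_unfold intro!: prod_nonneg \<rho>0)
  have Xdens: "X = density X0 (\<lambda>x. ennreal (r x))"
  proof -
    have "(\<Pi>\<^sub>M \<eta>\<in>cube k. Pn) = density (\<Pi>\<^sub>M \<eta>\<in>cube k. \<pi>\<^sub>n) (\<lambda>\<omega>. ennreal (\<Prod>\<eta>\<in>cube k. \<rho> (\<omega> \<eta>)))"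
      by (rule PiM_density[OF cube(1) pin.prob_space_axioms \<rho>m \<rho>0 dens prob])
    moreover have "density U (\<lambda>_. 1) \<Otimes>\<^sub>M density (\<Pi>\<^sub>M \<eta>\<in>cube k. \<pi>\<^sub>n) (\<lambda>\<omega>. ennreal (\<Prod>\<eta>\<in>cube k. \<rho> (\<omega> \<eta>)))
       = density X0 (\<lambda>(\<kappa>, \<omega>). 1 * ennreal (\<Prod>\<eta>\<in>cube k. \<rho> (\<omega> \<eta>)))"
      unfolding X0_def
      by (rule pair_measure_density)
         (use prodm calculation Pcube.sigma_finite_measure_axioms in \<open>auto intro: picube.sigma_finite_measure_axioms\<close>)
    ultimately show ?thesis
      by (simp add: X_def density_1 r_def case_prod_unfold)
  qed
  have "distr X (\<Pi>\<^sub>M \<eta>\<in>cube k. Pn) snd = (\<Pi>\<^sub>M \<eta>\<in>cube k. Pn)"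
    using uniform_mixture_const[OF shifts(1,2) Pcube.prob_space_axioms, of "\<lambda>_ \<omega>. \<omega>" "\<Pi>\<^sub>M \<eta>\<in>cube k. Pn" "\<Pi>\<^sub>M \<eta>\<in>cube k. Pn"]
    by (simp add: X_def U_def case_prod_unfold distr_id2)
  note snd_law = this
  have sndm: "snd \<in> measurable X (\<Pi>\<^sub>M \<eta>\<in>cube k. Pn)"
    unfolding X_def by (rule measurable_snd)
  have sums: "integrable X (\<lambda>x. \<Sum>\<eta>\<in>J. ln (\<rho> (snd x \<eta>)))"
      "(\<integral>x. (\<Sum>\<eta>\<in>J. ln (\<rho> (snd x \<eta>))) \<partial>X) = real (card J) * ent" if "J \<subseteq> cube k" for J
  proof -
    note PS = PiM_sum_integral[OF cube(1) that prob int]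
    show "integrable X (\<lambda>x. \<Sum>\<eta>\<in>J. ln (\<rho> (snd x \<eta>)))"
      by (rule integrable_distr[OF sndm]) (simp add: snd_law PS)
    have "(\<integral>\<omega>. (\<Sum>\<eta>\<in>J. ln (\<rho> (\<omega> \<eta>))) \<partial>distr X (\<Pi>\<^sub>M \<eta>\<in>cube k. Pn) snd) = (\<integral>x. (\<Sum>\<eta>\<in>J. ln (\<rho> (snd x \<eta>))) \<partial>X)"
      using PS(1) by (intro integral_distr[OF sndm]) auto
    then show "(\<integral>x. (\<Sum>\<eta>\<in>J. ln (\<rho> (snd x \<eta>))) \<partial>X) = real (card J) * ent"
      by (simp add: snd_law PS ent_def)
  qed
  have "AE \<gamma> in Pn. 0 < \<rho> \<gamma>"
    unfolding dens using \<rho>0 by (subst AE_density) (auto simp: less_le)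
  then have pos_prod: "AE \<omega> in (\<Pi>\<^sub>M \<eta>\<in>cube k. Pn). \<forall>\<eta>\<in>cube k. 0 < \<rho> (\<omega> \<eta>)"
    using prob by (intro AE_finite_allI cube(1) AE_PiM_component) auto
  have pos: "AE x in X. \<forall>\<eta>\<in>cube k. 0 < \<rho> (snd x \<eta>)"
    by (rule AE_distrD[OF sndm, of "\<lambda>\<omega>. \<forall>\<eta>\<in>cube k. 0 < \<rho> (\<omega> \<eta>)"]) (unfold snd_law, rule pos_prod)
  from pos have lnr: "AE x in X. ln (r x) = (\<Sum>\<eta>\<in>cube k. ln (\<rho> (snd x \<eta>)))"
    by eventually_elim (auto simp: r_def case_prod_unfold cube(1) intro!: ln_prod)
  have rmX: "(\<lambda>x. ln (r x)) \<in> borel_measurable X"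
    using rm by (simp add: Xdens)
  have lnr_int: "integrable X (\<lambda>x. ln (r x))"
    using sums(1)[OF order_refl] lnr rmX by (subst integrable_cong_AE) auto
  have lnr_val: "(\<integral>x. ln (r x) \<partial>X) = real (card (cube k)) * ent"
    using sums[OF order_refl] lnr rmX by (subst integral_cong_AE[OF _ _ lnr]) auto
  have Tm: "T \<in> measurable X0 config_space"
    unfolding T_def X0_def U_def
    by (rule measurable_uniform_mixture[OF shifts(1,2) picube.prob_space_axioms measurable_view[OF sets_PP[OF box_n_borel]]])
  interpret E: image_entropy X0 X r T config_space
    by (rule image_entropy.intro[OF X0.prob_space_axioms[folded X0_def] X.prob_space_axioms[folded X_def] rm r0 Xdens lnr_int Tm])
  have Q: "distr (P_bar H PP n) config_space (restr (box_n N)) = E.Q"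
    unfolding T_def X_def U_def by (rule P_bar_view[OF N])
  have Q0: "distr (PP UNIV) config_space (restr (box_n N)) = E.Q0"
    unfolding T_def X0_def U_def
    by (rule uniform_mixture_const[symmetric, OF shifts(1,2) picube.prob_space_axioms measurable_view[OF sets_PP[OF box_n_borel]]])
       (use poisson_view[OF N] in auto)
  define e where "e = (\<integral>\<gamma>. ln (E.h \<gamma>) \<partial>E.Q)"
  have "local_entropy (box_n N) (P_bar H PP n) (PP UNIV) = ereal e"
    unfolding local_entropy_def Q Q0 rel_entropy_def KL_divergence_def E.entropy_density_h e_def
    using E.image_ac E.integrable_ln_h by simp
  moreover have "e \<le> real ((2 * k + 1) ^ CARD('d)) * ent"
    using E.ln_h_le unfolding e_def lnr_val cube(3) .
  moreover have "real ((2 * k' + 1) ^ CARD('d)) * ent - ln (real ((2 * n) ^ CARD('d))) \<le> e"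
  proof -
    define K where "K = real (card shifts)"
    have K: "0 < K" using n by (simp add: K_def shifts(3))
    have "2 * n * k' \<le> 2 * n * k" using N k' by linarith
    then have kk: "k' \<le> k" using n by simp
    have sub: "cube k' \<subseteq> cube k"
    proof
      fix x assume "x \<in> cube k'"
      then have x: "x \<in> lattice_pts" "\<And>i. - real k' \<le> x $ i \<and> x $ i < real k' + 1"
        by (simp_all add: lattice_cube_def)
      have "real k' \<le> real k" using kk by simp
      then have "- real k \<le> x $ i \<and> x $ i < real k + 1" for i
        using x(2)[of i] by (intro conjI; linarith)
      with x(1) show "x \<in> cube k" by (simp add: lattice_cube_def)
    qed
    define b where "b \<kappa> \<eta> \<gamma> = restr (box_n n) (shift (- ((2 * real n) *\<^sub>R \<eta> + \<kappa>)) \<gamma>)" for \<kappa> \<eta> :: "real^'d" and \<gamma> :: "('d, 's) config"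
    define G where "G \<kappa> \<gamma> = (\<Prod>\<eta>\<in>cube k'. \<rho> (b \<kappa> \<eta> \<gamma>))" for \<kappa> \<gamma>
    define g where "g \<gamma> = (\<Sum>\<kappa>\<in>shifts. G \<kappa> \<gamma>) / K" for \<gamma>
    have G0: "0 \<le> G \<kappa> \<gamma>" for \<kappa> \<gamma> unfolding G_def by (intro prod_nonneg ballI \<rho>0)
    have bm: "b \<kappa> \<eta> \<in> measurable config_space config_space" for \<kappa> \<eta>
      unfolding b_def[abs_def] by (rule measurable_block[OF box_n_borel])
    have Gm[measurable]: "G \<kappa> \<in> borel_measurable config_space" for \<kappa>
      unfolding G_def[abs_def]
      by (intro borel_measurable_prod measurable_compose[OF bm gibbs_density_measurable[OF H]])
    have gm: "g \<in> borel_measurable config_space"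
      unfolding g_def[abs_def] by measurable
    have g0: "0 \<le> g \<gamma>" for \<gamma>
      unfolding g_def using K G0 by (intro divide_nonneg_pos sum_nonneg) auto
    have b_inside: "b \<kappa> \<eta> (restr (box_n N) \<gamma>) = b \<kappa> \<eta> \<gamma>" if "\<kappa> \<in> box_n n" "\<eta> \<in> cube k'" for \<kappa> \<eta> \<gamma>
    proof -
      have "block n \<kappa> \<eta> \<inter> box_n N = block n \<kappa> \<eta>"
        using block_inside[OF k' that] by blast
      then show ?thesis unfolding b_def restr_box_n_shift restr_restr by simp
    qed
    have G_inside: "G \<kappa> (restr (box_n N) \<gamma>) = G \<kappa> \<gamma>" if "\<kappa> \<in> shifts" for \<kappa> \<gamma>
      unfolding G_def using that b_inside by (intro prod.cong refl) auto
    \<comment> \<open>Under the Poisson law the tiles are independent, and each density integrates to one.\<close>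
    have intG: "(\<integral>\<^sup>+\<gamma>. ennreal (G \<kappa> \<gamma>) \<partial>PP UNIV) = 1" for \<kappa>
    proof -
      interpret PM: product_sigma_finite "\<lambda>_. \<pi>\<^sub>n" ..
      have pm: "(\<lambda>\<omega>. \<Prod>\<eta>\<in>cube k'. ennreal (\<rho> (\<omega> \<eta>))) \<in> borel_measurable (\<Pi>\<^sub>M \<eta>\<in>cube k'. config_space)"
      proof -
        have [measurable]: "\<rho> \<in> borel_measurable config_space"
          by (rule gibbs_density_measurable[OF H])
        show ?thesis by measurable
      qed
      have "(\<integral>\<^sup>+\<gamma>. ennreal (G \<kappa> \<gamma>) \<partial>PP UNIV) = (\<integral>\<^sup>+\<gamma>. (\<Prod>\<eta>\<in>cube k'. ennreal (\<rho> ((\<lambda>\<eta>\<in>cube k'. b \<kappa> \<eta> \<gamma>) \<eta>))) \<partial>PP UNIV)"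
        by (intro nn_integral_cong) (simp add: G_def prod_ennreal \<rho>0)
      also have "\<dots> = (\<integral>\<^sup>+\<omega>. (\<Prod>\<eta>\<in>cube k'. ennreal (\<rho> (\<omega> \<eta>))) \<partial>distr (PP UNIV) (\<Pi>\<^sub>M \<eta>\<in>cube k'. config_space) (\<lambda>\<gamma>. \<lambda>\<eta>\<in>cube k'. b \<kappa> \<eta> \<gamma>))"
        unfolding b_def by (rule nn_integral_distr[symmetric, OF measurable_blocks]) (use pm in \<open>simp_all add: sets_PP\<close>)
      also have "\<dots> = (\<integral>\<^sup>+\<omega>. (\<Prod>\<eta>\<in>cube k'. ennreal (\<rho> (\<omega> \<eta>))) \<partial>(\<Pi>\<^sub>M \<eta>\<in>cube k'. \<pi>\<^sub>n))"
        unfolding b_def blocks_law[OF cube(1,4,2)] ..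
      also have "\<dots> = (\<Prod>\<eta>\<in>cube k'. \<integral>\<^sup>+\<gamma>. ennreal (\<rho> \<gamma>) \<partial>\<pi>\<^sub>n)"
        by (intro PM.product_nn_integral_prod cube(1)) measurable
      also have "(\<integral>\<^sup>+\<gamma>. ennreal (\<rho> \<gamma>) \<partial>\<pi>\<^sub>n) = emeasure Pn (space Pn)"
        unfolding dens by (subst emeasure_density) (auto intro!: nn_integral_cong)
      finally show ?thesis by (simp add: Pn.emeasure_space_1)
    qed
    have g1: "(\<integral>\<^sup>+\<gamma>. ennreal (g \<gamma>) \<partial>E.Q0) \<le> 1"
    proof -
      have setsU: "sets (PP UNIV) = sets config_space"
        by (rule sets_PP) simp
      have resm: "restr (box_n N) \<in> measurable (PP UNIV) config_space"
        unfolding measurable_cong_sets[OF setsU refl] by (rule measurable_restr[OF box_n_borel])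
      have [measurable]: "G \<kappa> \<in> borel_measurable (PP UNIV)" for \<kappa>
        unfolding measurable_cong_sets[OF setsU refl] by (rule Gm)
      have "(\<integral>\<^sup>+\<gamma>. ennreal (g \<gamma>) \<partial>E.Q0) = (\<integral>\<^sup>+\<gamma>. ennreal (g (restr (box_n N) \<gamma>)) \<partial>PP UNIV)"
        unfolding Q0[symmetric] using gm by (intro nn_integral_distr resm) auto
      also have "\<dots> = (\<integral>\<^sup>+\<gamma>. ennreal (1 / K) * (\<Sum>\<kappa>\<in>shifts. ennreal (G \<kappa> \<gamma>)) \<partial>PP UNIV)"
      proof (rule nn_integral_cong)
        fix \<gamma>
        have eq: "g (restr (box_n N) \<gamma>) = 1 / K * (\<Sum>\<kappa>\<in>shifts. G \<kappa> \<gamma>)"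
          by (simp add: g_def G_inside)
        have "0 \<le> (\<Sum>\<kappa>\<in>shifts. G \<kappa> \<gamma>)" "0 \<le> 1 / K"
          using K G0 by (auto intro: sum_nonneg)
        then show "ennreal (g (restr (box_n N) \<gamma>)) = ennreal (1 / K) * (\<Sum>\<kappa>\<in>shifts. ennreal (G \<kappa> \<gamma>))"
          unfolding eq by (simp only: ennreal_mult sum_ennreal[OF G0])
      qed
      also have "\<dots> = ennreal (1 / K) * (\<Sum>\<kappa>\<in>shifts. \<integral>\<^sup>+\<gamma>. ennreal (G \<kappa> \<gamma>) \<partial>PP UNIV)"
        by (subst nn_integral_cmult, measurable, subst nn_integral_sum) auto
      also have "\<dots> = ennreal (1 / K) * ennreal K"
        by (simp add: intG K_def ennreal_of_nat_eq_real_of_nat)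
      also have "\<dots> = 1"
        using K by (simp add: ennreal_mult[symmetric])
      finally show ?thesis by simp
    qed
    have "AE x in X. 0 < g (T x) \<and> (\<Sum>\<eta>\<in>cube k'. ln (\<rho> (snd x \<eta>))) - ln K \<le> ln (g (T x))"
      using pos AE_space
    proof eventually_elim
      case (elim x)
      obtain \<kappa> \<omega> where x: "x = (\<kappa>, \<omega>)" by (cases x)
      have \<kappa>: "\<kappa> \<in> shifts"
        using elim(2) by (simp add: x X_def U_def space_pair_measure space_uniform_count_measure)
      have "\<rho> (b \<kappa> \<eta> (T x)) = \<rho> (\<omega> \<eta>)" if "\<eta> \<in> cube k'" for \<eta>
      proof -
        have "b \<kappa> \<eta> (T x) = b \<kappa> \<eta> (shift \<kappa> (glue_on (cube k) n \<omega>))"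
          unfolding x T_def prod.case view_def using \<kappa> that by (intro b_inside) auto
        also have "\<dots> = restr (box_n n) (\<omega> \<eta>)"
          unfolding b_def using that sub by (intro glue_on_block cube(2)) auto
        finally show ?thesis by (simp add: gibbs_density_restr)
      qed
      then have G: "G \<kappa> (T x) = (\<Prod>\<eta>\<in>cube k'. \<rho> (\<omega> \<eta>))"
        unfolding G_def by (intro prod.cong refl)
      have pos': "\<And>\<eta>. \<eta> \<in> cube k' \<Longrightarrow> 0 < \<rho> (\<omega> \<eta>)"
        using elim(1) sub by (auto simp: x)
      then have "0 < G \<kappa> (T x)"
        unfolding G by (intro prod_pos) auto
      moreover have "G \<kappa> (T x) / K \<le> g (T x)"
        unfolding g_def using K \<kappa> shifts(1) G0 by (intro divide_right_mono member_le_sum) auto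
      moreover have "ln (G \<kappa> (T x) / K) = (\<Sum>\<eta>\<in>cube k'. ln (\<rho> (\<omega> \<eta>))) - ln K"
      proof -
        have "ln (G \<kappa> (T x)) = (\<Sum>\<eta>\<in>cube k'. ln (\<rho> (\<omega> \<eta>)))"
          unfolding G by (intro ln_prod cube(1)) (use pos' in force)
        then show ?thesis using \<open>0 < G \<kappa> (T x)\<close> K by (simp add: ln_div)
      qed
      moreover have "0 < G \<kappa> (T x) / K" using \<open>0 < G \<kappa> (T x)\<close> K by simp
      ultimately have "0 < g (T x)" "ln (G \<kappa> (T x) / K) \<le> ln (g (T x))"
        by (linarith, intro ln_mono) auto
      then show ?case
        using \<open>ln (G \<kappa> (T x) / K) = _\<close> by (simp add: x)
    qed
    note lower = this
    interpret X: prob_space X by (rule E.X)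
    have "integrable X (\<lambda>x. (\<Sum>\<eta>\<in>cube k'. ln (\<rho> (snd x \<eta>))) - ln K)"
      using sums(1)[OF sub] by simp
    from E.le_ln_h[OF gm g0 g1 this lower]
    have "(\<integral>x. (\<Sum>\<eta>\<in>cube k'. ln (\<rho> (snd x \<eta>))) - ln K \<partial>X) \<le> e"
      unfolding e_def .
    moreover have "(\<integral>x. (\<Sum>\<eta>\<in>cube k'. ln (\<rho> (snd x \<eta>))) - ln K \<partial>X) = real (card (cube k')) * ent - ln K"
      using sums[OF sub] by (simp add: X.prob_space)
    ultimately show ?thesis
      unfolding K_def shifts(3) cube(3) by simp
  qed
  ultimately show ?thesis by blast
qed

text \<open>
  With \<open>q = N div (2 n)\<close>, a window of half side \<open>N\<close> is covered by \<open>2 q + 3\<close> tiles and contains \<open>2 q - 1\<close>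
  tiles in each direction. Both numbers are \<open>N / n\<close> up to an additive constant, so the two bounds on
  the entropy of the window have the same limit per volume. This proves convergence at the same
  time, without which the specific entropy would be an arbitrary value.
\<close>

lemma specific_entropy_eq:
  assumes ent0: "0 \<le> ent"
  shows "specific_entropy (P_bar H PP n) (PP UNIV) = ereal (ent / (2 * real n) ^ CARD('d))"
proof -
  define e where "e N = real_of_ereal (local_entropy (box_n N) (P_bar H PP n) (PP UNIV))" for N
  define c where "c = ln (real ((2 * n) ^ CARD('d)))"
  have n0: "0 < real n" using n by simp
  have bounds: "local_entropy (box_n N) (P_bar H PP n) (PP UNIV) = ereal (e N) \<and>
      (1 / (2 * real n) - 3 / 2 * (1 / real N)) ^ CARD('d) * ent - c / (2 * real N) ^ CARD('d) \<le> e N / (2 * real N) ^ CARD('d) \<and>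
      e N / (2 * real N) ^ CARD('d) \<le> (1 / (2 * real n) + 3 / 2 * (1 / real N)) ^ CARD('d) * ent"
    if "N \<ge> 4 * n" for N
  proof -
    define q where "q = N div (2 * n)"
    have N0: "0 < real N" using that n by simp
    have q1: "2 * n * q \<le> N" "N < 2 * n * (q + 1)"
      using n unfolding q_def by (simp_all add: dividend_less_times_div)
    have "2 * n * 1 \<le> N" using that by simp
    then have "1 \<le> q" using n unfolding q_def by (simp add: less_eq_div_iff_mult_less_eq)
    have q2: "2 * real n * real q \<le> real N" "real N < 2 * real n * (real q + 1)"
      using q1[folded of_nat_le_iff[where 'a=real] of_nat_less_iff[where 'a=real]] by (simp_all add: algebra_simps)
    obtain e' where e': "local_entropy (box_n N) (P_bar H PP n) (PP UNIV) = ereal e'"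
      "real ((2 * (q - 1) + 1) ^ CARD('d)) * ent - c \<le> e'" "e' \<le> real ((2 * (q + 1) + 1) ^ CARD('d)) * ent"
    proof -
      have "2 * n * (q - 1) + 2 * n \<le> N"
        using q1(1) \<open>1 \<le> q\<close> by (cases q) (simp_all add: algebra_simps)
      from local_entropy_bounds[OF less_imp_le[OF q1(2)] this] that show ?thesis
        unfolding c_def by blast
    qed
    have e: "local_entropy (box_n N) (P_bar H PP n) (PP UNIV) = ereal (e N)" "e' = e N"
      by (simp_all add: e_def e')
    \<comment> \<open>The condition \<open>4 n \<le> N\<close> makes the base nonnegative, so that taking powers is monotone.\<close>
    have low: "(real N / real n - 3) ^ CARD('d) \<le> real ((2 * (q - 1) + 1) ^ CARD('d))"
    proof -
      have "4 * real n \<le> real N" using that by (metis of_nat_le_iff of_nat_mult of_nat_numeral)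
      then have "0 \<le> real N / real n - 3" using n0 by (simp add: field_simps)
      moreover have "real N / real n - 3 \<le> real (2 * (q - 1) + 1)"
        using q2(2) n0 \<open>1 \<le> q\<close> by (simp add: field_simps of_nat_diff)
      ultimately show ?thesis unfolding of_nat_power by (intro power_mono)
    qed
    have up: "real ((2 * (q + 1) + 1) ^ CARD('d)) \<le> (real N / real n + 3) ^ CARD('d)"
    proof -
      have "real (2 * (q + 1) + 1) \<le> real N / real n + 3"
        using q2(1) n0 by (simp add: field_simps)
      then show ?thesis unfolding of_nat_power by (intro power_mono) auto
    qed
    have eqs: "1 / (2 * real n) - 3 / 2 * (1 / real N) = (real N / real n - 3) / (2 * real N)"
        "1 / (2 * real n) + 3 / 2 * (1 / real N) = (real N / real n + 3) / (2 * real N)"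
      using n0 N0 by (simp_all add: field_simps)
    have "((real N / real n - 3) ^ CARD('d) * ent - c) / (2 * real N) ^ CARD('d) \<le> e N / (2 * real N) ^ CARD('d)"
      using e'(2) mult_right_mono[OF low ent0] N0 unfolding e(2) by (intro divide_right_mono) auto
    moreover have "e N / (2 * real N) ^ CARD('d) \<le> ((real N / real n + 3) ^ CARD('d) * ent) / (2 * real N) ^ CARD('d)"
      using e'(3) mult_right_mono[OF up ent0] N0 unfolding e(2) by (intro divide_right_mono) auto
    ultimately show ?thesis
      unfolding eqs power_divide using e(1) by (simp add: diff_divide_distrib)
  qed
  have inv: "(\<lambda>N. 1 / real N) \<longlonglongrightarrow> 0"
    by (rule lim_1_over_n)
  have low: "(\<lambda>N. (1 / (2 * real n) - 3 / 2 * (1 / real N)) ^ CARD('d) * ent - c / (2 * real N) ^ CARD('d)) \<longlonglongrightarrow> ent / (2 * real n) ^ CARD('d)"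
  proof -
    have "(\<lambda>N. (1 / (2 * real n) - 3 / 2 * (1 / real N)) ^ CARD('d) * ent - c / 2 ^ CARD('d) * (1 / real N) ^ CARD('d))
       \<longlonglongrightarrow> (1 / (2 * real n) - 3 / 2 * 0) ^ CARD('d) * ent - c / 2 ^ CARD('d) * 0 ^ CARD('d)"
      by (intro tendsto_intros inv)
    then show ?thesis by (simp add: power_divide power_mult_distrib power_0_left)
  qed
  have up: "(\<lambda>N. (1 / (2 * real n) + 3 / 2 * (1 / real N)) ^ CARD('d) * ent) \<longlonglongrightarrow> ent / (2 * real n) ^ CARD('d)"
  proof -
    have "(\<lambda>N. (1 / (2 * real n) + 3 / 2 * (1 / real N)) ^ CARD('d) * ent)
       \<longlonglongrightarrow> (1 / (2 * real n) + 3 / 2 * 0) ^ CARD('d) * ent"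
      by (intro tendsto_intros inv)
    then show ?thesis by (simp add: power_divide)
  qed
  have ev: "\<forall>\<^sub>F N in sequentially. N \<ge> 4 * n" by (rule eventually_ge_at_top)
  have "(\<lambda>N. e N / (2 * real N) ^ CARD('d)) \<longlonglongrightarrow> ent / (2 * real n) ^ CARD('d)"
    by (rule tendsto_sandwich[OF _ _ low up]) (use bounds in \<open>auto intro!: eventually_mono[OF ev]\<close>)
  then have "(\<lambda>N. ereal (e N / (2 * real N) ^ CARD('d))) \<longlonglongrightarrow> ereal (ent / (2 * real n) ^ CARD('d))"
    by simp
  moreover have "\<forall>\<^sub>F N in sequentially. ereal (e N / (2 * real N) ^ CARD('d)) =
      local_entropy (box_n N) (P_bar H PP n) (PP UNIV) / ereal ((2 * real N) ^ CARD('d))"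
  proof (rule eventually_mono[OF ev])
    fix N assume N: "4 * n \<le> N"
    then have "(2 * real N) ^ CARD('d) \<noteq> 0" using n by simp
    then show "ereal (e N / (2 * real N) ^ CARD('d)) =
      local_entropy (box_n N) (P_bar H PP n) (PP UNIV) / ereal ((2 * real N) ^ CARD('d))"
      using bounds[OF N] by simp
  qed
  ultimately have "(\<lambda>N. local_entropy (box_n N) (P_bar H PP n) (PP UNIV) / ereal ((2 * real N) ^ CARD('d)))
      \<longlonglongrightarrow> ereal (ent / (2 * real n) ^ CARD('d))"
    by (rule Lim_transform_eventually)
  then show ?thesis
    unfolding specific_entropy_def by (rule limI)
qed

end

section \<open>The uniform bound\<close>

theorem proposition3p5:
  fixes z \<delta> :: real
    and R :: "'s::real_normed_vector measure"
    and H :: "('d::finite, 's) config \<Rightarrow> ereal"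
    and PP :: "(real ^ 'd) set \<Rightarrow> ('d, 's) config measure"
  assumes "z > 0" and "\<delta> > 0"
    and "prob_space R" and "sets R = sets borel"
    and "energy_functional H"
    and "\<And>\<Lambda>. \<Lambda> \<in> sets borel \<Longrightarrow> poisson_law (intensity z R \<Lambda>) (PP \<Lambda>)"
    and "mark_moment TYPE('d) \<delta> R"
    and "stable_energy \<delta> H"
    and "range_condition \<delta> H"
    and "locally_stable \<delta> H"
  shows "\<exists>a\<^sub>3::real. a\<^sub>3 > 0 \<and> (\<forall>n\<ge>1. specific_entropy (P_bar H PP n) (PP UNIV) \<le> ereal a\<^sub>3)"
proof -
  obtain a where a: "a > 0" and P: "\<And>n. P_box H PP n = density (PP (box_n n)) (\<lambda>\<gamma>. ennreal (gibbs_density H PP n \<gamma>)) \<and>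
      prob_space (P_box H PP n) \<and> integrable (P_box H PP n) (\<lambda>\<gamma>. ln (gibbs_density H PP n \<gamma>)) \<and>
      0 \<le> (\<integral>\<gamma>. ln (gibbs_density H PP n \<gamma>) \<partial>P_box H PP n) \<and>
      (\<integral>\<gamma>. ln (gibbs_density H PP n \<gamma>) \<partial>P_box H PP n) \<le> a * (2 * real n) ^ CARD('d)"
    using P_box_density[OF assms(1-8)] by blast
  have "specific_entropy (P_bar H PP n) (PP UNIV) \<le> ereal a" if n: "n \<ge> 1" for n
  proof -
    interpret gibbs_field z R H PP n
      by (rule gibbs_field.intro[OF n assms(3-6)]) (use P[of n] in blast)+
    have "0 \<le> ent" "ent \<le> a * (2 * real n) ^ CARD('d)"
      using P[of n] unfolding ent_def by blast+
    moreover have "0 < (2 * real n) ^ CARD('d)" using n by simp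
    ultimately show ?thesis
      by (subst specific_entropy_eq) (simp_all add: field_simps)
  qed
  with a show ?thesis by blast
qed

end
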